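(* Let $f,g\in L^2(\mathbb{R}^d)$. If $\mathrm{Re}\,W(f,g)(z)\neq 0$ for all $z\in\mathbb{R}^{2d}$, then there exist a generalized Gaussian $\gamma$ and $a,b\in\mathbb{C}$ such that $f=a\gamma$ and $g=b\gamma$. Similarly, if $\mathrm{Im}\,W(f,g)(z)\neq 0$ for all $z\in\mathbb{R}^{2d}$, then both $f$ and $g$ are generalized Gaussians.
   Context: The (cross-)Wigner distribution of $f,g\in L^2(\mathbb{R}^d)$ is $$W(f,g)(x,\xi)=\int_{\mathbb{R}^d} f\left(x+\tfrac{t}{2}\right)\overline{g\left(x-\tfrac{t}{2}\right)}\,e^{-2\pi i\langle\xi,t\rangle}\,dt,\qquad z=(x,\xi)\in\mathbb{R}^{2d}.$$ A generalized Gaussian is a function in $L^2(\mathbb{R}^d)$ of the form $e^{Q}$, where $Q$ is a polynomial of degree (at most) two on $\mathbb{R}^d$ with complex coefficients. Equalities of functions in $L^2$ are almost everywhere. *)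

theory Defs
  imports "HOL-Analysis.Analysis"
begin

text \<open>Elements of \<open>L\<^sup>2\<close> are represented by functions; equality in \<open>L\<^sup>2\<close> is equality almost everywhere
  with respect to Lebesgue measure.\<close>

definition square_integrable :: "(real ^ 'n \<Rightarrow> complex) \<Rightarrow> bool" where
  "square_integrable f \<longleftrightarrow>
     f \<in> borel_measurable lebesgue \<and> integrable lebesgue (\<lambda>x. (cmod (f x))\<^sup>2)"

definition wigner ::
  "(real ^ 'n \<Rightarrow> complex) \<Rightarrow> (real ^ 'n \<Rightarrow> complex) \<Rightarrow> (real ^ 'n) \<times> (real ^ 'n) \<Rightarrow> complex" where
  "wigner f g = (\<lambda>(x, \<xi>).
     LINT t|lebesgue. f (x + t /\<^sub>R 2) * cnj (g (x - t /\<^sub>R 2))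
       * exp (- 2 * of_real pi * \<i> * of_real (\<xi> \<bullet> t)))"

text \<open>The matrix \<open>A\<close> is not required to be symmetric and may vanish, so this covers all
  polynomial functions of total degree at most two.\<close>

definition quadratic_polynomial :: "(real ^ 'n \<Rightarrow> complex) \<Rightarrow> bool" where
  "quadratic_polynomial Q \<longleftrightarrow>
     (\<exists>(A :: complex ^ 'n ^ 'n) (b :: complex ^ 'n) (c :: complex). \<forall>x.
        Q x = (\<Sum>i\<in>UNIV. \<Sum>j\<in>UNIV. A $ i $ j * of_real (x $ i) * of_real (x $ j))
              + (\<Sum>i\<in>UNIV. b $ i * of_real (x $ i)) + c)"

definition generalized_gaussian :: "(real ^ 'n \<Rightarrow> complex) \<Rightarrow> bool" where
  "generalized_gaussian \<gamma> \<longleftrightarrow>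
     square_integrable \<gamma> \<and> (\<exists>Q. quadratic_polynomial Q \<and> (\<forall>x. \<gamma> x = exp (Q x)))"

end

theory Submission
  imports Defs "HOL-Complex_Analysis.Complex_Analysis" "HOL-Probability.Distributions"
begin

text \<open>
  Write \<open>W\<close> for the cross-Wigner distribution of \<open>f\<close> and \<open>g\<close>, and let \<open>F\<close>, \<open>G\<close> be the Bargmann transforms
  \<open>F z = \<integral> f u \<sqdot> exp (- \<pi> |u|\<^sup>2) \<sqdot> exp (2 \<pi> z \<sqdot> u) du\<close>, which are entire functions of \<open>z\<close> in complex \<open>n\<close>-space. The argument is
  Hudson's, with the real part of \<open>F\<close> times the conjugate of \<open>G\<close> in the role of the modulus of \<open>F\<close>.

  The function \<open>W\<close> is continuous on a connected space, so if its real part never vanishes, that real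
  part has a constant sign. Averaging \<open>W\<close> against the Gaussian centred at a phase space point \<open>(x, \<xi>)\<close>
  gives, up to a positive constant, the product of \<open>F\<close> and the conjugate of \<open>G\<close> at \<open>x - i \<xi>\<close>
  (\<open>wig_gaussian_average\<close>, \<open>Re_wig_pos_imp_bargmann\<close>): this is where a condition on the real part becomes a
  condition on holomorphic functions. So \<open>F \<sqdot> cnj G\<close> has, say, positive real part everywhere. Consequently
  neither \<open>F\<close> nor \<open>G\<close> has a zero, and \<open>F / G\<close> is entire along every complex line through the origin with
  values in a half plane, hence constant (\<open>bargmann_proportional\<close>). Since the transform is injective, \<open>f\<close> is
  a multiple of \<open>g\<close>. For the imaginary part nothing changes except that \<open>f\<close> is first multiplied by a
  suitable power of \<open>i\<close>; so in that case, too, \<open>f\<close> and \<open>g\<close> are even multiples of one Gaussian.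

  It remains to see that an \<open>L\<^sup>2\<close> function \<open>g\<close> whose transform \<open>G\<close> has no zeros is a Gaussian. Along every
  complex line through the origin \<open>G\<close> is a zero-free entire function of order at most two, hence the
  exponential of a quadratic polynomial in one variable. Its coefficients are determined by the first two
  derivatives at the origin, which are linear and quadratic in the direction of the line because they
  are moments of \<open>g u \<sqdot> exp (- \<pi> |u|\<^sup>2)\<close>. So \<open>G z = G 0 \<sqdot> exp (b \<sqdot> z + z \<sqdot> B z / 2)\<close> on the whole space
  (\<open>bargmann_zero_free_quadratic\<close>). On imaginary vectors
  \<open>G\<close> is the Fourier transform of an integrable function, so it tends to zero along every ray by the
  Riemann-Lebesgue lemma; therefore the real part of \<open>B\<close> is positive definite
  (\<open>bargmann_quadratic_pos_real_part\<close>). Then \<open>B\<close> is invertible, the inverse also has positive definite real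
  part, and the Gaussian built from the inverse of \<open>B\<close> has the same transform as \<open>g\<close>, by the
  \<open>n\<close>-dimensional Gaussian integral with a complex symmetric matrix (\<open>gauss_laplace_shift\<close>). Injectivity of
  the Fourier transform (\<open>fourier_injective\<close>) identifies the two functions.
\<close>

section \<open>Entire functions in one variable\<close>

text \<open>
  A function with values in the right half plane stays away from \<open>-1\<close>, so Liouville's theorem applies to
  \<open>1 / (1 + h)\<close>.
\<close>
lemma entire_Re_pos_constant:
  assumes hol: "h holomorphic_on UNIV" and pos: "\<And>z. Re (h z) > 0"
  shows "h z = h w"
proof -
  define k where "k = (\<lambda>z. 1 / (1 + h z))"
  have ge: "norm (1 + h z) \<ge> 1" for z
    using complex_Re_le_cmod[of "1 + h z"] pos[of z] by simp
  then have nz: "1 + h z \<noteq> 0" for z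
    by (metis norm_zero not_one_le_zero)
  have "k holomorphic_on UNIV"
    unfolding k_def by (intro holomorphic_intros hol) (use nz in auto)
  moreover have "bounded (range k)"
    unfolding bounded_iff k_def using ge by (intro exI[of _ 1]) (auto simp: norm_divide divide_le_eq_1)
  ultimately have "k constant_on UNIV"
    by (rule Liouville_theorem)
  then have "k z = k w"
    by (auto simp: constant_on_def)
  then show ?thesis
    using nz[of z] nz[of w] by (simp add: k_def)
qed

text \<open>
  This is a form of the Borel-Caratheodory inequality. The Moebius map \<open>w \<mapsto> w / (2 M - w)\<close> sends the half
  plane of numbers with real part below \<open>M\<close> into the unit disc and fixes the origin, so the Schwarz lemma applies after scaling.
\<close>
lemma norm_bound_from_Re_bound:
  assumes hol: "L holomorphic_on UNIV" and L0: "L 0 = 0"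
    and r: "r > 0" and M: "\<And>z. norm z < 2 * r \<Longrightarrow> Re (L z) < M" and z: "norm z \<le> r"
  shows "norm (L z) \<le> 2 * M"
proof -
  have M0: "0 < M" using M[of 0] r L0 by simp
  define g where "g = (\<lambda>\<zeta>. L (of_real (2 * r) * \<zeta>) / (of_real (2 * M) - L (of_real (2 * r) * \<zeta>)))"
  have ReL: "Re (L (of_real (2 * r) * \<zeta>)) < M" if "norm \<zeta> < 1" for \<zeta>
    using M[of "of_real (2 * r) * \<zeta>"] that r by (simp add: norm_mult)
  have den: "of_real (2 * M) - L (of_real (2 * r) * \<zeta>) \<noteq> 0" if "norm \<zeta> < 1" for \<zeta>
  proof
    assume "of_real (2 * M) - L (of_real (2 * r) * \<zeta>) = 0"
    then have "Re (L (of_real (2 * r) * \<zeta>)) = 2 * M" by (simp add: complex_eq_iff)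
    with ReL[OF that] M0 show False by simp
  qed
  have lt: "norm (g \<zeta>) < 1" if "norm \<zeta> < 1" for \<zeta>
  proof -
    define w where "w = L (of_real (2 * r) * \<zeta>)"
    \<comment> \<open>Points with real part below \<open>M\<close> are closer to \<open>0\<close> than to \<open>2 M\<close>.\<close>
    have "Re w < M" using ReL[OF that] by (simp add: w_def)
    then have "(Re w)\<^sup>2 < (2 * M - Re w)\<^sup>2"
      using M0 by (simp add: power2_eq_square algebra_simps)
    then have "(norm w)\<^sup>2 < (norm (of_real (2 * M) - w))\<^sup>2"
      by (simp add: cmod_power2)
    then have "norm w < norm (of_real (2 * M) - w)"
      by (simp add: power2_less_imp_less)
    then show ?thesis
      using den[OF that] by (auto simp: g_def norm_divide divide_less_eq w_def)
  qed
  have "(L \<circ> (\<lambda>\<zeta>. of_real (2 * r) * \<zeta>)) holomorphic_on ball 0 1"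
    by (intro holomorphic_on_compose holomorphic_intros holomorphic_on_subset[OF hol]) auto
  then have holg: "g holomorphic_on ball 0 1"
    unfolding g_def by (intro holomorphic_intros) (use den in \<open>auto simp: o_def\<close>)
  define \<zeta> where "\<zeta> = z / of_real (2 * r)"
  have \<zeta>: "norm \<zeta> \<le> 1/2" "of_real (2 * r) * \<zeta> = z"
    using z r by (auto simp: \<zeta>_def norm_divide)
  have "norm (g \<zeta>) \<le> norm \<zeta>"
    by (rule Schwarz_Lemma(1)[OF holg]) (use L0 lt \<zeta> in \<open>auto simp: g_def\<close>)
  then have "norm (g \<zeta>) \<le> 1/2" using \<zeta> by linarith
  then have "norm (L z) \<le> 1/2 * norm (of_real (2 * M) - L z)"
    using den[of \<zeta>] \<zeta> by (auto simp: g_def norm_divide divide_le_eq)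
  also have "norm (of_real (2 * M) - L z) \<le> 2 * M + norm (L z)"
    using norm_triangle_ineq4[of "2 * of_real M" "L z"] M0 by (simp add: norm_mult)
  finally show ?thesis by simp
qed

text \<open>
  A zero-free entire function has a holomorphic logarithm. The growth bound controls only the real part of
  the logarithm, but by \<open>norm_bound_from_Re_bound\<close> this also bounds its modulus, and Liouville's theorem for
  polynomial growth leaves a quadratic polynomial.
\<close>
lemma zero_free_order_two:
  assumes hol: "\<phi> holomorphic_on UNIV" and nz: "\<And>s. \<phi> s \<noteq> 0"
    and bd: "\<And>s. norm (\<phi> s) \<le> C * exp (K * (norm s)\<^sup>2)"
  obtains \<alpha> \<beta> where "\<And>s. \<phi> s = \<phi> 0 * exp (\<alpha> * s + \<beta> * s\<^sup>2)"
proof -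
  obtain L0 where hol0: "L0 holomorphic_on UNIV" and L0: "\<And>s. \<phi> s = exp (L0 s)"
    by (rule contractible_imp_holomorphic_log[OF hol convex_imp_contractible[OF convex_UNIV] nz]) auto
  define L where "L = (\<lambda>s. L0 s - L0 0)"
  have holL: "L holomorphic_on UNIV" unfolding L_def by (intro holomorphic_intros hol0)
  have C: "C > 0"
  proof -
    have "0 < norm (\<phi> 0)" using nz by simp
    also have "\<dots> \<le> C" using bd[of 0] by simp
    finally show ?thesis .
  qed
  define A where "A = \<bar>ln C - Re (L0 0)\<bar>"
  have ReL: "Re (L s) \<le> A + \<bar>K\<bar> * (norm s)\<^sup>2" for s
  proof -
    have "exp (Re (L0 s)) \<le> exp (ln C + K * (norm s)\<^sup>2)"
      using bd[of s] C by (simp add: L0 exp_add)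
    then have "Re (L0 s) \<le> ln C + K * (norm s)\<^sup>2" by simp
    moreover have "K * (norm s)\<^sup>2 \<le> \<bar>K\<bar> * (norm s)\<^sup>2"
      by (intro mult_right_mono) auto
    ultimately show ?thesis unfolding A_def L_def by simp
  qed
  have bdL: "norm (L z) \<le> (2 * (A + 1 + 4 * \<bar>K\<bar>)) * norm z ^ 2" if "1 \<le> norm z" for z
  proof -
    define r where "r = norm z"
    have r: "r \<ge> 1" using that by (simp add: r_def)
    have "norm (L z) \<le> 2 * (A + 1 + \<bar>K\<bar> * (2 * r)\<^sup>2)"
    proof (rule norm_bound_from_Re_bound[OF holL])
      show "Re (L w) < A + 1 + \<bar>K\<bar> * (2 * r)\<^sup>2" if "norm w < 2 * r" for w
      proof -
        have "\<bar>K\<bar> * (norm w)\<^sup>2 \<le> \<bar>K\<bar> * (2 * r)\<^sup>2"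
          using that by (intro mult_left_mono power_mono) auto
        then show ?thesis using ReL[of w] by linarith
      qed
    qed (use r in \<open>auto simp: L_def r_def\<close>)
    also have "\<dots> \<le> 2 * ((A + 1) * r\<^sup>2 + 4 * \<bar>K\<bar> * r\<^sup>2)"
    proof -
      have "(A + 1) * 1 \<le> (A + 1) * r\<^sup>2"
        using r by (intro mult_left_mono) (auto simp: A_def)
      then show ?thesis by (simp add: power_mult_distrib)
    qed
    finally show ?thesis by (simp add: r_def algebra_simps)
  qed
  define \<alpha> \<beta> where "\<alpha> = deriv L 0" and "\<beta> = (deriv ^^ 2) L 0 / 2"
  have Ls: "L s = \<alpha> * s + \<beta> * s\<^sup>2" for s
  proof -
    have "L s = (\<Sum>k\<le>2. (deriv^^k) L 0 / fact k * s ^ k)"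
      by (rule Liouville_polynomial[OF holL bdL])
    moreover have "L 0 = 0" by (simp add: L_def)
    ultimately show ?thesis
      by (simp add: numeral_2_eq_2 \<alpha>_def \<beta>_def)
  qed
  have \<phi>L: "\<phi> s = \<phi> 0 * exp (L s)" for s
    unfolding L_def exp_diff L0 by simp
  have "\<phi> s = \<phi> 0 * exp (\<alpha> * s + \<beta> * s\<^sup>2)" for s
    using \<phi>L[of s] unfolding Ls .
  then show ?thesis
    by (rule that)
qed

text \<open>
  Reading off the exponent from the derivatives at the origin is what later allows the exponents on
  different complex lines to be glued to one quadratic polynomial in several variables.
\<close>
lemma zero_free_order_two_jet:
  fixes \<phi> \<phi>' \<phi>'' :: "complex \<Rightarrow> complex"
  assumes d1: "\<And>s. (\<phi> has_field_derivative \<phi>' s) (at s)"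
    and d2: "\<And>s. (\<phi>' has_field_derivative \<phi>'' s) (at s)" and nz: "\<And>s. \<phi> s \<noteq> 0"
    and bd: "\<And>s. norm (\<phi> s) \<le> C * exp (K * (norm s)\<^sup>2)"
  shows "\<phi> s = \<phi> 0 * exp (\<phi>' 0 / \<phi> 0 * s + (\<phi>'' 0 / \<phi> 0 - (\<phi>' 0 / \<phi> 0)\<^sup>2) / 2 * s\<^sup>2)"
proof -
  have "\<phi> holomorphic_on UNIV"
    using d1 by (auto simp: holomorphic_on_def field_differentiable_def)
  then obtain \<alpha> \<beta> where \<phi>: "\<And>s. \<phi> s = \<phi> 0 * exp (\<alpha> * s + \<beta> * s\<^sup>2)"
    using zero_free_order_two[OF _ nz bd] by blast
  have D: "(\<phi> has_field_derivative \<phi> 0 * (exp (\<alpha> * s + \<beta> * s\<^sup>2) * (\<alpha> + 2 * \<beta> * s))) (at s)" for s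
  proof -
    have "((\<lambda>s. \<phi> 0 * exp (\<alpha> * s + \<beta> * s\<^sup>2)) has_field_derivative \<phi> 0 * (exp (\<alpha> * s + \<beta> * s\<^sup>2) * (\<alpha> + 2 * \<beta> * s))) (at s)"
      by (auto intro!: derivative_eq_intros)
    moreover have "(\<lambda>s. \<phi> 0 * exp (\<alpha> * s + \<beta> * s\<^sup>2)) = \<phi>"
      by (rule ext) (rule \<phi>[symmetric])
    ultimately show ?thesis
      by (rule back_subst[of "\<lambda>f. (f has_field_derivative _) (at s)"])
  qed
  have \<phi>': "\<phi>' = (\<lambda>s. \<phi> 0 * (exp (\<alpha> * s + \<beta> * s\<^sup>2) * (\<alpha> + 2 * \<beta> * s)))"
    by (rule ext) (rule DERIV_unique[OF d1 D])
  have D0: "((\<lambda>s. \<phi> 0 * (exp (\<alpha> * s + \<beta> * s\<^sup>2) * (\<alpha> + 2 * \<beta> * s))) has_field_derivative \<phi> 0 * (\<alpha>\<^sup>2 + 2 * \<beta>)) (at 0)"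
    by (auto intro!: derivative_eq_intros simp: power2_eq_square)
  have \<phi>'': "\<phi>'' 0 = \<phi> 0 * (\<alpha>\<^sup>2 + 2 * \<beta>)"
    by (rule DERIV_unique[OF d2[of 0, unfolded \<phi>'] D0])
  have \<alpha>: "\<phi>' 0 / \<phi> 0 = \<alpha>"
    using nz[of 0] by (simp add: \<phi>')
  have "\<phi>'' 0 / \<phi> 0 = \<alpha>\<^sup>2 + 2 * \<beta>"
    using nz[of 0] by (simp add: \<phi>'')
  then have \<beta>: "(\<phi>'' 0 / \<phi> 0 - \<alpha>\<^sup>2) / 2 = \<beta>"
    by simp
  show ?thesis
    unfolding \<alpha> \<beta> by (rule \<phi>)
qed

section \<open>Holomorphic parameter integrals\<close>

text \<open>
  Expanding the exponential and exchanging sum and integral is justified by the integrable majorant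
  \<open>|h| exp (|s| |p|)\<close>.
\<close>
lemma laplace_power_series:
  fixes h p :: "'a \<Rightarrow> complex"
  assumes [measurable]: "h \<in> borel_measurable M" "p \<in> borel_measurable M"
    and int: "\<And>r. r \<ge> 0 \<Longrightarrow> integrable M (\<lambda>u. norm (h u) * exp (r * norm (p u)))"
  shows "(\<lambda>n. (\<integral>u. h u * p u ^ n \<partial>M) / fact n * s ^ n) sums (\<integral>u. h u * exp (s * p u) \<partial>M)"
proof -
  define f where "f = (\<lambda>n u. h u * (s * p u) ^ n /\<^sub>R fact n)"
  have [measurable]: "f n \<in> borel_measurable M" for n
    unfolding f_def by measurable
  have nf: "norm (f n u) = norm (h u) * ((norm s * norm (p u)) ^ n /\<^sub>R fact n)" for n u
    by (simp add: f_def norm_mult norm_power)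
  have expsum: "(\<lambda>n. norm (f n u)) sums (norm (h u) * exp (norm s * norm (p u)))" for u
    unfolding nf by (intro sums_mult exp_converges)
  have part: "(\<Sum>n<N. norm (f n u)) \<le> norm (h u) * exp (norm s * norm (p u))" for N u
    using sum_le_suminf[OF sums_summable[OF expsum[of u]], of "{..<N}"] sums_unique[OF expsum[of u]]
    by simp
  have intf: "integrable M (f n)" for n
  proof (rule Bochner_Integration.integrable_bound[OF int[of "norm s"]])
    show "AE u in M. norm (f n u) \<le> norm (norm (h u) * exp (norm s * norm (p u)))"
    proof (intro always_eventually allI)
      fix u
      have "norm (f n u) \<le> (\<Sum>k<Suc n. norm (f k u))"
        by (rule member_le_sum) auto
      then show "norm (f n u) \<le> norm (norm (h u) * exp (norm s * norm (p u)))"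
        using part[of u "Suc n"] by simp
    qed
  qed auto
  have "(\<lambda>n. integral\<^sup>L M (f n)) sums (\<integral>u. (\<Sum>n. f n u) \<partial>M)"
  proof (rule sums_integral[OF intf])
    show "AE u in M. summable (\<lambda>n. norm (f n u))"
      using expsum sums_summable by blast
    show "summable (\<lambda>n. \<integral>u. norm (f n u) \<partial>M)"
    proof (rule bounded_imp_summable[where B="\<integral>u. norm (h u) * exp (norm s * norm (p u)) \<partial>M"])
      fix N
      have "(\<Sum>n\<le>N. \<integral>u. norm (f n u) \<partial>M) = (\<integral>u. (\<Sum>n\<le>N. norm (f n u)) \<partial>M)"
        using intf by (simp add: integrable_norm)
      also have "\<dots> \<le> (\<integral>u. norm (h u) * exp (norm s * norm (p u)) \<partial>M)"
        using intf part[of _ "Suc N"] int[of "norm s"]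
        by (intro integral_mono) (auto simp: lessThan_Suc_atMost)
      finally show "(\<Sum>n\<le>N. \<integral>u. norm (f n u) \<partial>M) \<le> \<dots>" .
    qed auto
  qed
  moreover have "(\<Sum>n. f n u) = h u * exp (s * p u)" for u
    unfolding f_def using sums_mult[OF exp_converges[of "s * p u"], of "h u"] by (auto simp: sums_iff)
  moreover have "integral\<^sup>L M (f n) = (\<integral>u. h u * p u ^ n \<partial>M) / fact n * s ^ n" for n
  proof -
    have "f n = (\<lambda>u. (s ^ n / fact n) * (h u * p u ^ n))"
      by (simp add: f_def power_mult_distrib scaleR_conv_of_real field_simps)
    then have "integral\<^sup>L M (f n) = (\<integral>u. (s ^ n / fact n) * (h u * p u ^ n) \<partial>M)"
      by (simp only:)
    also have "\<dots> = (s ^ n / fact n) * (\<integral>u. h u * p u ^ n \<partial>M)"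
      by (rule integral_mult_right_zero)
    finally show ?thesis by simp
  qed
  ultimately show ?thesis by simp
qed

text \<open>
  The derivative is again an integral of the same kind, with \<open>h\<close> replaced by \<open>h p\<close>; the second part says that
  the hypothesis is inherited, so that the lemma can be iterated.
\<close>
lemma laplace_has_field_derivative:
  fixes h p :: "'a \<Rightarrow> complex"
  assumes [measurable]: "h \<in> borel_measurable M" "p \<in> borel_measurable M"
    and int: "\<And>r. r \<ge> 0 \<Longrightarrow> integrable M (\<lambda>u. norm (h u) * exp (r * norm (p u)))"
  shows "((\<lambda>s. \<integral>u. h u * exp (s * p u) \<partial>M) has_field_derivative (\<integral>u. h u * p u * exp (s * p u) \<partial>M)) (at s)"
    and "\<And>r. r \<ge> 0 \<Longrightarrow> integrable M (\<lambda>u. norm (h u * p u) * exp (r * norm (p u)))"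
proof -
  show int': "integrable M (\<lambda>u. norm (h u * p u) * exp (r * norm (p u)))" if "r \<ge> 0" for r
  proof (rule Bochner_Integration.integrable_bound[OF int[of "r + 1"]])
    show "AE u in M. norm (norm (h u * p u) * exp (r * norm (p u))) \<le> norm (norm (h u) * exp ((r + 1) * norm (p u)))"
    proof (intro always_eventually allI)
      fix u
      have "norm (p u) \<le> exp (norm (p u))"
        using exp_ge_add_one_self[of "norm (p u)"] by linarith
      then show "norm (norm (h u * p u) * exp (r * norm (p u))) \<le> norm (norm (h u) * exp ((r + 1) * norm (p u)))"
        by (simp add: norm_mult algebra_simps exp_add mult_left_mono)
    qed
  qed (use that in auto)
  define c where "c = (\<lambda>n. (\<integral>u. h u * p u ^ n \<partial>M) / fact n)"
  have c: "(\<lambda>n. c n * s ^ n) sums (\<integral>u. h u * exp (s * p u) \<partial>M)" for s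
    unfolding c_def by (rule laplace_power_series[OF _ _ int]) measurable
  have dc: "diffs c n = (\<integral>u. h u * p u * p u ^ n \<partial>M) / fact n" for n
  proof -
    have "diffs c n = of_nat (Suc n) * ((\<integral>u. h u * p u ^ Suc n \<partial>M) / (of_nat (Suc n) * fact n))"
      by (simp only: diffs_def c_def fact_Suc of_nat_mult of_nat_fact)
    also have "\<dots> = (\<integral>u. h u * p u ^ Suc n \<partial>M) / fact n"
      by (simp del: of_nat_Suc power_Suc)
    also have "\<dots> = (\<integral>u. h u * p u * p u ^ n \<partial>M) / fact n"
      by (simp only: power_Suc mult.assoc)
    finally show ?thesis .
  qed
  have "(\<lambda>n. diffs c n * s ^ n) sums (\<integral>u. h u * p u * exp (s * p u) \<partial>M)" for s
    unfolding dc by (rule laplace_power_series[OF _ _ int']) measurable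
  then have "(\<Sum>n. diffs c n * s ^ n) = (\<integral>u. h u * p u * exp (s * p u) \<partial>M)"
    by (rule sums_unique[symmetric])
  moreover have "((\<lambda>x. \<Sum>n. c n * x ^ n) has_field_derivative (\<Sum>n. diffs c n * s ^ n)) (at s)"
    by (rule termdiffs_strong_converges_everywhere) (rule sums_summable[OF c])
  moreover have "(\<lambda>x. \<Sum>n. c n * x ^ n) = (\<lambda>s. \<integral>u. h u * exp (s * p u) \<partial>M)"
    by (rule ext) (rule sums_unique[OF c, symmetric])
  ultimately show "((\<lambda>s. \<integral>u. h u * exp (s * p u) \<partial>M) has_field_derivative (\<integral>u. h u * p u * exp (s * p u) \<partial>M)) (at s)"
    by simp
qed

section \<open>Square integrable functions and their approximation\<close>

lemma lborel_integrable_affine: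
  fixes f :: "'a::euclidean_space \<Rightarrow> 'b::{banach, second_countable_topology}"
  assumes f: "integrable lborel f" and c: "c \<noteq> 0"
  shows "integrable lborel (\<lambda>x. f (t + c *\<^sub>R x))"
proof -
  have [measurable]: "f \<in> borel_measurable borel" using f by auto
  have "integrable (density (distr lborel borel (\<lambda>x. t + c *\<^sub>R x)) (\<lambda>_. ennreal (\<bar>c\<bar>^DIM('a)))) f"
    using f lborel_affine[OF c, of t] by simp
  then have "integrable (distr lborel borel (\<lambda>x. t + c *\<^sub>R x)) (\<lambda>x. \<bar>c\<bar>^DIM('a) *\<^sub>R f x)"
    by (subst (asm) integrable_density) auto
  then have "integrable lborel (\<lambda>x. \<bar>c\<bar>^DIM('a) *\<^sub>R f (t + c *\<^sub>R x))"
    by (subst (asm) integrable_distr_eq) auto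
  then have "integrable lborel (\<lambda>x. inverse (\<bar>c\<bar>^DIM('a)) *\<^sub>R (\<bar>c\<bar>^DIM('a) *\<^sub>R f (t + c *\<^sub>R x)))"
    by (rule integrable_scaleR_right)
  then show ?thesis using c by simp
qed

lemma lborel_integral_affine:
  fixes f :: "'a::euclidean_space \<Rightarrow> 'b::{banach, second_countable_topology}"
  assumes [measurable]: "f \<in> borel_measurable borel" and c: "c \<noteq> 0"
  shows "integral\<^sup>L lborel f = \<bar>c\<bar>^DIM('a) *\<^sub>R (\<integral>x. f (t + c *\<^sub>R x) \<partial>lborel)"
proof -
  have "integral\<^sup>L lborel f = integral\<^sup>L (density (distr lborel borel (\<lambda>x. t + c *\<^sub>R x)) (\<lambda>_. ennreal (\<bar>c\<bar>^DIM('a)))) f"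
    using lborel_affine[OF c, of t] by simp
  also have "\<dots> = \<bar>c\<bar>^DIM('a) *\<^sub>R (\<integral>x. f (t + c *\<^sub>R x) \<partial>lborel)"
    by (subst integral_density) (auto simp: integral_distr)
  finally show ?thesis .
qed

text \<open>
  Borel rather than Lebesgue measurable representatives: integrands such as \<open>(x, s) \<mapsto> f (x + s)\<close> are then
  measurable for the product sigma-algebra, as Fubini's theorem requires.
\<close>
definition borel_L2 :: "('a::euclidean_space \<Rightarrow> complex) \<Rightarrow> bool" where
  "borel_L2 f \<longleftrightarrow> f \<in> borel_measurable borel \<and> integrable lborel (\<lambda>x. (cmod (f x))\<^sup>2)"

lemma borel_L2_measurable [measurable_dest]: "borel_L2 f \<Longrightarrow> f \<in> borel_measurable borel"
  by (simp add: borel_L2_def)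

lemma borel_L2_integrable: "borel_L2 f \<Longrightarrow> integrable lborel (\<lambda>x. (cmod (f x))\<^sup>2)"
  by (simp add: borel_L2_def)

lemma borel_L2_mult_integrable:
  assumes "borel_L2 f" "borel_L2 g"
  shows "integrable lborel (\<lambda>x. f x * g x)"
proof (rule Bochner_Integration.integrable_bound)
  show "integrable lborel (\<lambda>x. (cmod (f x))\<^sup>2 + (cmod (g x))\<^sup>2)"
    by (intro Bochner_Integration.integrable_add borel_L2_integrable assms)
  have "cmod (f x * g x) \<le> norm ((cmod (f x))\<^sup>2 + (cmod (g x))\<^sup>2)" for x
  proof -
    have "0 \<le> cmod (f x) * cmod (g x)" by simp
    then show ?thesis
      using sum_squares_bound[of "cmod (f x)" "cmod (g x)"] unfolding norm_mult real_norm_def by linarith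
  qed
  then show "AE x in lborel. cmod (f x * g x) \<le> norm ((cmod (f x))\<^sup>2 + (cmod (g x))\<^sup>2)"
    by simp
  note [measurable] = assms[THEN borel_L2_measurable]
  show "(\<lambda>x. f x * g x) \<in> borel_measurable lborel" by simp
qed

lemma borel_L2_Cauchy_Schwarz:
  assumes f: "borel_L2 f" and g: "borel_L2 g"
  shows "(\<integral>x. cmod (f x * g x) \<partial>lborel)\<^sup>2 \<le> (\<integral>x. (cmod (f x))\<^sup>2 \<partial>lborel) * (\<integral>x. (cmod (g x))\<^sup>2 \<partial>lborel)"
proof -
  note [measurable] = assms[THEN borel_L2_measurable]
  have "(\<integral>\<^sup>+x. ennreal (cmod (f x)) * ennreal (cmod (g x)) \<partial>lborel)\<^sup>2
      \<le> (\<integral>\<^sup>+x. (ennreal (cmod (f x)))^2 \<partial>lborel) * (\<integral>\<^sup>+x. (ennreal (cmod (g x)))^2 \<partial>lborel)"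
    by (rule Cauchy_Schwarz_nn_integral) auto
  then have "(\<integral>\<^sup>+x. ennreal (cmod (f x * g x)) \<partial>lborel)\<^sup>2
      \<le> (\<integral>\<^sup>+x. ennreal ((cmod (f x))\<^sup>2) \<partial>lborel) * (\<integral>\<^sup>+x. ennreal ((cmod (g x))\<^sup>2) \<partial>lborel)"
    by (simp add: ennreal_mult' norm_mult ennreal_power)
  then show ?thesis
    using borel_L2_integrable[OF f] borel_L2_integrable[OF g] integrable_norm[OF borel_L2_mult_integrable[OF f g]]
    by (simp add: nn_integral_eq_integral ennreal_power ennreal_mult'[symmetric])
qed

lemma borel_L2_affine:
  assumes f: "borel_L2 f" and c: "c \<noteq> 0"
  shows "borel_L2 (\<lambda>x. f (t + c *\<^sub>R x))"
  unfolding borel_L2_def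
proof
  note [measurable] = borel_L2_measurable[OF f]
  show "(\<lambda>x. f (t + c *\<^sub>R x)) \<in> borel_measurable borel" by measurable
  show "integrable lborel (\<lambda>x. (cmod (f (t + c *\<^sub>R x)))\<^sup>2)"
    by (rule lborel_integrable_affine[OF borel_L2_integrable[OF f] c])
qed

lemma borel_L2_cnj: "borel_L2 f \<Longrightarrow> borel_L2 (\<lambda>x. cnj (f x))"
  using measurable_compose[of f borel borel cnj borel] borel_measurable_continuous_onI[of cnj]
  by (simp add: borel_L2_def continuous_on_cnj)

lemma borel_L2_cmult: "borel_L2 f \<Longrightarrow> borel_L2 (\<lambda>x. c * f x)"
  using borel_measurable_times[of "\<lambda>x. c" borel f] by (simp add: borel_L2_def norm_mult power_mult_distrib)

lemma borel_L2_diff: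
  assumes "borel_L2 f" "borel_L2 g"
  shows "borel_L2 (\<lambda>x. f x - g x)"
  unfolding borel_L2_def
proof
  note [measurable] = assms[THEN borel_L2_measurable]
  show m: "(\<lambda>x. f x - g x) \<in> borel_measurable borel" by measurable
  show "integrable lborel (\<lambda>x. (cmod (f x - g x))\<^sup>2)"
  proof (rule Bochner_Integration.integrable_bound)
    show "integrable lborel (\<lambda>x. 2 * (cmod (f x))\<^sup>2 + 2 * (cmod (g x))\<^sup>2)"
      by (intro Bochner_Integration.integrable_add integrable_mult_right borel_L2_integrable assms)
    have "(cmod (f x - g x))\<^sup>2 \<le> 2 * (cmod (f x))\<^sup>2 + 2 * (cmod (g x))\<^sup>2" for x
    proof -
      have "(cmod (f x - g x))\<^sup>2 \<le> (cmod (f x) + cmod (g x))\<^sup>2"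
        by (intro power_mono norm_triangle_ineq4) auto
      also have "\<dots> \<le> 2 * (cmod (f x))\<^sup>2 + 2 * (cmod (g x))\<^sup>2"
        using sum_squares_bound[of "cmod (f x)" "cmod (g x)"] by (simp add: power2_sum)
      finally show ?thesis .
    qed
    then show "AE x in lborel. norm ((cmod (f x - g x))\<^sup>2) \<le> norm (2 * (cmod (f x))\<^sup>2 + 2 * (cmod (g x))\<^sup>2)"
      by simp
  qed (use m in measurable)
qed

definition cts_bdd_supp :: "('a::euclidean_space \<Rightarrow> complex) \<Rightarrow> bool" where
  "cts_bdd_supp \<phi> \<longleftrightarrow> continuous_on UNIV \<phi> \<and> (\<exists>R. \<forall>x. norm x > R \<longrightarrow> \<phi> x = 0)"

lemma cts_bdd_supp_bound:
  fixes \<phi> :: "'a::euclidean_space \<Rightarrow> complex"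
  assumes "cts_bdd_supp \<phi>"
  obtains B R where "\<And>x. norm (\<phi> x) \<le> B" "B > 0" "R > 0" "\<And>x. norm x > R \<Longrightarrow> \<phi> x = 0"
proof -
  obtain R where R: "\<And>x. norm x > R \<Longrightarrow> \<phi> x = 0" and c: "continuous_on UNIV \<phi>"
    using assms by (auto simp: cts_bdd_supp_def)
  have "compact (\<phi> ` cball 0 R)"
    by (intro compact_continuous_image continuous_on_subset[OF c]) auto
  then obtain B where B: "B > 0" "\<And>y. y \<in> \<phi> ` cball 0 R \<Longrightarrow> norm y \<le> B"
    using compact_imp_bounded bounded_pos by metis
  have "norm (\<phi> x) \<le> B" for x
    using B R[of x] by (cases "norm x > R") auto
  moreover have "\<phi> x = 0" if "norm x > max R 1" for x
    using that R by auto
  ultimately show ?thesis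
    using B(1) that[of B "max R 1"] by auto
qed

lemma integrable_indicator_cball:
  "integrable lborel (\<lambda>x. B * indicator (cball (a :: 'a::euclidean_space) R) x :: real)"
  by (intro integrable_mult_right integrable_real_indicator) (auto simp: emeasure_lborel_cball_finite[unfolded infinity_ennreal_def])

lemma cts_bdd_supp_L2:
  assumes "cts_bdd_supp \<phi>"
  shows "borel_L2 \<phi>"
  unfolding borel_L2_def
proof
  obtain B R where B: "\<And>x. norm (\<phi> x) \<le> B" "B > 0" "R > 0" "\<And>x. norm x > R \<Longrightarrow> \<phi> x = 0"
    using cts_bdd_supp_bound[OF assms] by blast
  show m [measurable]: "\<phi> \<in> borel_measurable borel"
    using assms by (auto simp: cts_bdd_supp_def intro: borel_measurable_continuous_onI)
  show "integrable lborel (\<lambda>x. (cmod (\<phi> x))\<^sup>2)"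
  proof (rule Bochner_Integration.integrable_bound[OF integrable_indicator_cball[of "B\<^sup>2" 0 R]])
    have "norm ((cmod (\<phi> x))\<^sup>2) \<le> norm (B\<^sup>2 * indicator (cball 0 R) x)" for x
      using B(1)[of x] B(4)[of x] by (cases "norm x > R") (auto intro: power_mono)
    then show "AE x in lborel. norm ((cmod (\<phi> x))\<^sup>2) \<le> norm (B\<^sup>2 * indicator (cball 0 R) x)"
      by simp
  qed auto
qed

lemma AE_lborel_continuous_limit:
  fixes f :: "'a::euclidean_space \<Rightarrow> complex"
  assumes "f \<in> borel_measurable borel"
  obtains g :: "nat \<Rightarrow> 'a \<Rightarrow> complex"
  where "\<And>n. continuous_on UNIV (g n)" "AE x in lborel. (\<lambda>n. g n x) \<longlonglongrightarrow> f x"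
proof -
  have "f \<in> borel_measurable lebesgue"
    using assms by (intro measurable_completion) simp
  then have "f measurable_on UNIV"
    by (intro lebesgue_measurable_imp_measurable_on) auto
  then obtain N g where N: "negligible N" and g: "\<And>n. continuous_on UNIV (g n)"
    and lim: "\<And>x. x \<notin> N \<Longrightarrow> (\<lambda>n. g n x) \<longlonglongrightarrow> f x"
    unfolding measurable_on_def by auto
  have "AE x in lebesgue. x \<notin> N"
    using N by (intro AE_not_in) (simp add: negligible_iff_null_sets)
  then have "AE x in lborel. x \<notin> N"
    by (simp add: AE_completion_iff)
  then have "AE x in lborel. (\<lambda>n. g n x) \<longlonglongrightarrow> f x"
    by eventually_elim (rule lim)
  with g show ?thesis by (rule that)
qed

text \<open>
  The radial retraction onto the disc of radius \<open>r\<close>.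
\<close>
definition radial_clamp :: "real \<Rightarrow> complex \<Rightarrow> complex" where
  "radial_clamp r w = w /\<^sub>R max 1 (norm w / r)"

lemma continuous_radial_clamp: "continuous_on UNIV (radial_clamp r)"
  unfolding radial_clamp_def divide_inverse
  by (intro continuous_intros) (auto simp: max_def)

lemma norm_radial_clamp_le: "norm (radial_clamp r w) \<le> norm w"
proof -
  have "norm w / max 1 (norm w / r) \<le> norm w / 1"
    by (intro divide_left_mono) auto
  then show ?thesis by (simp add: radial_clamp_def divide_inverse mult.commute)
qed

lemma norm_radial_clamp_le_radius:
  assumes "r > 0"
  shows "norm (radial_clamp r w) \<le> r"
proof (cases "norm w \<le> r")
  case True
  then show ?thesis using norm_radial_clamp_le[of r w] by simp
next
  case False
  then have "max 1 (norm w / r) = norm w / r"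
    using assms by (auto simp: max_def field_simps)
  then show ?thesis using False assms by (auto simp: radial_clamp_def)
qed

lemma radial_clamp_eq: "norm w \<le> r \<Longrightarrow> r > 0 \<Longrightarrow> radial_clamp r w = w"
  by (simp add: radial_clamp_def max_def field_simps)

definition cutoff :: "nat \<Rightarrow> 'a::euclidean_space \<Rightarrow> real" where
  "cutoff N x = max 0 (min 1 (real N + 1 - norm x))"

lemma cutoff_bounds: "0 \<le> cutoff N x" "cutoff N x \<le> 1"
  by (auto simp: cutoff_def)

lemma continuous_cutoff: "continuous_on UNIV (cutoff N)"
  unfolding cutoff_def by (intro continuous_intros)

lemma cutoff_eq_1: "norm x \<le> real N \<Longrightarrow> cutoff N x = 1"
  by (simp add: cutoff_def)

lemma cutoff_eq_0: "norm x > real N + 1 \<Longrightarrow> cutoff N x = 0"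
  by (simp add: cutoff_def)

text \<open>
  Every measurable function is an almost everywhere limit of continuous functions. Truncating both \<open>f\<close> and
  the approximants in the same way, in space and in size, provides a majorant for dominated convergence in
  the inner limit; the outer limit removes the truncation.
\<close>
lemma cts_bdd_supp_dense:
  fixes f :: "'a::euclidean_space \<Rightarrow> complex"
  assumes f: "borel_L2 f" and e: "e > 0"
  obtains \<phi> where "cts_bdd_supp \<phi>" "(\<integral>x. (cmod (f x - \<phi> x))\<^sup>2 \<partial>lborel) < e"
proof -
  note [measurable] = borel_L2_measurable[OF f]
  note [measurable] = borel_measurable_continuous_onI[OF continuous_radial_clamp] borel_measurable_continuous_onI[OF continuous_cutoff]
  obtain g where cg: "\<And>n. continuous_on UNIV (g n)" and g: "AE x in lborel. (\<lambda>n. g n x) \<longlonglongrightarrow> f x"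
    using AE_lborel_continuous_limit[OF borel_L2_measurable[OF f]] by blast
  note [measurable] = borel_measurable_continuous_onI[OF cg]
  define F where "F = (\<lambda>N x. cutoff N x *\<^sub>R radial_clamp (real (Suc N)) (f x))"
  define \<Phi> where "\<Phi> = (\<lambda>N n x. cutoff N x *\<^sub>R radial_clamp (real (Suc N)) (g n x))"
  have Fm [measurable]: "F N \<in> borel_measurable borel" for N
    unfolding F_def by measurable
  have \<Phi>m [measurable]: "\<Phi> N n \<in> borel_measurable borel" for N n
    unfolding \<Phi>_def by measurable
  have nF: "norm (F N x) \<le> norm (f x)" for N x
  proof -
    have "cutoff N x * norm (radial_clamp (real (Suc N)) (f x)) \<le> 1 * norm (f x)"
      by (intro mult_mono cutoff_bounds norm_radial_clamp_le) auto
    then show ?thesis by (simp add: F_def cutoff_bounds)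
  qed
  have bnd: "norm (cutoff N x *\<^sub>R radial_clamp (real (Suc N)) w) \<le> real (Suc N) * indicator (cball 0 (real N + 1)) x" for N x w
  proof (cases "norm x > real N + 1")
    case False
    have "cutoff N x * norm (radial_clamp (real (Suc N)) w) \<le> 1 * real (Suc N)"
      by (intro mult_mono cutoff_bounds norm_radial_clamp_le_radius) auto
    then show ?thesis using False by (simp add: cutoff_bounds)
  qed (simp add: cutoff_eq_0)
  have "(\<lambda>N. \<integral>x. (cmod (f x - F N x))\<^sup>2 \<partial>lborel) \<longlonglongrightarrow> (\<integral>x. 0 \<partial>(lborel :: 'a measure))"
  proof (rule integral_dominated_convergence)
    show "integrable lborel (\<lambda>x. 4 * (cmod (f x))\<^sup>2)"
      using borel_L2_integrable[OF f] by simp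
    show "AE x in lborel. (\<lambda>N. (cmod (f x - F N x))\<^sup>2) \<longlonglongrightarrow> 0"
    proof (intro always_eventually allI)
      fix x
      obtain N0 where N0: "real N0 \<ge> max (norm x) (norm (f x))"
        using real_arch_simple by blast
      have "\<forall>\<^sub>F N in sequentially. (cmod (f x - F N x))\<^sup>2 = 0"
        using eventually_ge_at_top[of N0]
      proof eventually_elim
        case (elim N)
        then have "real N \<ge> real N0" by simp
        then have "norm x \<le> real N" "norm (f x) \<le> real (Suc N)"
          using N0 by auto
        then have "F N x = f x" by (simp add: F_def cutoff_eq_1 radial_clamp_eq del: of_nat_Suc)
        then show ?case by simp
      qed
      then show "(\<lambda>N. (cmod (f x - F N x))\<^sup>2) \<longlonglongrightarrow> 0"
        by (rule tendsto_eventually)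
    qed
    show "AE x in lborel. norm ((cmod (f x - F N x))\<^sup>2) \<le> 4 * (cmod (f x))\<^sup>2" for N
    proof (intro always_eventually allI)
      fix x
      have "cmod (f x - F N x) \<le> 2 * cmod (f x)"
        using norm_triangle_ineq4[of "f x" "F N x"] nF[of N x] by simp
      then have "(cmod (f x - F N x))\<^sup>2 \<le> (2 * cmod (f x))\<^sup>2"
        by (intro power_mono) auto
      then show "norm ((cmod (f x - F N x))\<^sup>2) \<le> 4 * (cmod (f x))\<^sup>2"
        by (simp add: power_mult_distrib)
    qed
  qed auto
  then have "\<forall>\<^sub>F N in sequentially. (\<integral>x. (cmod (f x - F N x))\<^sup>2 \<partial>lborel) < e / 4"
    using e by (intro order_tendstoD(2)[where y=0]) auto
  then obtain N where N: "(\<integral>x. (cmod (f x - F N x))\<^sup>2 \<partial>lborel) < e / 4"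
    by (auto simp: eventually_sequentially)
  have "(\<lambda>n. \<integral>x. (cmod (F N x - \<Phi> N n x))\<^sup>2 \<partial>lborel) \<longlonglongrightarrow> (\<integral>x. 0 \<partial>(lborel :: 'a measure))"
  proof (rule integral_dominated_convergence)
    show "integrable lborel (\<lambda>x. (2 * real (Suc N))\<^sup>2 * indicator (cball 0 (real N + 1)) x :: real)"
      by (rule integrable_indicator_cball)
    show "AE x in lborel. (\<lambda>n. (cmod (F N x - \<Phi> N n x))\<^sup>2) \<longlonglongrightarrow> 0"
      using g
    proof eventually_elim
      case (elim x)
      have "isCont (radial_clamp (real (Suc N))) (f x)"
        using continuous_radial_clamp by (simp add: continuous_on_eq_continuous_at)
      then have "(\<lambda>n. radial_clamp (real (Suc N)) (g n x)) \<longlonglongrightarrow> radial_clamp (real (Suc N)) (f x)"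
        using elim isCont_tendsto_compose by blast
      then have "(\<lambda>n. (cmod (F N x - \<Phi> N n x))\<^sup>2) \<longlonglongrightarrow> (cmod (F N x - F N x))\<^sup>2"
        unfolding F_def \<Phi>_def by (intro tendsto_intros)
      then show ?case by simp
    qed
    show "AE x in lborel. norm ((cmod (F N x - \<Phi> N n x))\<^sup>2) \<le> (2 * real (Suc N))\<^sup>2 * indicator (cball 0 (real N + 1)) x" for n
    proof (intro always_eventually allI)
      fix x
      have "cmod (F N x - \<Phi> N n x) \<le> 2 * (real (Suc N) * indicator (cball 0 (real N + 1)) x)"
        using norm_triangle_ineq4[of "F N x" "\<Phi> N n x"] bnd[of N x "f x"] bnd[of N x "g n x"]
        unfolding F_def \<Phi>_def by linarith
      then have "(cmod (F N x - \<Phi> N n x))\<^sup>2 \<le> (2 * (real (Suc N) * indicator (cball 0 (real N + 1)) x))\<^sup>2"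
        by (intro power_mono) auto
      also have "\<dots> = (2 * real (Suc N))\<^sup>2 * indicator (cball 0 (real N + 1)) x"
        by (simp add: indicator_def power_mult_distrib del: of_nat_Suc)
      finally show "norm ((cmod (F N x - \<Phi> N n x))\<^sup>2) \<le> (2 * real (Suc N))\<^sup>2 * indicator (cball 0 (real N + 1)) x"
        by simp
    qed
  qed auto
  then have "\<forall>\<^sub>F n in sequentially. (\<integral>x. (cmod (F N x - \<Phi> N n x))\<^sup>2 \<partial>lborel) < e / 4"
    using e by (intro order_tendstoD(2)[where y=0]) auto
  then obtain n where n: "(\<integral>x. (cmod (F N x - \<Phi> N n x))\<^sup>2 \<partial>lborel) < e / 4"
    by (auto simp: eventually_sequentially)
  have \<Phi>: "cts_bdd_supp (\<Phi> N n)"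
    unfolding cts_bdd_supp_def
  proof
    have "continuous_on UNIV (\<lambda>x. radial_clamp (real (Suc N)) (g n x))"
      using continuous_on_compose2[OF continuous_radial_clamp cg] by simp
    then show "continuous_on UNIV (\<Phi> N n)"
      unfolding \<Phi>_def by (intro continuous_intros continuous_cutoff)
    show "\<exists>R. \<forall>x. R < norm x \<longrightarrow> \<Phi> N n x = 0"
      by (intro exI[of _ "real N + 1"]) (simp add: \<Phi>_def cutoff_eq_0)
  qed
  have F2: "borel_L2 (F N)"
    unfolding borel_L2_def
  proof
    show "integrable lborel (\<lambda>x. (cmod (F N x))\<^sup>2)"
      by (rule Bochner_Integration.integrable_bound[OF borel_L2_integrable[OF f]]) (auto intro!: power_mono nF)
  qed simp
  have i1: "integrable lborel (\<lambda>x. (cmod (f x - F N x))\<^sup>2)"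
    by (intro borel_L2_integrable borel_L2_diff f F2)
  have i2: "integrable lborel (\<lambda>x. (cmod (F N x - \<Phi> N n x))\<^sup>2)"
    by (intro borel_L2_integrable borel_L2_diff cts_bdd_supp_L2 \<Phi> F2)
  have "(\<integral>x. (cmod (f x - \<Phi> N n x))\<^sup>2 \<partial>lborel)
      \<le> (\<integral>x. 2 * (cmod (f x - F N x))\<^sup>2 + 2 * (cmod (F N x - \<Phi> N n x))\<^sup>2 \<partial>lborel)"
  proof (rule integral_mono)
    show "integrable lborel (\<lambda>x. (cmod (f x - \<Phi> N n x))\<^sup>2)"
      by (intro borel_L2_integrable borel_L2_diff cts_bdd_supp_L2 \<Phi> f)
    show "(cmod (f x - \<Phi> N n x))\<^sup>2 \<le> 2 * (cmod (f x - F N x))\<^sup>2 + 2 * (cmod (F N x - \<Phi> N n x))\<^sup>2" for x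
    proof -
      have "(cmod (f x - \<Phi> N n x))\<^sup>2 \<le> (cmod (f x - F N x) + cmod (F N x - \<Phi> N n x))\<^sup>2"
        using norm_triangle_ineq[of "f x - F N x" "F N x - \<Phi> N n x"] by (intro power_mono) auto
      also have "\<dots> \<le> 2 * (cmod (f x - F N x))\<^sup>2 + 2 * (cmod (F N x - \<Phi> N n x))\<^sup>2"
        using sum_squares_bound[of "cmod (f x - F N x)" "cmod (F N x - \<Phi> N n x)"] by (simp add: power2_sum)
      finally show ?thesis .
    qed
  qed (use i1 i2 in auto)
  also have "\<dots> = 2 * (\<integral>x. (cmod (f x - F N x))\<^sup>2 \<partial>lborel) + 2 * (\<integral>x. (cmod (F N x - \<Phi> N n x))\<^sup>2 \<partial>lborel)"
    using i1 i2 by simp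
  also have "\<dots> < e" using N n by simp
  finally show ?thesis using that \<Phi> by blast
qed

section \<open>Continuity of the Wigner distribution\<close>

text \<open>
  The Wigner distribution after the substitution \<open>t = 2 s\<close>, without the factor that this produces. Both
  arguments are then translates and reflections of \<open>s\<close> by \<open>x\<close>, and no halves occur.
\<close>
definition wig :: "('a::euclidean_space \<Rightarrow> complex) \<Rightarrow> ('a \<Rightarrow> complex) \<Rightarrow> 'a \<times> 'a \<Rightarrow> complex" where
  "wig f g = (\<lambda>(x, \<xi>). \<integral>s. f (x + s) * cnj (g (x - s)) * cis (- (4 * pi * (\<xi> \<bullet> s))) \<partial>lborel)"

lemma borel_measurable_cnj [measurable]: "cnj \<in> borel_measurable borel"
  by (intro borel_measurable_continuous_onI continuous_intros)

lemma borel_measurable_cis [measurable]: "cis \<in> borel_measurable borel"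
  by (intro borel_measurable_continuous_onI continuous_on_cis continuous_intros)

lemma wig_factors_L2:
  assumes "borel_L2 f" "borel_L2 g"
  shows "borel_L2 (\<lambda>s. f (x + s))" "borel_L2 (\<lambda>s. cnj (g (x - s)))"
  using borel_L2_affine[OF assms(1), of 1 x] borel_L2_cnj[OF borel_L2_affine[OF assms(2), of "-1" x]] by simp_all

lemma wig_integrable:
  assumes f: "borel_L2 f" and g: "borel_L2 g"
  shows "integrable lborel (\<lambda>s. f (x + s) * cnj (g (x - s)) * cis (- (4 * pi * (\<xi> \<bullet> s))))"
proof (rule Bochner_Integration.integrable_bound)
  show "integrable lborel (\<lambda>s. f (x + s) * cnj (g (x - s)))"
    by (rule borel_L2_mult_integrable[OF wig_factors_L2[OF f g]])
  note [measurable] = assms[THEN borel_L2_measurable]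
  show "(\<lambda>s. f (x + s) * cnj (g (x - s)) * cis (- (4 * pi * (\<xi> \<bullet> s)))) \<in> borel_measurable lborel"
    by measurable
qed (simp add: norm_mult)

text \<open>
  By the Cauchy-Schwarz inequality, since translation and reflection preserve the \<open>L\<^sup>2\<close> norm. The bound does
  not depend on \<open>z\<close>, which turns \<open>L\<^sup>2\<close> approximation into uniform approximation.
\<close>
lemma norm_wig_le:
  assumes f: "borel_L2 f" and g: "borel_L2 g"
  shows "cmod (wig f g z) \<le> sqrt (\<integral>u. (cmod (f u))\<^sup>2 \<partial>lborel) * sqrt (\<integral>u. (cmod (g u))\<^sup>2 \<partial>lborel)"
proof -
  obtain x \<xi> where z: "z = (x, \<xi>)" by (cases z)
  note [measurable] = assms[THEN borel_L2_measurable]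
  let ?F = "\<lambda>s. f (x + s)" and ?G = "\<lambda>s. cnj (g (x - s))"
  have "cmod (wig f g z) \<le> (\<integral>s. cmod (?F s * ?G s * cis (- (4 * pi * (\<xi> \<bullet> s)))) \<partial>lborel)"
    unfolding wig_def z by simp
  also have "\<dots> = (\<integral>s. cmod (?F s * ?G s) \<partial>lborel)"
    by (simp add: norm_mult)
  also have "\<dots> \<le> sqrt ((\<integral>s. (cmod (?F s))\<^sup>2 \<partial>lborel) * (\<integral>s. (cmod (?G s))\<^sup>2 \<partial>lborel))"
    by (rule real_le_rsqrt) (rule borel_L2_Cauchy_Schwarz[OF wig_factors_L2[OF f g]])
  also have "(\<integral>s. (cmod (?F s))\<^sup>2 \<partial>lborel) = (\<integral>u. (cmod (f u))\<^sup>2 \<partial>lborel)"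
    using lborel_integral_affine[of "\<lambda>u. (cmod (f u))\<^sup>2" 1 x] by simp
  also have "(\<integral>s. (cmod (?G s))\<^sup>2 \<partial>lborel) = (\<integral>u. (cmod (g u))\<^sup>2 \<partial>lborel)"
    using lborel_integral_affine[of "\<lambda>u. (cmod (g u))\<^sup>2" "-1" x] by simp
  finally show ?thesis by (simp add: real_sqrt_mult)
qed

lemma wig_diff_left:
  assumes "borel_L2 f" "borel_L2 f'" "borel_L2 g"
  shows "wig (\<lambda>x. f x - f' x) g z = wig f g z - wig f' g z"
  unfolding wig_def using assms
  by (auto simp: case_prod_unfold left_diff_distrib wig_integrable)

lemma wig_diff_right:
  assumes "borel_L2 f" "borel_L2 g" "borel_L2 g'"
  shows "wig f (\<lambda>x. g x - g' x) z = wig f g z - wig f g' z"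
  unfolding wig_def using assms
  by (auto simp: case_prod_unfold left_diff_distrib right_diff_distrib wig_integrable)

lemma wig_cmult_left: "wig (\<lambda>x. c * f x) g z = c * wig f g z"
  unfolding wig_def by (simp add: case_prod_unfold mult.assoc)

lemma continuous_on_wig_cts_bdd_supp:
  fixes f g :: "'a::euclidean_space \<Rightarrow> complex"
  assumes f: "cts_bdd_supp f" and g: "cts_bdd_supp g"
  shows "continuous_on UNIV (wig f g)"
proof -
  obtain B R where B: "\<And>x. norm (f x) \<le> B" "B > 0" "R > 0" "\<And>x. norm x > R \<Longrightarrow> f x = 0"
    using cts_bdd_supp_bound[OF f] by blast
  obtain C where C: "\<And>x. norm (g x) \<le> C" "C > 0"
    using cts_bdd_supp_bound[OF g] by metis
  have cf: "continuous_on UNIV f" and cg: "continuous_on UNIV g"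
    using f g by (auto simp: cts_bdd_supp_def)
  note [measurable] = borel_measurable_continuous_onI[OF cf] borel_measurable_continuous_onI[OF cg]
  have tf: "(\<lambda>n. f (y n)) \<longlonglongrightarrow> f l" and tg: "(\<lambda>n. g (y n)) \<longlonglongrightarrow> g l" if "y \<longlonglongrightarrow> l" for y l
    using continuous_on_tendsto_compose[OF cf that] continuous_on_tendsto_compose[OF cg that] by auto
  show ?thesis
  proof (rule continuous_on_sequentiallyI)
    fix u :: "nat \<Rightarrow> 'a \<times> 'a" and z
    assume u: "u \<longlonglongrightarrow> z"
    define X \<Xi> x \<xi> where "X = (\<lambda>n. fst (u n))" and "\<Xi> = (\<lambda>n. snd (u n))" and "x = fst z" and "\<xi> = snd z"
    have X: "X \<longlonglongrightarrow> x" and \<Xi>: "\<Xi> \<longlonglongrightarrow> \<xi>"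
      unfolding X_def \<Xi>_def x_def \<xi>_def using u by (auto intro: tendsto_intros)
    have "Bseq X" using X by (intro convergent_imp_Bseq) (auto simp: convergent_def)
    then obtain K where K: "K > 0" "\<And>n. norm (X n) \<le> K" by (auto simp: Bseq_def)
    have "(\<lambda>n. \<integral>s. f (X n + s) * cnj (g (X n - s)) * cis (- (4 * pi * (\<Xi> n \<bullet> s))) \<partial>lborel) \<longlonglongrightarrow>
        (\<integral>s. f (x + s) * cnj (g (x - s)) * cis (- (4 * pi * (\<xi> \<bullet> s))) \<partial>lborel)"
    proof (rule integral_dominated_convergence)
      show "integrable lborel (\<lambda>s. (B * C) * indicator (cball 0 (R + K)) s :: real)"
        by (rule integrable_indicator_cball)
      show "AE s in lborel. (\<lambda>n. f (X n + s) * cnj (g (X n - s)) * cis (- (4 * pi * (\<Xi> n \<bullet> s))))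
          \<longlonglongrightarrow> f (x + s) * cnj (g (x - s)) * cis (- (4 * pi * (\<xi> \<bullet> s)))"
        by (intro always_eventually allI tendsto_intros tf tg X \<Xi>)
      show "AE s in lborel. norm (f (X n + s) * cnj (g (X n - s)) * cis (- (4 * pi * (\<Xi> n \<bullet> s))))
          \<le> (B * C) * indicator (cball 0 (R + K)) s" for n
      proof (intro always_eventually allI)
        fix s
        show "norm (f (X n + s) * cnj (g (X n - s)) * cis (- (4 * pi * (\<Xi> n \<bullet> s))))
          \<le> (B * C) * indicator (cball 0 (R + K)) s"
        proof (cases "norm s \<le> R + K")
          case True
          then show ?thesis
            using B(1)[of "X n + s"] C(1)[of "X n - s"] B(2) by (auto simp: norm_mult intro!: mult_mono)
        next
          case False
          have "norm s \<le> norm (X n + s) + norm (X n)"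
            using norm_triangle_ineq4[of "X n + s" "X n"] by simp
          then have "norm (X n + s) > R" using False K(2)[of n] by linarith
          then show ?thesis using B(4) False by simp
        qed
      qed
    qed measurable
    then show "(\<lambda>n. wig f g (u n)) \<longlonglongrightarrow> wig f g z"
      by (simp add: wig_def case_prod_unfold X_def \<Xi>_def x_def \<xi>_def)
  qed
qed

text \<open>
  A uniform limit of the Wigner distributions of continuous functions with bounded support, for which
  continuity is dominated convergence.
\<close>
lemma continuous_on_wig:
  fixes f g :: "'a::euclidean_space \<Rightarrow> complex"
  assumes f: "borel_L2 f" and g: "borel_L2 g"
  shows "continuous_on UNIV (wig f g)"
proof -
  let ?N = "\<lambda>h :: 'a \<Rightarrow> complex. sqrt (\<integral>u. (cmod (h u))\<^sup>2 \<partial>lborel)"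
  define e where "e = (\<lambda>n. inverse (real (Suc n)))"
  have e: "e n > 0" for n by (simp add: e_def)
  have approx: "\<exists>\<phi>. cts_bdd_supp \<phi> \<and> ?N (\<lambda>x. h x - \<phi> x) \<le> e n" if h: "borel_L2 h" for h :: "'a \<Rightarrow> complex" and n
  proof -
    have "0 < (e n)\<^sup>2" using e[of n] by simp
    then obtain \<phi> where "cts_bdd_supp \<phi>" "(\<integral>x. (cmod (h x - \<phi> x))\<^sup>2 \<partial>lborel) < (e n)\<^sup>2"
      by (rule cts_bdd_supp_dense[OF h])
    then show ?thesis
      using e[of n] by (intro exI[of _ \<phi>] conjI real_le_lsqrt) auto
  qed
  obtain F where F: "\<And>n. cts_bdd_supp (F n)" "\<And>n. ?N (\<lambda>x. f x - F n x) \<le> e n"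
    using approx[OF f] by metis
  obtain G where G: "\<And>n. cts_bdd_supp (G n)" "\<And>n. ?N (\<lambda>x. g x - G n x) \<le> e n"
    using approx[OF g] by metis
  have F2: "borel_L2 (F n)" and G2: "borel_L2 (G n)" for n
    by (rule cts_bdd_supp_L2[OF F(1)], rule cts_bdd_supp_L2[OF G(1)])
  have "uniform_limit UNIV (\<lambda>n. wig (F n) (G n)) (wig f g) sequentially"
  proof (rule uniform_limit_sequentially_iff[THEN iffD2], intro allI impI)
    fix \<epsilon> :: real assume \<epsilon>: "\<epsilon> > 0"
    have "(\<lambda>n. e n * ?N g + ?N f * e n + e n * e n) \<longlonglongrightarrow> 0 * ?N g + ?N f * 0 + 0 * 0"
      unfolding e_def by (intro tendsto_intros LIMSEQ_inverse_real_of_nat)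
    then have "\<forall>\<^sub>F n in sequentially. e n * ?N g + ?N f * e n + e n * e n < \<epsilon>"
      using \<epsilon> by (intro order_tendstoD(2)[where y=0]) auto
    then obtain M where M: "\<And>n. n \<ge> M \<Longrightarrow> e n * ?N g + ?N f * e n + e n * e n < \<epsilon>"
      by (auto simp: eventually_sequentially)
    have "dist (wig (F n) (G n) z) (wig f g z) < \<epsilon>" if "n \<ge> M" for n z
    proof -
      let ?f = "\<lambda>x. f x - F n x" and ?g = "\<lambda>x. g x - G n x"
      have f': "borel_L2 ?f" and g': "borel_L2 ?g"
        by (rule borel_L2_diff[OF f F2], rule borel_L2_diff[OF g G2])
      \<comment> \<open>The errors are paired with \<open>f\<close>, with \<open>g\<close> and with each other, so only norms of fixed or of small
        functions occur in the estimate.\<close>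
      have "wig f g z - wig (F n) (G n) z = wig ?f g z + wig f ?g z - wig ?f ?g z"
        by (simp add: wig_diff_left wig_diff_right f g F2 G2 g')
      then have "norm (wig f g z - wig (F n) (G n) z) \<le> norm (wig ?f g z) + norm (wig f ?g z) + norm (wig ?f ?g z)"
        using norm_triangle_ineq4[of "wig ?f g z + wig f ?g z" "wig ?f ?g z"] norm_triangle_ineq[of "wig ?f g z" "wig f ?g z"]
        by simp
      also have "\<dots> \<le> ?N ?f * ?N g + ?N f * ?N ?g + ?N ?f * ?N ?g"
        by (intro add_mono norm_wig_le f g f' g')
      also have "\<dots> \<le> e n * ?N g + ?N f * e n + e n * e n"
        by (intro add_mono mult_mono F G order_refl) (use e[of n] in auto)
      also have "\<dots> < \<epsilon>" by (rule M[OF that])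
      finally show ?thesis by (simp add: dist_norm norm_minus_commute)
    qed
    then show "\<exists>N. \<forall>n\<ge>N. \<forall>x\<in>UNIV. dist (wig (F n) (G n) x) (wig f g x) < \<epsilon>" by blast
  qed
  then show ?thesis
    by (rule uniform_limit_theorem[rotated])
      (use F G in \<open>auto intro!: always_eventually continuous_on_wig_cts_bdd_supp\<close>)
qed

lemma nonvanishing_constant_sign:
  fixes h :: "'a::real_normed_vector \<Rightarrow> real"
  assumes c: "continuous_on UNIV h" and nz: "\<And>z. h z \<noteq> 0"
  shows "(\<forall>z. h z > 0) \<or> (\<forall>z. h z < 0)"
proof (rule ccontr)
  assume "\<not> ?thesis"
  then obtain a b where "h a \<le> 0" "h b \<ge> 0"
    by (auto simp: not_less)
  moreover have "connected (range h)"
    by (intro connected_continuous_image c connected_UNIV)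
  ultimately have "0 \<in> range h"
    unfolding connected_iff_interval by blast
  with nz show False by auto
qed

section \<open>Gaussian integrals with complex matrices\<close>

lemma integrable_gaussian:
  assumes c: "c > 0"
  shows "integrable lborel (\<lambda>u::'a::euclidean_space. exp (- c * (norm u)\<^sup>2))"
proof -
  define \<sigma> where "\<sigma> = 1 / sqrt (2 * c)"
  have \<sigma>: "2 * \<sigma>\<^sup>2 = 1 / c" using c by (simp add: \<sigma>_def power_divide)
  have "integrable lborel (\<lambda>x::real. sqrt (2 * pi * \<sigma>\<^sup>2) * normal_density 0 \<sigma> x)"
    by (intro integrable_mult_right integrable_normal_density) (use c in \<open>simp add: \<sigma>_def\<close>)
  moreover have "sqrt (2 * pi * \<sigma>\<^sup>2) * normal_density 0 \<sigma> x = exp (- c * x\<^sup>2)" for x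
    using c \<sigma> by (simp add: normal_density_def mult.commute) (simp add: \<sigma>_def)
  ultimately have 1: "integrable lborel (\<lambda>x::real. exp (- c * x\<^sup>2))"
    by simp
  have eq: "exp (- c * (norm u)\<^sup>2) = (\<Prod>b\<in>Basis. exp (- c * (u \<bullet> b)\<^sup>2))" for u :: 'a
  proof -
    have "(norm u)\<^sup>2 = (\<Sum>b\<in>Basis. (u \<bullet> b)\<^sup>2)"
      unfolding power2_norm_eq_inner euclidean_inner[of u u] by (simp only: power2_eq_square)
    then show ?thesis
      by (simp add: exp_sum[symmetric] sum_distrib_left)
  qed
  have "(\<integral>\<^sup>+u. ennreal (exp (- c * (norm u)\<^sup>2)) \<partial>(lborel :: 'a measure)) = (\<integral>\<^sup>+u. (\<Prod>b\<in>Basis. ennreal (exp (- c * (u \<bullet> b)\<^sup>2))) \<partial>(lborel :: 'a measure))"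
    unfolding eq by (simp add: prod_ennreal)
  also have "\<dots> = (\<Prod>b\<in>(Basis :: 'a set). \<integral>\<^sup>+x. ennreal (exp (- c * x\<^sup>2)) \<partial>lborel)"
    by (rule nn_integral_lborel_prod) auto
  also have "\<dots> < \<infinity>"
    using 1 by (simp add: nn_integral_eq_integral prod_ennreal ennreal_power less_top[symmetric])
  finally show ?thesis
    by (intro integrableI_bounded) auto
qed

text \<open>
  Completing the square: a linear exponent costs half of the quadratic decay and a constant factor.
\<close>
lemma integrable_gaussian_exp:
  assumes c: "c > 0"
  shows "integrable lborel (\<lambda>u::'a::euclidean_space. exp (- c * (norm u)\<^sup>2 + r * norm u))"
proof (rule Bochner_Integration.integrable_bound)
  show "integrable lborel (\<lambda>u::'a. exp (r\<^sup>2 / (2 * c)) * exp (- (c / 2) * (norm u)\<^sup>2))"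
    using c by (intro integrable_mult_right integrable_gaussian) simp
  have "- c * t\<^sup>2 + r * t \<le> r\<^sup>2 / (2 * c) - (c / 2) * t\<^sup>2" for t
  proof -
    have "0 \<le> (c * t - r)\<^sup>2 / (2 * c)" using c by simp
    also have "\<dots> = r\<^sup>2 / (2 * c) - (c / 2) * t\<^sup>2 - (- c * t\<^sup>2 + r * t)"
      using c by (simp add: power2_eq_square field_simps)
    finally show ?thesis by simp
  qed
  then show "AE u in lborel. norm (exp (- c * (norm u)\<^sup>2 + r * norm (u :: 'a)))
      \<le> norm (exp (r\<^sup>2 / (2 * c)) * exp (- (c / 2) * (norm u)\<^sup>2))"
    by (simp add: exp_add[symmetric])
qed measurable

text \<open>
  The bilinear (not the Hermitian) product, so that expressions in it are holomorphic in both arguments.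
\<close>
definition cdot :: "complex ^ 'n \<Rightarrow> complex ^ 'n \<Rightarrow> complex" where
  "cdot x y = (\<Sum>i\<in>UNIV. x $ i * y $ i)"

definition cvec :: "real ^ 'n \<Rightarrow> complex ^ 'n" where
  "cvec u = (\<chi> i. of_real (u $ i))"

lemma cdot_commute: "cdot x y = cdot y x"
  by (simp add: cdot_def mult.commute)

lemma cdot_add_left: "cdot (x + x') y = cdot x y + cdot x' y"
  by (simp add: cdot_def distrib_right sum.distrib)

lemma cdot_add_right: "cdot x (y + y') = cdot x y + cdot x y'"
  by (simp add: cdot_def distrib_left sum.distrib)

lemma cdot_diff_left: "cdot (x - x') y = cdot x y - cdot x' y"
  by (simp add: cdot_def left_diff_distrib sum_subtractf)

lemma cdot_diff_right: "cdot x (y - y') = cdot x y - cdot x y'"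
  by (simp add: cdot_def right_diff_distrib sum_subtractf)

lemma cdot_scale_left: "cdot (c *s x) y = c * cdot x y"
  by (simp add: cdot_def sum_distrib_left mult.assoc)

lemma cdot_scale_right: "cdot x (c *s y) = c * cdot x y"
  by (simp add: cdot_def sum_distrib_left mult.left_commute)

lemma cdot_zero [simp]: "cdot 0 y = 0" "cdot x 0 = 0"
  by (simp_all add: cdot_def)

lemmas cdot_linear = cdot_add_left cdot_add_right cdot_diff_left cdot_diff_right cdot_scale_left cdot_scale_right

lemma cdot_matrix:
  assumes "transpose M = M"
  shows "cdot x (M *v y) = cdot (M *v x) y"
proof -
  have "M $ i $ j = M $ j $ i" for i j
    using arg_cong[OF assms, of "\<lambda>A. A $ j $ i"] by (simp add: transpose_def)
  then have "(\<Sum>i\<in>UNIV. \<Sum>j\<in>UNIV. x $ i * (M $ i $ j * y $ j)) = (\<Sum>i\<in>UNIV. \<Sum>j\<in>UNIV. (M $ j $ i * x $ i) * y $ j)"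
    by (simp add: mult.assoc mult.left_commute)
  also have "\<dots> = (\<Sum>j\<in>UNIV. \<Sum>i\<in>UNIV. (M $ j $ i * x $ i) * y $ j)"
    by (rule sum.swap)
  finally show ?thesis
    by (simp add: cdot_def matrix_vector_mult_def sum_distrib_left sum_distrib_right)
qed

lemma cdot_cvec: "cdot (cvec u) (cvec v) = of_real (u \<bullet> v)"
  by (simp add: cdot_def cvec_def inner_vec_def)

lemma cvec_linear:
  "cvec (u + v) = cvec u + cvec v" "cvec (u - v) = cvec u - cvec v" "cvec (r *\<^sub>R u) = of_real r *s cvec u"
  by (simp_all add: cvec_def vec_eq_iff)

lemma continuous_on_cdot_cvec [continuous_intros]: "continuous_on A (\<lambda>u. cdot z (cvec u))"
  unfolding cdot_def cvec_def by (simp) (intro continuous_intros)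

lemma borel_measurable_cdot_cvec [measurable]: "(\<lambda>u. cdot z (cvec u)) \<in> borel_measurable borel"
  by (intro borel_measurable_continuous_onI continuous_intros)

lemma norm_cdot_cvec_le: "norm (cdot z (cvec u)) \<le> (\<Sum>i\<in>UNIV. norm (z $ i)) * norm u"
proof -
  have "norm (cdot z (cvec u)) \<le> (\<Sum>i\<in>UNIV. norm (z $ i * of_real (u $ i)))"
    unfolding cdot_def cvec_def by (simp add: sum_norm_le)
  also have "\<dots> \<le> (\<Sum>i\<in>UNIV. norm (z $ i) * norm u)"
    by (intro sum_mono) (simp add: norm_mult mult_left_mono component_le_norm_cart)
  finally show ?thesis by (simp add: sum_distrib_right)
qed

definition quad :: "complex ^ 'n ^ 'n \<Rightarrow> complex ^ 'n \<Rightarrow> complex" where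
  "quad M x = cdot x (M *v x)"

definition pos_real_part :: "complex ^ 'n ^ 'n \<Rightarrow> bool" where
  "pos_real_part M \<longleftrightarrow> (\<forall>y. y \<noteq> 0 \<longrightarrow> Re (quad M (cvec y)) > 0)"

lemma quad_scale: "quad M (c *s x) = c\<^sup>2 * quad M x"
  by (simp add: quad_def matrix_vector_mult_scaleR vector_scalar_commute cdot_linear power2_eq_square)

lemma quad_add:
  assumes "transpose M = M"
  shows "quad M (x + y) = quad M x + 2 * cdot (M *v x) y + quad M y"
  using cdot_matrix[OF assms, of x y] cdot_commute[of y "M *v x"]
  by (simp add: quad_def matrix_vector_right_distrib cdot_linear)

lemma continuous_on_quad_cvec [continuous_intros]: "continuous_on A (\<lambda>u. quad M (cvec u))"
  unfolding quad_def cdot_def cvec_def matrix_vector_mult_def by (simp) (intro continuous_intros)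

lemma borel_measurable_quad_cvec [measurable]: "(\<lambda>u. quad M (cvec u)) \<in> borel_measurable borel"
  by (intro borel_measurable_continuous_onI continuous_intros)

text \<open>
  The form attains a positive minimum on the compact unit sphere, and it is homogeneous of degree two.
\<close>
lemma pos_real_part_coercive:
  fixes M :: "complex ^ 'n ^ 'n"
  assumes "pos_real_part M"
  obtains m where "m > 0" "\<And>y. Re (quad M (cvec y)) \<ge> m * (norm y)\<^sup>2"
proof -
  let ?S = "sphere (0 :: real ^ 'n) 1"
  have "continuous_on ?S (\<lambda>y. Re (quad M (cvec y)))"
    by (intro continuous_intros)
  moreover have "?S \<noteq> {}" by simp
  ultimately obtain y0 where y0: "y0 \<in> ?S" "\<And>y. y \<in> ?S \<Longrightarrow> Re (quad M (cvec y0)) \<le> Re (quad M (cvec y))"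
    using continuous_attains_inf[of ?S "\<lambda>y. Re (quad M (cvec y))"] by auto
  define m where "m = Re (quad M (cvec y0))"
  have "y0 \<noteq> 0" using y0(1) by auto
  then have m: "m > 0" using assms by (simp add: m_def pos_real_part_def)
  have "m * (norm y)\<^sup>2 \<le> Re (quad M (cvec y))" for y
  proof (cases "y = 0")
    case False
    define v where "v = (1 / norm y) *\<^sub>R y"
    have "v \<in> ?S" using False by (simp add: v_def)
    then have "m \<le> Re (quad M (cvec v))" using y0 by (simp add: m_def)
    moreover have "quad M (cvec y) = of_real ((norm y)\<^sup>2) * quad M (cvec v)"
    proof -
      have "cvec y = of_real (norm y) *s cvec v"
        using False by (simp add: v_def cvec_linear(3)[symmetric])
      then show ?thesis by (simp add: quad_scale)
    qed
    then have "Re (quad M (cvec y)) = (norm y)\<^sup>2 * Re (quad M (cvec v))"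
      by simp
    ultimately show ?thesis by (simp add: mult.commute[of m] mult_left_mono)
  next
    case True
    then show ?thesis by (simp add: quad_def cvec_def cdot_def)
  qed
  with m show ?thesis by (rule that)
qed

text \<open>
  The bilateral Laplace transform of the Gaussian with matrix \<open>M\<close>.
\<close>
definition gauss_laplace :: "complex ^ 'n ^ 'n \<Rightarrow> complex ^ 'n \<Rightarrow> complex" where
  "gauss_laplace M w = (\<integral>y. exp (- quad M (cvec y) / 2 + cdot w (cvec y)) \<partial>lborel)"

lemma gauss_laplace_dominated:
  fixes M :: "complex ^ 'n ^ 'n"
  assumes "pos_real_part M"
  shows "integrable lborel (\<lambda>y. norm (exp (- quad M (cvec y) / 2 + cdot w (cvec y))) * exp (r * norm (cdot v (cvec y))))"
proof -
  obtain m where m: "m > 0" "\<And>y. Re (quad M (cvec y)) \<ge> m * (norm y)\<^sup>2"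
    using pos_real_part_coercive[OF assms] by blast
  define C where "C = (\<Sum>i\<in>UNIV. norm (w $ i)) + \<bar>r\<bar> * (\<Sum>i\<in>UNIV. norm (v $ i))"
  show ?thesis
  proof (rule Bochner_Integration.integrable_bound)
    show "integrable lborel (\<lambda>y::real^'n. exp (- (m / 2) * (norm y)\<^sup>2 + C * norm y))"
      using m by (intro integrable_gaussian_exp) simp
    have "Re (- quad M (cvec y) / 2 + cdot w (cvec y)) + r * norm (cdot v (cvec y)) \<le> - (m / 2) * (norm y)\<^sup>2 + C * norm y" for y
    proof -
      have "r * norm (cdot v (cvec y)) \<le> \<bar>r\<bar> * ((\<Sum>i\<in>UNIV. norm (v $ i)) * norm y)"
        by (intro mult_mono norm_cdot_cvec_le) auto
      moreover have "Re (cdot w (cvec y)) \<le> (\<Sum>i\<in>UNIV. norm (w $ i)) * norm y"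
        using complex_Re_le_cmod norm_cdot_cvec_le order_trans by blast
      ultimately show ?thesis
        using m(2)[of y] by (simp add: C_def algebra_simps)
    qed
    then show "AE y in lborel. norm (norm (exp (- quad M (cvec y) / 2 + cdot w (cvec y))) * exp (r * norm (cdot v (cvec y))))
      \<le> norm (exp (- (m / 2) * (norm y)\<^sup>2 + C * norm y))"
      by (simp add: exp_add[symmetric])
  qed measurable
qed

lemma gauss_laplace_integrable:
  assumes "pos_real_part M"
  shows "integrable lborel (\<lambda>y. exp (- quad M (cvec y) / 2 + cdot w (cvec y)))"
proof -
  have "(\<lambda>y. exp (- quad M (cvec y) / 2 + cdot w (cvec y))) \<in> borel_measurable lborel"
    by measurable
  moreover have "integrable lborel (\<lambda>y. norm (exp (- quad M (cvec y) / 2 + cdot w (cvec y))))"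
    using gauss_laplace_dominated[OF assms, of w 0 0] by (simp del: norm_exp_eq_Re)
  ultimately show ?thesis
    by (rule integrable_norm_cancel[rotated])
qed

text \<open>
  Completing the square for a real shift is a translation of the variable of integration.
\<close>
lemma gauss_laplace_real_shift:
  fixes M :: "complex ^ 'n ^ 'n"
  assumes sym: "transpose M = M"
  shows "gauss_laplace M (M *v cvec s) = exp (quad M (cvec s) / 2) * gauss_laplace M 0"
proof -
  define k where "k = (\<lambda>y. exp (- quad M (cvec y) / 2 + cdot (M *v cvec s) (cvec y)))"
  have [measurable]: "k \<in> borel_measurable borel" unfolding k_def by measurable
  have "k (s + y) = exp (quad M (cvec s) / 2) * exp (- quad M (cvec y) / 2)" for y
    unfolding k_def exp_add[symmetric]
    by (intro arg_cong[of _ _ exp])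
      (simp add: cvec_linear quad_add[OF sym] cdot_linear, simp add: quad_def cdot_commute field_simps)
  then have "integral\<^sup>L lborel k = (\<integral>y. exp (quad M (cvec s) / 2) * exp (- quad M (cvec y) / 2) \<partial>lborel)"
    using lborel_integral_affine[of k 1 s] by simp
  then show ?thesis by (simp add: gauss_laplace_def k_def)
qed

text \<open>
  For a complex shift \<open>s = p + i q\<close> no translation is available, but both sides are entire in \<open>\<tau>\<close> when \<open>s\<close> is
  replaced by \<open>p + \<tau> q\<close>, and they agree for real \<open>\<tau>\<close>. This evaluates the complex Gaussian integrals up to
  the common factor \<open>gauss_laplace M 0\<close>.
\<close>
lemma gauss_laplace_shift:
  fixes M :: "complex ^ 'n ^ 'n"
  assumes sym: "transpose M = M" and pos: "pos_real_part M"
  shows "gauss_laplace M (M *v s) = exp (quad M s / 2) * gauss_laplace M 0"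
proof -
  define p q where "p = (\<chi> i. Re (s $ i))" and "q = (\<chi> i. Im (s $ i))"
  have s: "s = cvec p + \<i> *s cvec q"
    by (simp add: vec_eq_iff cvec_def p_def q_def complex_eq)
  define L where "L = (\<lambda>\<tau>. gauss_laplace M (M *v (cvec p + \<tau> *s cvec q)))"
  define R where "R = (\<lambda>\<tau>. exp (quad M (cvec p + \<tau> *s cvec q) / 2) * gauss_laplace M 0)"
  have "L \<tau> = (\<integral>y. exp (- quad M (cvec y) / 2 + cdot (M *v cvec p) (cvec y)) * exp (\<tau> * cdot (M *v cvec q) (cvec y)) \<partial>lborel)" for \<tau>
    unfolding L_def gauss_laplace_def
    by (simp add: matrix_vector_right_distrib vector_scalar_commute cdot_linear exp_add[symmetric] algebra_simps)
  moreover have "(\<lambda>\<tau>. \<integral>y. exp (- quad M (cvec y) / 2 + cdot (M *v cvec p) (cvec y)) * exp (\<tau> * cdot (M *v cvec q) (cvec y)) \<partial>lborel) holomorphic_on UNIV"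
    unfolding holomorphic_on_def field_differentiable_def
    by (intro ballI exI) (rule has_field_derivative_at_within, rule laplace_has_field_derivative(1), measurable, rule gauss_laplace_dominated[OF pos])
  ultimately have hL: "L holomorphic_on UNIV" by presburger
  have hR: "R holomorphic_on UNIV"
    unfolding R_def quad_add[OF sym] quad_scale cdot_linear by (intro holomorphic_intros) auto
  have eq: "L (of_real t) = R (of_real t)" for t
    unfolding L_def R_def cvec_linear[symmetric] by (rule gauss_laplace_real_shift[OF sym])
  have "L \<i> - R \<i> = 0"
  proof (rule analytic_continuation[of "\<lambda>z. L z - R z" UNIV "\<real>" 0])
    show "(\<lambda>z. L z - R z) holomorphic_on UNIV" by (intro holomorphic_intros hL hR)
    show "0 islimpt (\<real> :: complex set)"
      unfolding islimpt_approachable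
    proof (intro allI impI)
      fix e :: real assume "e > 0"
      then show "\<exists>x'\<in>\<real>. x' \<noteq> 0 \<and> dist x' (0 :: complex) < e"
        by (intro bexI[of _ "of_real (e / 2)"]) (auto simp: norm_divide)
    qed
    show "L z - R z = 0" if "z \<in> \<real>" for z using that eq by (auto simp: Reals_def)
  qed auto
  then show ?thesis by (simp add: L_def R_def s)
qed

lemma integral_gaussian_pos:
  assumes "c > 0"
  shows "(\<integral>u. exp (- c * (norm u)\<^sup>2) \<partial>(lborel :: ('a::euclidean_space) measure)) > 0"
proof -
  have "(\<integral>u. exp (- c * (norm u)\<^sup>2) \<partial>(lborel :: ('a) measure)) \<noteq> 0"
    using integral_nonneg_eq_0_iff_AE[OF integrable_gaussian[OF assms, where 'a='a]]
    by (simp add: eventually_False ae_filter_eq_bot_iff)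
  then show ?thesis
    by (simp add: less_le)
qed

text \<open>
  The scalar matrix \<open>2 c\<close> with the purely imaginary shift \<open>i t / (2 c)\<close> gives the Fourier transform of a real Gaussian.
\<close>
lemma gaussian_fourier:
  fixes t :: "real ^ 'n"
  assumes c: "c > 0"
  shows "(\<integral>\<xi>. of_real (exp (- c * (norm \<xi>)\<^sup>2)) * cis (\<xi> \<bullet> t) \<partial>lborel)
       = of_real (\<integral>\<xi>. exp (- c * (norm \<xi>)\<^sup>2) \<partial>(lborel :: (real^'n) measure)) * of_real (exp (- (norm t)\<^sup>2 / (4 * c)))"
proof -
  define M :: "complex ^ 'n ^ 'n" where "M = mat (2 * of_real c)"
  have M: "M *v x = (2 * of_real c) *s x" for x
    by (simp add: M_def matrix_vector_mult_def mat_def vec_eq_iff if_distrib[of "\<lambda>a. a * _"] cong: if_cong)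
  have sym: "transpose M = M" by (simp add: M_def transpose_mat)
  have quadM: "quad M (cvec y) = of_real (2 * c * (norm y)\<^sup>2)" for y
    by (simp add: quad_def M cdot_linear cdot_cvec power2_norm_eq_inner)
  have pos: "pos_real_part M"
    using c by (simp add: pos_real_part_def quadM)
  define s where "s = (\<i> / (2 * of_real c)) *s cvec t"
  have Ms: "M *v s = \<i> *s cvec t" using c by (simp add: M s_def)
  have qs: "quad M s / 2 = of_real (- (norm t)\<^sup>2 / (4 * c))"
    using c by (simp add: s_def quad_scale quadM power_divide) (simp add: field_simps power2_eq_square)
  have "gauss_laplace M (\<i> *s cvec t) = (\<integral>\<xi>. of_real (exp (- c * (norm \<xi>)\<^sup>2)) * cis (\<xi> \<bullet> t) \<partial>lborel)"
    unfolding gauss_laplace_def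
    by (intro Bochner_Integration.integral_cong refl) (simp add: quadM cdot_linear cdot_cvec cis_conv_exp exp_of_real[symmetric] exp_add[symmetric] inner_commute)
  moreover have "gauss_laplace M 0 = of_real (\<integral>\<xi>. exp (- c * (norm \<xi>)\<^sup>2) \<partial>(lborel :: (real^'n) measure))"
    unfolding gauss_laplace_def integral_complex_of_real[symmetric]
    by (intro Bochner_Integration.integral_cong refl) (simp add: quadM exp_of_real[symmetric])
  ultimately show ?thesis
    using gauss_laplace_shift[OF sym pos, of s] unfolding Ms qs by (simp only: exp_of_real mult.commute)
qed

section \<open>Injectivity of the Fourier transform\<close>

lemma lborel_Fubini:
  fixes f :: "'a::euclidean_space \<Rightarrow> 'b::euclidean_space \<Rightarrow> complex"
  assumes [measurable]: "case_prod f \<in> borel_measurable (lborel \<Otimes>\<^sub>M lborel)"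
    and 1: "\<And>x. integrable lborel (f x)" and 2: "integrable lborel (\<lambda>x. \<integral>y. norm (f x y) \<partial>lborel)"
  shows "(\<integral>x. (\<integral>y. f x y \<partial>lborel) \<partial>lborel) = (\<integral>y. (\<integral>x. f x y \<partial>lborel) \<partial>lborel)"
proof -
  have "integrable (lborel \<Otimes>\<^sub>M lborel) (case_prod f)"
    using 1 2 by (intro lborel_pair.Fubini_integrable) auto
  then show ?thesis
    by (rule lborel_pair.Fubini_integral[symmetric])
qed

lemma integral_lborel_pos:
  fixes f :: "'a::euclidean_space \<Rightarrow> real"
  assumes int: "integrable lborel f" and pos: "\<And>x. f x > 0"
  shows "integral\<^sup>L lborel f > 0"
proof -
  have ne: "integral\<^sup>L lborel f \<noteq> 0"
  proof
    assume "integral\<^sup>L lborel f = 0"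
    then have "AE x in lborel. f x = 0"
      using integral_nonneg_eq_0_iff_AE[OF int] pos by (simp add: less_imp_le)
    then have "AE x in (lborel :: 'a measure). False"
      by eventually_elim (use pos in \<open>auto simp: less_le\<close>)
    then show False
      by (simp add: eventually_False ae_filter_eq_bot_iff)
  qed
  have "integral\<^sup>L lborel f \<ge> 0"
    using pos by (simp add: less_imp_le)
  with ne show ?thesis by simp
qed

text \<open>
  A Gaussian is a superposition of characters, so integrals of \<open>h\<close> against Gaussians are superpositions of
  values of the Fourier transform of \<open>h\<close>.
\<close>
lemma fourier_zero_imp_gaussian_zero:
  fixes h :: "real ^ 'n \<Rightarrow> complex"
  assumes h: "integrable lborel h" and zero: "\<And>y. (\<integral>u. h u * cis (y \<bullet> u) \<partial>lborel) = 0" and c: "c > 0"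
  shows "(\<integral>u. h u * of_real (exp (- (norm (u - v))\<^sup>2 / (4 * c))) \<partial>lborel) = 0"
proof -
  note [measurable] = borel_measurable_integrable[OF h]
  let ?G = "\<lambda>\<xi>::real^'n. exp (- c * (norm \<xi>)\<^sup>2)"
  let ?\<kappa> = "integral\<^sup>L lborel ?G"
  have G: "integrable lborel ?G" by (rule integrable_gaussian[OF c])
  have "of_real ?\<kappa> * (\<integral>u. h u * of_real (exp (- (norm (u - v))\<^sup>2 / (4 * c))) \<partial>lborel)
      = (\<integral>u. h u * (of_real ?\<kappa> * of_real (exp (- (norm (u - v))\<^sup>2 / (4 * c)))) \<partial>lborel)"
    unfolding integral_mult_right_zero[symmetric] by (simp add: mult_ac)
  also have "\<dots> = (\<integral>u. (\<integral>\<xi>. h u * (of_real (?G \<xi>) * cis (\<xi> \<bullet> (u - v))) \<partial>lborel) \<partial>lborel)"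
    unfolding gaussian_fourier[OF c, symmetric] integral_mult_right_zero ..
  also have "\<dots> = (\<integral>\<xi>. (\<integral>u. h u * (of_real (?G \<xi>) * cis (\<xi> \<bullet> (u - v))) \<partial>lborel) \<partial>lborel)"
  proof (rule lborel_Fubini)
    show "integrable lborel (\<lambda>\<xi>. h u * (of_real (?G \<xi>) * cis (\<xi> \<bullet> (u - v))))" for u
    proof (intro integrable_mult_right)
      show "integrable lborel (\<lambda>\<xi>. of_real (?G \<xi>) * cis (\<xi> \<bullet> (u - v)))"
        by (rule Bochner_Integration.integrable_bound[OF G]) (auto simp: norm_mult)
    qed
    have "(\<lambda>u. \<integral>\<xi>. norm (h u * (of_real (?G \<xi>) * cis (\<xi> \<bullet> (u - v)))) \<partial>lborel) = (\<lambda>u. norm (h u) * ?\<kappa>)"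
      by (simp add: norm_mult)
    then show "integrable lborel (\<lambda>u. \<integral>\<xi>. norm (h u * (of_real (?G \<xi>) * cis (\<xi> \<bullet> (u - v)))) \<partial>lborel)"
      using h by simp
  qed measurable
  also have "\<dots> = (\<integral>\<xi>. 0 \<partial>(lborel :: (real^'n) measure))"
  proof (intro Bochner_Integration.integral_cong refl)
    fix \<xi> :: "real^'n"
    have "h u * (of_real (?G \<xi>) * cis (\<xi> \<bullet> (u - v))) = (of_real (?G \<xi>) * cis (- (\<xi> \<bullet> v))) * (h u * cis (\<xi> \<bullet> u))" for u
    proof -
      have "cis (\<xi> \<bullet> (u - v)) = cis (- (\<xi> \<bullet> v)) * cis (\<xi> \<bullet> u)"
        by (simp add: cis_mult inner_diff_right)
      then show ?thesis by (simp only: mult_ac)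
    qed
    then show "(\<integral>u. h u * (of_real (?G \<xi>) * cis (\<xi> \<bullet> (u - v))) \<partial>lborel) = 0"
      by (simp only: integral_mult_right_zero zero mult_zero_right)
  qed
  finally show ?thesis
    using integral_gaussian_pos[OF c, where 'a="real^'n"] by simp
qed

text \<open>
  The convolutions of \<open>\<phi>\<close> with Gaussians of width \<open>1 / n\<close> are pairings with translated Gaussians, so they are
  annihilated by \<open>h\<close>, and they converge boundedly to a multiple of \<open>\<phi>\<close>. The functions \<open>\<Psi> n\<close> in the proof are
  these convolutions up to normalisation, with the width absorbed into the argument of \<open>\<phi>\<close>.
\<close>
lemma fourier_zero_imp_pairing_zero:
  fixes h \<phi> :: "real ^ 'n \<Rightarrow> complex"
  assumes h: "integrable lborel h" and zero: "\<And>y. (\<integral>u. h u * cis (y \<bullet> u) \<partial>lborel) = 0"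
    and \<phi>: "continuous_on UNIV \<phi>" and bd: "\<And>u. norm (\<phi> u) \<le> 1"
  shows "(\<integral>u. h u * \<phi> u \<partial>lborel) = 0"
proof -
  note [measurable] = borel_measurable_integrable[OF h] borel_measurable_continuous_onI[OF \<phi>]
  let ?E = "\<lambda>x::real^'n. exp (- 1 * (norm x)\<^sup>2)"
  let ?\<kappa> = "integral\<^sup>L lborel ?E"
  have E: "integrable lborel ?E" by (rule integrable_gaussian) simp
  define \<Psi> where "\<Psi> = (\<lambda>n u. \<integral>x. \<phi> (u + (1 / real (Suc n)) *\<^sub>R x) * of_real (?E x) \<partial>lborel)"
  have \<Psi>m [measurable]: "\<Psi> n \<in> borel_measurable borel" for n
    unfolding \<Psi>_def by measurable
  have Eint: "integrable lborel (\<lambda>x. \<phi> (k x) * of_real (?E x))" if [measurable]: "k \<in> borel_measurable borel" for k :: "real^'n \<Rightarrow> real^'n"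
    by (rule Bochner_Integration.integrable_bound[OF E]) (auto simp: norm_mult bd mult_left_le_one_le)
  have \<Psi>bd: "norm (\<Psi> n u) \<le> ?\<kappa>" for n u
  proof -
    have "norm (\<Psi> n u) \<le> (\<integral>x. norm (\<phi> (u + (1 / real (Suc n)) *\<^sub>R x) * of_real (?E x)) \<partial>lborel)"
      unfolding \<Psi>_def by (rule integral_norm_bound)
    also have "\<dots> \<le> ?\<kappa>"
      by (intro integral_mono integrable_norm Eint E) (auto simp: norm_mult bd mult_left_le_one_le)
    finally show ?thesis .
  qed
  have zeroN: "(\<integral>u. h u * \<Psi> n u \<partial>lborel) = 0" for n
  proof -
    define N where "N = real (Suc n)"
    have N: "N > 0" by (simp add: N_def)
    let ?K = "\<lambda>u v::real^'n. of_real (exp (- (N\<^sup>2) * (norm (v - u))\<^sup>2)) :: complex"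
    have GN: "integrable lborel (\<lambda>v. exp (- (N\<^sup>2) * (norm (v - u))\<^sup>2))" for u :: "real^'n"
      using lborel_integrable_affine[OF integrable_gaussian[of "N\<^sup>2", where 'a="real^'n"], of 1 "- u"] N by simp
    have GNint: "(\<integral>v. exp (- (N\<^sup>2) * (norm (v - u))\<^sup>2) \<partial>lborel) = (\<integral>v. exp (- (N\<^sup>2) * (norm v)\<^sup>2) \<partial>(lborel :: (real^'n) measure))" for u :: "real^'n"
      by (rule sym) (use lborel_integral_affine[of "\<lambda>v. exp (- (N\<^sup>2) * (norm v)\<^sup>2)" 1 "- u"] in simp)
    have inner: "(\<integral>v. \<phi> v * ?K u v \<partial>lborel) = of_real ((1 / N) ^ CARD('n)) * \<Psi> n u" for u
    proof -
      have "(\<integral>v. \<phi> v * ?K u v \<partial>lborel) = \<bar>1 / N\<bar> ^ DIM(real^'n) *\<^sub>R (\<integral>x. \<phi> (u + (1 / N) *\<^sub>R x) * ?K u (u + (1 / N) *\<^sub>R x) \<partial>lborel)"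
        by (rule lborel_integral_affine) (use N in auto)
      moreover have "?K u (u + (1 / N) *\<^sub>R x) = of_real (?E x)" for x
        using N by (simp add: power_divide)
      ultimately show ?thesis
        using N by (simp add: \<Psi>_def N_def scaleR_conv_of_real)
    qed
    have "(\<integral>u. (\<integral>v. h u * (\<phi> v * ?K u v) \<partial>lborel) \<partial>lborel) = (\<integral>v. (\<integral>u. h u * (\<phi> v * ?K u v) \<partial>lborel) \<partial>lborel)"
    proof (rule lborel_Fubini)
      have int: "integrable lborel (\<lambda>v. \<phi> v * ?K u v)" for u
        by (rule Bochner_Integration.integrable_bound[OF GN[of u]]) (auto simp: norm_mult bd mult_left_le_one_le)
      then show "integrable lborel (\<lambda>v. h u * (\<phi> v * ?K u v))" for u
        by (rule integrable_mult_right)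
      show "integrable lborel (\<lambda>u. \<integral>v. norm (h u * (\<phi> v * ?K u v)) \<partial>lborel)"
      proof (rule Bochner_Integration.integrable_bound)
        show "integrable lborel (\<lambda>u. norm (h u) * (\<integral>v. exp (- (N\<^sup>2) * (norm v)\<^sup>2) \<partial>(lborel :: (real^'n) measure)))"
          using h by simp
        have "(\<integral>v. norm (h u * (\<phi> v * ?K u v)) \<partial>lborel) \<le> (\<integral>v. norm (h u) * exp (- (N\<^sup>2) * (norm (v - u))\<^sup>2) \<partial>lborel)" for u
          by (intro integral_mono integrable_norm integrable_mult_right int GN) (auto simp: norm_mult bd mult_left_mono mult_left_le_one_le)
        then have "(\<integral>v. norm (h u * (\<phi> v * ?K u v)) \<partial>lborel) \<le> norm (h u) * (\<integral>v. exp (- (N\<^sup>2) * (norm v)\<^sup>2) \<partial>(lborel :: (real^'n) measure))" for u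
          unfolding GNint[of u, symmetric] integral_mult_right_zero .
        then show "AE u in lborel. norm (\<integral>v. norm (h u * (\<phi> v * ?K u v)) \<partial>lborel) \<le> norm (norm (h u) * (\<integral>v. exp (- (N\<^sup>2) * (norm v)\<^sup>2) \<partial>(lborel :: (real^'n) measure)))"
          by (simp add: abs_mult)
      qed measurable
    qed measurable
    also have "\<dots> = (\<integral>v. 0 \<partial>(lborel :: (real^'n) measure))"
    proof (intro Bochner_Integration.integral_cong refl)
      fix v :: "real^'n"
      \<comment> \<open>The width parameter \<open>c = 1 / (4 N\<^sup>2)\<close> gives the kernel \<open>exp (- N\<^sup>2 |u - v|\<^sup>2)\<close>.\<close>
      have "h u * (\<phi> v * ?K u v) = \<phi> v * (h u * of_real (exp (- (norm (u - v))\<^sup>2 / (4 * (1 / (4 * N\<^sup>2))))))" for u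
        using N by (simp add: norm_minus_commute mult_ac)
      then show "(\<integral>u. h u * (\<phi> v * ?K u v) \<partial>lborel) = 0"
        using fourier_zero_imp_gaussian_zero[OF h zero, of "1 / (4 * N\<^sup>2)" v] N
        by (simp only: integral_mult_right_zero) simp
    qed
    finally have "(\<integral>u. h u * (of_real ((1 / N) ^ CARD('n)) * \<Psi> n u) \<partial>lborel) = 0"
      unfolding integral_mult_right_zero inner by simp
    then have "of_real ((1 / N) ^ CARD('n)) * (\<integral>u. h u * \<Psi> n u \<partial>lborel) = 0"
      unfolding integral_mult_right_zero[symmetric] by (simp add: mult_ac)
    then show ?thesis using N by simp
  qed
  have \<Psi>lim: "(\<lambda>n. \<Psi> n u) \<longlonglongrightarrow> \<phi> u * of_real ?\<kappa>" for u
  proof -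
    have "(\<lambda>n. \<Psi> n u) \<longlonglongrightarrow> (\<integral>x. \<phi> u * of_real (?E x) \<partial>lborel)"
      unfolding \<Psi>_def
    proof (rule integral_dominated_convergence[OF _ _ E])
      show "AE x in lborel. (\<lambda>n. \<phi> (u + (1 / real (Suc n)) *\<^sub>R x) * of_real (?E x)) \<longlonglongrightarrow> \<phi> u * of_real (?E x)"
      proof (intro always_eventually allI tendsto_intros)
        fix x
        have "(\<lambda>n. u + inverse (real (Suc n)) *\<^sub>R x) \<longlonglongrightarrow> u + 0 *\<^sub>R x"
          by (intro tendsto_intros LIMSEQ_inverse_real_of_nat)
        then have "(\<lambda>n. u + (1 / real (Suc n)) *\<^sub>R x) \<longlonglongrightarrow> u"
          by (simp add: inverse_eq_divide)
        then show "(\<lambda>n. \<phi> (u + (1 / real (Suc n)) *\<^sub>R x)) \<longlonglongrightarrow> \<phi> u"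
          by (intro continuous_on_tendsto_compose[OF \<phi>]) auto
      qed
    qed (auto simp: norm_mult bd mult_left_le_one_le)
    then show ?thesis by simp
  qed
  have "(\<lambda>n. \<integral>u. h u * \<Psi> n u \<partial>lborel) \<longlonglongrightarrow> (\<integral>u. h u * (\<phi> u * of_real ?\<kappa>) \<partial>lborel)"
  proof (rule integral_dominated_convergence)
    show "integrable lborel (\<lambda>u. norm (h u) * ?\<kappa>)" using h by simp
    show "AE u in lborel. (\<lambda>n. h u * \<Psi> n u) \<longlonglongrightarrow> h u * (\<phi> u * of_real ?\<kappa>)"
      by (intro always_eventually allI tendsto_intros \<Psi>lim)
    show "AE u in lborel. norm (h u * \<Psi> n u) \<le> norm (h u) * ?\<kappa>" for n
      using \<Psi>bd by (simp add: norm_mult mult_left_mono)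
  qed measurable
  then have "(\<integral>u. h u * (\<phi> u * of_real ?\<kappa>) \<partial>lborel) = 0"
    by (simp add: zeroN LIMSEQ_const_iff)
  then have "(\<integral>u. h u * \<phi> u \<partial>lborel) * of_real ?\<kappa> = 0"
    unfolding integral_mult_left_zero[symmetric] by (simp add: mult_ac)
  then show ?thesis
    using integral_gaussian_pos[of 1, where 'a="real^'n"] by simp
qed

text \<open>
  Testing \<open>h\<close> against continuous functions that are bounded by one and converge to the conjugate sign of \<open>h\<close>
  shows that the integral of \<open>|h|\<close> vanishes.
\<close>
lemma fourier_injective:
  fixes h :: "real ^ 'n \<Rightarrow> complex"
  assumes h: "integrable lborel h" and zero: "\<And>y. (\<integral>u. h u * cis (y \<bullet> u) \<partial>lborel) = 0"
  shows "AE u in lborel. h u = 0"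
proof -
  note [measurable] = borel_measurable_integrable[OF h]
  define \<sigma> where "\<sigma> = (\<lambda>u. cnj (sgn (h u)))"
  have \<sigma>m [measurable]: "\<sigma> \<in> borel_measurable borel"
    unfolding \<sigma>_def sgn_div_norm by measurable
  obtain g where cg: "\<And>n. continuous_on UNIV (g n)" and g: "AE u in lborel. (\<lambda>n. g n u) \<longlonglongrightarrow> \<sigma> u"
    using AE_lborel_continuous_limit[OF \<sigma>m] by blast
  define \<phi> where "\<phi> = (\<lambda>n u. radial_clamp 1 (g n u))"
  have c\<phi>: "continuous_on UNIV (\<phi> n)" for n
    unfolding \<phi>_def using continuous_on_compose2[OF continuous_radial_clamp cg] by simp
  note [measurable] = borel_measurable_continuous_onI[OF c\<phi>]
  have bd: "norm (\<phi> n u) \<le> 1" for n u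
    unfolding \<phi>_def by (rule norm_radial_clamp_le_radius) simp
  have "(\<lambda>n. \<integral>u. h u * \<phi> n u \<partial>lborel) \<longlonglongrightarrow> (\<integral>u. h u * \<sigma> u \<partial>lborel)"
  proof (rule integral_dominated_convergence[OF _ _ integrable_norm[OF h]])
    show "AE u in lborel. (\<lambda>n. h u * \<phi> n u) \<longlonglongrightarrow> h u * \<sigma> u"
      using g
    proof eventually_elim
      case (elim u)
      have "isCont (radial_clamp 1) (\<sigma> u)"
        using continuous_radial_clamp by (simp add: continuous_on_eq_continuous_at)
      then have "(\<lambda>n. \<phi> n u) \<longlonglongrightarrow> radial_clamp 1 (\<sigma> u)"
        unfolding \<phi>_def using elim isCont_tendsto_compose by blast
      moreover have "radial_clamp 1 (\<sigma> u) = \<sigma> u"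
        by (rule radial_clamp_eq) (auto simp: \<sigma>_def norm_sgn)
      ultimately show ?case by (auto intro: tendsto_intros)
    qed
    show "AE u in lborel. norm (h u * \<phi> n u) \<le> norm (h u)" for n
      using bd by (simp add: norm_mult mult_left_le)
  qed measurable
  moreover have "(\<integral>u. h u * \<phi> n u \<partial>lborel) = 0" for n
    by (rule fourier_zero_imp_pairing_zero[OF h zero c\<phi> bd])
  ultimately have "(\<integral>u. h u * \<sigma> u \<partial>lborel) = 0"
    by (simp add: LIMSEQ_const_iff)
  moreover have "h u * \<sigma> u = of_real (norm (h u))" for u
  proof (cases "h u = 0")
    case False
    have "h u * \<sigma> u = (h u * cnj (h u)) / of_real (norm (h u))"
      by (simp add: \<sigma>_def sgn_eq)
    also have "\<dots> = of_real (norm (h u))"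
      using False by (simp add: complex_norm_square[symmetric] power2_eq_square)
    finally show ?thesis .
  qed (simp add: \<sigma>_def)
  ultimately have "(\<integral>u. norm (h u) \<partial>lborel) = 0"
    by simp
  then show ?thesis
    using integral_nonneg_eq_0_iff_AE[OF integrable_norm[OF h]] by simp
qed

section \<open>Gaussian averages of the Wigner distribution\<close>

text \<open>
  The coherent state at the phase space point \<open>(x, \<xi>)\<close>, conjugated and without normalisation.
\<close>
definition phase_gauss :: "'a::euclidean_space \<Rightarrow> 'a \<Rightarrow> 'a \<Rightarrow> complex" where
  "phase_gauss x \<xi> u = of_real (exp (- pi * (norm (u - x))\<^sup>2)) * cis (- (2 * pi * (\<xi> \<bullet> u)))"

lemma phase_gauss_measurable [measurable]: "phase_gauss x \<xi> \<in> borel_measurable borel"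
  unfolding phase_gauss_def[abs_def] by measurable

lemma phase_gauss_L2: "borel_L2 (phase_gauss x \<xi>)"
  unfolding borel_L2_def
proof
  have "(cmod (phase_gauss x \<xi> u))\<^sup>2 = exp (- (2 * pi) * (norm (- x + 1 *\<^sub>R u))\<^sup>2)" for u
    by (simp add: phase_gauss_def norm_mult exp_double[symmetric])
  then show "integrable lborel (\<lambda>u. (cmod (phase_gauss x \<xi> u))\<^sup>2)"
    using lborel_integrable_affine[OF integrable_gaussian[of "2 * pi", where 'a='a], of 1 "- x"] by simp
qed measurable

lemma integrable_L2_phase_gauss: "borel_L2 f \<Longrightarrow> integrable lborel (\<lambda>u. f u * phase_gauss x \<xi> u)"
  by (rule borel_L2_mult_integrable[OF _ phase_gauss_L2])

text \<open>
  With \<open>u = x + s\<close> the second factor becomes \<open>G (2 x - u)\<close>; integrating first over \<open>x\<close> separates the two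
  integrals and produces the Jacobian of \<open>x \<mapsto> 2 x\<close>.
\<close>
lemma convolution_at_double_point:
  fixes F G :: "'a::euclidean_space \<Rightarrow> complex"
  assumes F: "integrable lborel F" and G: "integrable lborel G"
  shows "(\<integral>x. (\<integral>s. F (x + s) * G (x - s) \<partial>lborel) \<partial>lborel)
      = of_real ((1 / 2) ^ DIM('a)) * (integral\<^sup>L lborel F * integral\<^sup>L lborel G)"
proof -
  note [measurable] = borel_measurable_integrable[OF F] borel_measurable_integrable[OF G]
  have half: "(\<integral>x. H (2 *\<^sub>R x - u) \<partial>lborel) = (1 / 2) ^ DIM('a) *\<^sub>R integral\<^sup>L lborel H"
    if [measurable]: "H \<in> borel_measurable borel" for H :: "'a \<Rightarrow> 'b::{banach, second_countable_topology}" and u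
    using lborel_integral_affine[OF that, of 2 "- u"] by (simp add: field_simps power_divide)
  have G2: "integrable lborel (\<lambda>x. G (2 *\<^sub>R x - u))" for u
    using lborel_integrable_affine[OF G, of 2 "- u"] by simp
  have "(\<integral>s. F (x + s) * G (x - s) \<partial>lborel) = (\<integral>u. F u * G (2 *\<^sub>R x - u) \<partial>lborel)" for x
    using lborel_integral_affine[of "\<lambda>u. F u * G (2 *\<^sub>R x - u)" 1 x] by (simp add: scaleR_2)
  then have "(\<integral>x. (\<integral>s. F (x + s) * G (x - s) \<partial>lborel) \<partial>lborel) = (\<integral>x. (\<integral>u. F u * G (2 *\<^sub>R x - u) \<partial>lborel) \<partial>lborel)"
    by simp
  also have "\<dots> = (\<integral>u. (\<integral>x. F u * G (2 *\<^sub>R x - u) \<partial>lborel) \<partial>lborel)"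
  proof (rule lborel_Fubini[symmetric])
    show "integrable lborel (\<lambda>x. F u * G (2 *\<^sub>R x - u))" for u
      using G2 by simp
    have "(\<integral>x. norm (F u * G (2 *\<^sub>R x - u)) \<partial>lborel) = norm (F u) * ((1 / 2) ^ DIM('a) * (\<integral>x. norm (G x) \<partial>lborel))" for u
      using half[of "\<lambda>x. norm (G x)" u] by (simp add: norm_mult)
    then show "integrable lborel (\<lambda>u. \<integral>x. norm (F u * G (2 *\<^sub>R x - u)) \<partial>lborel)"
      using F by simp
  qed measurable
  also have "\<dots> = (\<integral>u. F u * ((1 / 2) ^ DIM('a) *\<^sub>R integral\<^sup>L lborel G) \<partial>lborel)"
    using half[of G] by simp
  also have "\<dots> = of_real ((1 / 2) ^ DIM('a)) * (integral\<^sup>L lborel F * integral\<^sup>L lborel G)"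
    by (simp add: scaleR_conv_of_real mult_ac)
  finally show ?thesis .
qed

text \<open>
  Averaging over the frequency replaces the character in the definition of \<open>wig\<close> by its Gaussian average,
  which is a Gaussian in \<open>s\<close>.
\<close>
lemma wig_gaussian_average_frequency:
  fixes f g :: "real ^ 'n \<Rightarrow> complex"
  assumes f: "borel_L2 f" and g: "borel_L2 g"
  shows "(\<integral>\<xi>. wig f g (x, \<xi>) * of_real (exp (- (2 * pi) * (norm (\<xi> - \<xi>0))\<^sup>2)) \<partial>lborel)
    = of_real (\<integral>\<xi>. exp (- (2 * pi) * (norm \<xi>)\<^sup>2) \<partial>(lborel :: (real^'n) measure))
      * (\<integral>s. f (x + s) * cnj (g (x - s)) * (of_real (exp (- (2 * pi) * (norm s)\<^sup>2)) * cis (- (4 * pi * (\<xi>0 \<bullet> s)))) \<partial>lborel)"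
proof -
  note [measurable] = assms[THEN borel_L2_measurable]
  let ?P = "\<lambda>s. f (x + s) * cnj (g (x - s))"
  let ?E = "\<lambda>\<xi>::real^'n. exp (- (2 * pi) * (norm (\<xi> - \<xi>0))\<^sup>2)"
  let ?G = "\<lambda>\<xi>::real^'n. exp (- (2 * pi) * (norm \<xi>)\<^sup>2)"
  let ?\<kappa> = "integral\<^sup>L lborel ?G"
  have G: "integrable lborel ?G" by (rule integrable_gaussian) simp
  have E: "integrable lborel ?E"
    using lborel_integrable_affine[OF G, of 1 "- \<xi>0"] by simp
  have P: "integrable lborel ?P"
    by (rule borel_L2_mult_integrable[OF wig_factors_L2[OF f g]])
  have freq: "(\<integral>\<xi>. cis (- (4 * pi * (\<xi> \<bullet> s))) * of_real (?E \<xi>) \<partial>lborel) = of_real ?\<kappa> * (of_real (?G s) * cis (- (4 * pi * (\<xi>0 \<bullet> s))))" for s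
  proof -
    let ?t = "- (4 * pi) *\<^sub>R s"
    have "(\<integral>\<xi>. cis (- (4 * pi * (\<xi> \<bullet> s))) * of_real (?E \<xi>) \<partial>lborel)
        = (\<integral>\<xi>. cis (- (4 * pi * ((\<xi>0 + \<xi>) \<bullet> s))) * of_real (?G \<xi>) \<partial>lborel)"
      using lborel_integral_affine[of "\<lambda>\<xi>. cis (- (4 * pi * (\<xi> \<bullet> s))) * of_real (?E \<xi>)" 1 \<xi>0] by simp
    also have "\<dots> = (\<integral>\<xi>. cis (- (4 * pi * (\<xi>0 \<bullet> s))) * (of_real (?G \<xi>) * cis (\<xi> \<bullet> ?t)) \<partial>lborel)"
    proof (intro Bochner_Integration.integral_cong refl)
      fix \<xi> :: "real^'n"
      have "cis (- (4 * pi * ((\<xi>0 + \<xi>) \<bullet> s))) = cis (- (4 * pi * (\<xi>0 \<bullet> s))) * cis (\<xi> \<bullet> ?t)"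
        by (simp add: cis_mult inner_add_left algebra_simps)
      then show "cis (- (4 * pi * ((\<xi>0 + \<xi>) \<bullet> s))) * of_real (?G \<xi>) = cis (- (4 * pi * (\<xi>0 \<bullet> s))) * (of_real (?G \<xi>) * cis (\<xi> \<bullet> ?t))"
        by (simp only: mult_ac)
    qed
    also have "\<dots> = cis (- (4 * pi * (\<xi>0 \<bullet> s))) * (of_real ?\<kappa> * of_real (exp (- (norm ?t)\<^sup>2 / (4 * (2 * pi)))))"
      unfolding integral_mult_right_zero by (subst gaussian_fourier) auto
    also have "- (norm ?t)\<^sup>2 / (4 * (2 * pi)) = - (2 * pi) * (norm s)\<^sup>2"
      by (simp add: power_mult_distrib power2_eq_square)
    finally show ?thesis by (simp only: mult_ac)
  qed
  have "(\<integral>\<xi>. wig f g (x, \<xi>) * of_real (?E \<xi>) \<partial>lborel)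
      = (\<integral>\<xi>. (\<integral>s. ?P s * (cis (- (4 * pi * (\<xi> \<bullet> s))) * of_real (?E \<xi>)) \<partial>lborel) \<partial>lborel)"
    unfolding wig_def case_prod_conv integral_mult_left_zero[symmetric] by (simp only: mult.assoc)
  also have "\<dots> = (\<integral>s. (\<integral>\<xi>. ?P s * (cis (- (4 * pi * (\<xi> \<bullet> s))) * of_real (?E \<xi>)) \<partial>lborel) \<partial>lborel)"
  proof (rule lborel_Fubini[symmetric])
    show "integrable lborel (\<lambda>\<xi>. ?P s * (cis (- (4 * pi * (\<xi> \<bullet> s))) * of_real (?E \<xi>)))" for s
      by (intro integrable_mult_right, rule Bochner_Integration.integrable_bound[OF E]) (auto simp: norm_mult)
    have "(\<integral>\<xi>. norm (?P s * (cis (- (4 * pi * (\<xi> \<bullet> s))) * of_real (?E \<xi>))) \<partial>lborel) = norm (?P s) * integral\<^sup>L lborel ?E" for s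
      by (simp add: norm_mult)
    then show "integrable lborel (\<lambda>s. \<integral>\<xi>. norm (?P s * (cis (- (4 * pi * (\<xi> \<bullet> s))) * of_real (?E \<xi>))) \<partial>lborel)"
      using integrable_norm[OF P] by simp
  qed measurable
  also have "\<dots> = (\<integral>s. ?P s * (of_real ?\<kappa> * (of_real (?G s) * cis (- (4 * pi * (\<xi>0 \<bullet> s))))) \<partial>lborel)"
    unfolding integral_mult_right_zero freq ..
  also have "\<dots> = of_real ?\<kappa> * (\<integral>s. ?P s * (of_real (?G s) * cis (- (4 * pi * (\<xi>0 \<bullet> s)))) \<partial>lborel)"
    unfolding integral_mult_right_zero[symmetric] by (simp only: mult_ac)
  finally show ?thesis .
qed

text \<open>
  This is the instance of Moyal's identity in which the second Wigner distribution is that of a coherent state.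
  It rests on the parallelogram law \<open>|u - x0|\<^sup>2 + |v - x0|\<^sup>2 = 2 |s|\<^sup>2 + 2 |x - x0|\<^sup>2\<close> for \<open>u = x + s\<close> and
  \<open>v = x - s\<close>: the Gaussian in \<open>s\<close> from the frequency average and the Gaussian in \<open>x\<close> combine to
  a product of a function of \<open>u\<close> and a function of \<open>v\<close>.
\<close>
lemma wig_gaussian_average:
  fixes f g :: "real ^ 'n \<Rightarrow> complex"
  assumes f: "borel_L2 f" and g: "borel_L2 g"
  shows "(\<integral>x. (\<integral>\<xi>. wig f g (x, \<xi>) * of_real (exp (- (2 * pi) * (norm (\<xi> - \<xi>0))\<^sup>2)) \<partial>lborel)
              * of_real (exp (- (2 * pi) * (norm (x - x0))\<^sup>2)) \<partial>lborel)
    = of_real ((\<integral>\<xi>. exp (- (2 * pi) * (norm \<xi>)\<^sup>2) \<partial>(lborel :: (real^'n) measure)) * (1 / 2) ^ CARD('n))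
      * ((\<integral>u. f u * phase_gauss x0 \<xi>0 u \<partial>lborel) * cnj (\<integral>u. g u * phase_gauss x0 \<xi>0 u \<partial>lborel))"
proof -
  let ?\<kappa> = "(\<integral>\<xi>. exp (- (2 * pi) * (norm \<xi>)\<^sup>2) \<partial>(lborel :: (real^'n) measure))"
  let ?F = "\<lambda>u. f u * phase_gauss x0 \<xi>0 u" and ?G = "\<lambda>u. cnj (g u * phase_gauss x0 \<xi>0 u)"
  have prod: "f (x + s) * cnj (g (x - s)) * (of_real (exp (- (2 * pi) * (norm s)\<^sup>2)) * cis (- (4 * pi * (\<xi>0 \<bullet> s))))
      * of_real (exp (- (2 * pi) * (norm (x - x0))\<^sup>2)) = ?F (x + s) * ?G (x - s)" for x s
  proof -
    have "(norm (x + s - x0))\<^sup>2 + (norm (x - s - x0))\<^sup>2 = 2 * ((norm s)\<^sup>2 + (norm (x - x0))\<^sup>2)"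
      by (simp add: power2_norm_eq_inner inner_simps inner_commute)
    then have "- pi * ((norm (x + s - x0))\<^sup>2 + (norm (x - s - x0))\<^sup>2) = - (2 * pi) * ((norm s)\<^sup>2 + (norm (x - x0))\<^sup>2)"
      by simp
    then have "exp (- pi * (norm (x + s - x0))\<^sup>2) * exp (- pi * (norm (x - s - x0))\<^sup>2)
        = exp (- (2 * pi) * (norm s)\<^sup>2) * exp (- (2 * pi) * (norm (x - x0))\<^sup>2)"
      unfolding exp_add[symmetric] distrib_left by (rule arg_cong[of _ _ exp])
    then have 1: "complex_of_real (exp (- pi * (norm (x + s - x0))\<^sup>2)) * of_real (exp (- pi * (norm (x - s - x0))\<^sup>2))
        = of_real (exp (- (2 * pi) * (norm s)\<^sup>2)) * of_real (exp (- (2 * pi) * (norm (x - x0))\<^sup>2))"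
      by (metis of_real_mult)
    have 2: "cis (- (2 * pi * (\<xi>0 \<bullet> (x + s)))) * cis (2 * pi * (\<xi>0 \<bullet> (x - s))) = cis (- (4 * pi * (\<xi>0 \<bullet> s)))"
      by (simp add: cis_mult inner_simps algebra_simps)
    have "?F (x + s) * ?G (x - s) = f (x + s) * cnj (g (x - s))
        * (complex_of_real (exp (- pi * (norm (x + s - x0))\<^sup>2)) * of_real (exp (- pi * (norm (x - s - x0))\<^sup>2)))
        * (cis (- (2 * pi * (\<xi>0 \<bullet> (x + s)))) * cis (2 * pi * (\<xi>0 \<bullet> (x - s))))"
      by (simp add: phase_gauss_def cis_cnj mult_ac)
    then show ?thesis unfolding 1 2 by (simp only: mult_ac)
  qed
  have G: "integrable lborel ?G"
    using integrable_L2_phase_gauss[OF g] by (rule integrable_cnj)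
  have "(\<integral>x. (\<integral>\<xi>. wig f g (x, \<xi>) * of_real (exp (- (2 * pi) * (norm (\<xi> - \<xi>0))\<^sup>2)) \<partial>lborel)
              * of_real (exp (- (2 * pi) * (norm (x - x0))\<^sup>2)) \<partial>lborel)
      = (\<integral>x. of_real ?\<kappa> * (\<integral>s. ?F (x + s) * ?G (x - s) \<partial>lborel) \<partial>lborel)"
    unfolding wig_gaussian_average_frequency[OF f g] prod[symmetric] integral_mult_left_zero by (simp only: mult.assoc)
  also have "\<dots> = of_real ?\<kappa> * (\<integral>x. (\<integral>s. ?F (x + s) * ?G (x - s) \<partial>lborel) \<partial>lborel)"
    by (rule integral_mult_right_zero)
  also have "\<dots> = of_real ?\<kappa> * (of_real ((1 / 2) ^ DIM(real^'n)) * (integral\<^sup>L lborel ?F * integral\<^sup>L lborel ?G))"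
    by (subst convolution_at_double_point[OF integrable_L2_phase_gauss[OF f] G]) (rule refl)
  also have "integral\<^sup>L lborel ?G = cnj (\<integral>u. g u * phase_gauss x0 \<xi>0 u \<partial>lborel)"
    by (simp del: complex_cnj_mult)
  also have "DIM(real^'n) = CARD('n)"
    by simp
  finally show ?thesis
    unfolding of_real_mult mult.assoc .
qed

text \<open>
  The average of a positive function against a positive weight is positive.
\<close>
lemma Re_wig_pos_imp:
  fixes f g :: "real ^ 'n \<Rightarrow> complex"
  assumes f: "borel_L2 f" and g: "borel_L2 g" and pos: "\<And>z. Re (wig f g z) > 0"
  shows "Re ((\<integral>u. f u * phase_gauss x0 \<xi>0 u \<partial>lborel) * cnj (\<integral>u. g u * phase_gauss x0 \<xi>0 u \<partial>lborel)) > 0"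
proof -
  note [measurable] = assms(1,2)[THEN borel_L2_measurable]
  let ?\<kappa> = "(\<integral>\<xi>. exp (- (2 * pi) * (norm \<xi>)\<^sup>2) \<partial>(lborel :: (real^'n) measure))"
  let ?E = "\<lambda>a \<xi>::real^'n. exp (- (2 * pi) * (norm (\<xi> - a))\<^sup>2)"
  have E: "integrable lborel (?E a)" for a
    using lborel_integrable_affine[OF integrable_gaussian[of "2 * pi", where 'a="real^'n"], of 1 "- a"] by simp
  obtain B where B: "\<And>z. norm (wig f g z) \<le> B"
    using norm_wig_le[OF f g] by blast
  have B0: "B \<ge> 0" using B[of 0] norm_ge_zero order_trans by blast
  have wigm [measurable]: "wig f g \<in> borel_measurable (borel \<Otimes>\<^sub>M borel)"
    using borel_measurable_continuous_onI[OF continuous_on_wig[OF f g]] by (simp add: borel_prod)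
  have wigx [measurable]: "(\<lambda>\<xi>. wig f g (x, \<xi>)) \<in> borel_measurable borel" for x
    by measurable
  define I where "I = (\<lambda>x. \<integral>\<xi>. wig f g (x, \<xi>) * of_real (?E \<xi>0 \<xi>) \<partial>lborel)"
  have "(\<lambda>x. \<integral>\<xi>. (\<lambda>(x, \<xi>). wig f g (x, \<xi>) * of_real (?E \<xi>0 \<xi>)) (x, \<xi>) \<partial>lborel) \<in> borel_measurable borel"
    by measurable
  then have Im [measurable]: "I \<in> borel_measurable borel"
    by (simp add: I_def)
  have int1: "integrable lborel (\<lambda>\<xi>. wig f g (x, \<xi>) * of_real (?E \<xi>0 \<xi>))" for x
    by (rule Bochner_Integration.integrable_bound[OF integrable_mult_right[OF E[of \<xi>0], of B]])
      (use B B0 in \<open>auto simp: norm_mult abs_mult intro!: mult_right_mono\<close>)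
  have Ipos: "Re (I x) > 0" for x
  proof -
    have "Re (I x) = (\<integral>\<xi>. Re (wig f g (x, \<xi>) * of_real (?E \<xi>0 \<xi>)) \<partial>lborel)"
      unfolding I_def by (rule integral_Re[symmetric]) (rule int1)
    also have "\<dots> > 0"
    proof (rule integral_lborel_pos)
      show "integrable lborel (\<lambda>\<xi>. Re (wig f g (x, \<xi>) * of_real (?E \<xi>0 \<xi>)))"
        by (rule integrable_Re[OF int1])
      show "Re (wig f g (x, \<xi>) * of_real (?E \<xi>0 \<xi>)) > 0" for \<xi>
        using pos[of "(x, \<xi>)"] by simp
    qed
    finally show ?thesis .
  qed
  have Ibd: "norm (I x) \<le> B * integral\<^sup>L lborel (?E \<xi>0)" for x
  proof -
    have "norm (I x) \<le> (\<integral>\<xi>. norm (wig f g (x, \<xi>) * of_real (?E \<xi>0 \<xi>)) \<partial>lborel)"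
      unfolding I_def by (rule integral_norm_bound)
    also have "\<dots> \<le> (\<integral>\<xi>. B * ?E \<xi>0 \<xi> \<partial>lborel)"
      by (intro integral_mono integrable_norm int1 integrable_mult_right E) (use B in \<open>auto simp: norm_mult intro!: mult_right_mono\<close>)
    finally show ?thesis by simp
  qed
  have int2: "integrable lborel (\<lambda>x. I x * of_real (?E x0 x))"
  proof (rule Bochner_Integration.integrable_bound[OF integrable_mult_right[OF E[of x0], of "B * integral\<^sup>L lborel (?E \<xi>0)"]])
    have "norm (I x * of_real (?E x0 x)) \<le> B * integral\<^sup>L lborel (?E \<xi>0) * ?E x0 x" for x
      using mult_right_mono[OF Ibd[of x], of "?E x0 x"] by (simp add: norm_mult)
    then have "norm (I x * of_real (?E x0 x)) \<le> norm (B * integral\<^sup>L lborel (?E \<xi>0) * ?E x0 x)" for x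
      using order_trans abs_ge_self unfolding real_norm_def by blast
    then show "AE x in lborel. norm (I x * of_real (?E x0 x)) \<le> norm (B * integral\<^sup>L lborel (?E \<xi>0) * ?E x0 x)"
      by (intro always_eventually allI)
  qed measurable
  have "Re (\<integral>x. I x * of_real (?E x0 x) \<partial>lborel) = (\<integral>x. Re (I x * of_real (?E x0 x)) \<partial>lborel)"
    by (rule integral_Re[symmetric]) (rule int2)
  also have "\<dots> > 0"
  proof (rule integral_lborel_pos)
    show "integrable lborel (\<lambda>x. Re (I x * of_real (?E x0 x)))"
      by (rule integrable_Re[OF int2])
    show "Re (I x * of_real (?E x0 x)) > 0" for x
      using Ipos[of x] by simp
  qed
  finally have avg: "Re (\<integral>x. I x * of_real (?E x0 x) \<partial>lborel) > 0" .
  have Re_scale: "Re (of_real r * w) = r * Re w" for r w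
    by simp
  have "?\<kappa> * (1 / 2) ^ CARD('n) * Re ((\<integral>u. f u * phase_gauss x0 \<xi>0 u \<partial>lborel) * cnj (\<integral>u. g u * phase_gauss x0 \<xi>0 u \<partial>lborel)) > 0"
    using avg unfolding I_def wig_gaussian_average[OF f g] Re_scale .
  moreover have "?\<kappa> * (1 / 2) ^ CARD('n) > 0"
    using integral_gaussian_pos[of "2 * pi", where 'a="real^'n"] by simp
  ultimately show ?thesis
    by (rule zero_less_mult_pos)
qed

section \<open>The Bargmann transform\<close>

definition gauss_weight :: "'a::euclidean_space \<Rightarrow> complex" where
  "gauss_weight u = of_real (exp (- pi * (norm u)\<^sup>2))"

lemma gauss_weight_measurable [measurable]: "gauss_weight \<in> borel_measurable borel"
  unfolding gauss_weight_def[abs_def] by measurable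

lemma gauss_weight_nonzero [simp]: "gauss_weight u \<noteq> 0"
  by (simp add: gauss_weight_def)

lemma integrable_gauss_weight:
  fixes f q :: "'a::euclidean_space \<Rightarrow> complex"
  assumes f: "borel_L2 f" and [measurable]: "q \<in> borel_measurable borel"
    and q: "\<And>u. norm (q u) \<le> exp (K * norm u)"
  shows "integrable lborel (\<lambda>u. f u * gauss_weight u * q u)"
proof -
  note [measurable] = borel_L2_measurable[OF f]
  have "borel_L2 (\<lambda>u::'a. of_real (exp (- pi * (norm u)\<^sup>2 + K * norm u)))"
    unfolding borel_L2_def
  proof
    have "(\<lambda>u::'a. (cmod (of_real (exp (- pi * (norm u)\<^sup>2 + K * norm u))))\<^sup>2) = (\<lambda>u. exp (- (2 * pi) * (norm u)\<^sup>2 + (2 * K) * norm u))"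
      by (simp add: exp_double[symmetric] algebra_simps)
    then show "integrable lborel (\<lambda>u::'a. (cmod (of_real (exp (- pi * (norm u)\<^sup>2 + K * norm u))))\<^sup>2)"
      using integrable_gaussian_exp[of "2 * pi" "2 * K", where 'a='a] by simp
  qed measurable
  then have "integrable lborel (\<lambda>u. f u * of_real (exp (- pi * (norm u)\<^sup>2 + K * norm u)))"
    by (rule borel_L2_mult_integrable[OF f])
  then show ?thesis
  proof (rule Bochner_Integration.integrable_bound)
    have "norm (f u * gauss_weight u * q u) \<le> norm (f u * of_real (exp (- pi * (norm u)\<^sup>2 + K * norm u)))" for u
    proof -
      have "norm (f u) * (exp (- pi * (norm u)\<^sup>2) * norm (q u)) \<le> norm (f u) * (exp (- pi * (norm u)\<^sup>2) * exp (K * norm u))"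
        by (intro mult_left_mono q) auto
      then show ?thesis
        unfolding exp_add by (simp add: gauss_weight_def norm_mult mult.assoc)
    qed
    then show "AE u in lborel. norm (f u * gauss_weight u * q u) \<le> norm (f u * of_real (exp (- pi * (norm u)\<^sup>2 + K * norm u)))"
      by (intro always_eventually allI)
  qed measurable
qed

definition bargmann :: "(real ^ 'n \<Rightarrow> complex) \<Rightarrow> complex ^ 'n \<Rightarrow> complex" where
  "bargmann f z = (\<integral>u. f u * gauss_weight u * exp (2 * pi * cdot z (cvec u)) \<partial>lborel)"

lemma bargmann_dominated:
  fixes f :: "real ^ 'n \<Rightarrow> complex"
  assumes f: "borel_L2 f" and r: "r \<ge> 0"
  shows "integrable lborel (\<lambda>u. norm (f u * gauss_weight u * exp (2 * pi * cdot z (cvec u))) * exp (r * norm (2 * pi * cdot v (cvec u))))"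
proof -
  define K where "K = 2 * pi * ((\<Sum>i\<in>UNIV. norm (z $ i)) + r * (\<Sum>i\<in>UNIV. norm (v $ i)))"
  have "integrable lborel (\<lambda>u. f u * gauss_weight u * (exp (2 * pi * cdot z (cvec u)) * of_real (exp (r * norm (2 * pi * cdot v (cvec u))))))"
  proof (rule integrable_gauss_weight[OF f, where K=K])
    fix u :: "real^'n"
    have "Re (2 * pi * cdot z (cvec u)) \<le> 2 * pi * ((\<Sum>i\<in>UNIV. norm (z $ i)) * norm u)"
      using order_trans[OF complex_Re_le_cmod norm_cdot_cvec_le[of z u]] by simp
    moreover have "r * norm (2 * pi * cdot v (cvec u)) \<le> r * (2 * pi * ((\<Sum>i\<in>UNIV. norm (v $ i)) * norm u))"
      using norm_cdot_cvec_le[of v u] r by (intro mult_left_mono) (auto simp: norm_mult)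
    moreover have "K * norm u = 2 * pi * ((\<Sum>i\<in>UNIV. norm (z $ i)) * norm u) + r * (2 * pi * ((\<Sum>i\<in>UNIV. norm (v $ i)) * norm u))"
      by (simp add: K_def algebra_simps)
    ultimately have "Re (2 * pi * cdot z (cvec u)) + r * norm (2 * pi * cdot v (cvec u)) \<le> K * norm u"
      by linarith
    then show "norm (exp (2 * pi * cdot z (cvec u)) * of_real (exp (r * norm (2 * pi * cdot v (cvec u))))) \<le> exp (K * norm u)"
      by (simp add: norm_mult exp_add[symmetric])
  qed measurable
  from integrable_norm[OF this] show ?thesis
    by (simp add: norm_mult mult.assoc)
qed

lemma bargmann_line:
  "bargmann f (z + s *s v) = (\<integral>u. f u * gauss_weight u * exp (2 * pi * cdot z (cvec u)) * exp (s * (2 * pi * cdot v (cvec u))) \<partial>lborel)"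
  unfolding bargmann_def by (simp add: cdot_linear exp_add distrib_left mult_ac)

lemma bargmann_line_derivatives:
  fixes f :: "real ^ 'n \<Rightarrow> complex"
  assumes f: "borel_L2 f"
  defines "h \<equiv> \<lambda>z u. f u * gauss_weight u * exp (2 * pi * cdot z (cvec u))" and "p \<equiv> \<lambda>v u. 2 * pi * cdot v (cvec u)"
  shows "((\<lambda>s. bargmann f (z + s *s v)) has_field_derivative (\<integral>u. h z u * p v u * exp (s * p v u) \<partial>lborel)) (at s)"
    and "((\<lambda>s. \<integral>u. h z u * p v u * exp (s * p v u) \<partial>lborel) has_field_derivative (\<integral>u. h z u * p v u * p v u * exp (s * p v u) \<partial>lborel)) (at s)"
proof -
  note [measurable] = borel_L2_measurable[OF f]
  have h [measurable]: "h z \<in> borel_measurable lborel" and p [measurable]: "p v \<in> borel_measurable lborel"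
    unfolding h_def p_def by measurable
  have dom: "integrable lborel (\<lambda>u. norm (h z u) * exp (r * norm (p v u)))" if "r \<ge> 0" for r
    unfolding h_def p_def by (rule bargmann_dominated[OF f that])
  show "((\<lambda>s. bargmann f (z + s *s v)) has_field_derivative (\<integral>u. h z u * p v u * exp (s * p v u) \<partial>lborel)) (at s)"
    unfolding bargmann_line using laplace_has_field_derivative(1)[OF h p dom] unfolding h_def p_def .
  show "((\<lambda>s. \<integral>u. h z u * p v u * exp (s * p v u) \<partial>lborel) has_field_derivative (\<integral>u. h z u * p v u * p v u * exp (s * p v u) \<partial>lborel)) (at s)"
    by (rule laplace_has_field_derivative(1)[OF _ p laplace_has_field_derivative(2)[OF h p dom]]) measurable
qed

text \<open>
  The bound \<open>2 \<pi> a t \<le> \<pi> t\<^sup>2 / 2 + 2 \<pi> a\<^sup>2\<close> leaves half of the Gaussian weight for integrability and shows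
  that the transform has order at most two along complex lines.
\<close>
lemma bargmann_growth:
  fixes f :: "real ^ 'n \<Rightarrow> complex"
  assumes f: "borel_L2 f"
  obtains C K where "\<And>s. norm (bargmann f (s *s v)) \<le> C * exp (K * (norm s)\<^sup>2)"
proof -
  note [measurable] = borel_L2_measurable[OF f]
  define k where "k = (\<Sum>i\<in>UNIV. norm (v $ i))"
  have L2: "borel_L2 (\<lambda>u::real^'n. of_real (exp (- (pi / 2) * (norm u)\<^sup>2)))"
    unfolding borel_L2_def
  proof
    have "(\<lambda>u::real^'n. (cmod (of_real (exp (- (pi / 2) * (norm u)\<^sup>2))))\<^sup>2) = (\<lambda>u. exp (- pi * (norm u)\<^sup>2))"
      by (simp add: exp_double[symmetric])
    then show "integrable lborel (\<lambda>u::real^'n. (cmod (of_real (exp (- (pi / 2) * (norm u)\<^sup>2))))\<^sup>2)"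
      using integrable_gaussian[of pi, where 'a="real^'n"] by simp
  qed measurable
  define H where "H = (\<lambda>u. norm (f u) * exp (- (pi / 2) * (norm u)\<^sup>2))"
  have H: "integrable lborel H"
    using integrable_norm[OF borel_L2_mult_integrable[OF f L2]] by (simp add: H_def norm_mult)
  have "norm (bargmann f (s *s v)) \<le> integral\<^sup>L lborel H * exp ((2 * pi * k\<^sup>2) * (norm s)\<^sup>2)" for s
  proof -
    have pt: "norm (f u * gauss_weight u * exp (2 * pi * cdot (s *s v) (cvec u))) \<le> H u * exp ((2 * pi * k\<^sup>2) * (norm s)\<^sup>2)" for u
    proof -
      have "Re (2 * pi * cdot (s *s v) (cvec u)) \<le> norm (2 * pi * cdot (s *s v) (cvec u))"
        by (rule complex_Re_le_cmod)
      also have "\<dots> \<le> 2 * pi * (norm s * (k * norm u))"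
        using norm_cdot_cvec_le[of v u] by (simp add: norm_mult cdot_linear k_def mult_left_mono)
      finally have 1: "Re (2 * pi * cdot (s *s v) (cvec u)) \<le> 2 * pi * (norm s * (k * norm u))" .
      have "0 \<le> (pi / 2) * (norm u - 2 * (norm s * k))\<^sup>2" by simp
      also have "\<dots> = (pi / 2) * (norm u)\<^sup>2 - 2 * pi * (norm s * (k * norm u)) + (2 * pi * k\<^sup>2) * (norm s)\<^sup>2"
        by (simp add: power2_eq_square algebra_simps)
      finally have "Re (2 * pi * cdot (s *s v) (cvec u)) \<le> (pi / 2) * (norm u)\<^sup>2 + (2 * pi * k\<^sup>2) * (norm s)\<^sup>2"
        using 1 by linarith
      moreover have "- pi * (norm u)\<^sup>2 + (pi / 2) * (norm u)\<^sup>2 = - (pi / 2) * (norm u)\<^sup>2"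
        by (simp add: field_simps)
      ultimately have 2: "- pi * (norm u)\<^sup>2 + Re (2 * pi * cdot (s *s v) (cvec u)) \<le> - (pi / 2) * (norm u)\<^sup>2 + (2 * pi * k\<^sup>2) * (norm s)\<^sup>2"
        by linarith
      have "norm (f u * gauss_weight u * exp (2 * pi * cdot (s *s v) (cvec u)))
          = norm (f u) * exp (- pi * (norm u)\<^sup>2 + Re (2 * pi * cdot (s *s v) (cvec u)))"
        unfolding exp_add by (simp add: norm_mult gauss_weight_def)
      also have "\<dots> \<le> norm (f u) * exp (- (pi / 2) * (norm u)\<^sup>2 + (2 * pi * k\<^sup>2) * (norm s)\<^sup>2)"
        using 2 by (intro mult_left_mono) (simp_all only: exp_le_cancel_iff norm_ge_zero)
      finally show ?thesis by (simp only: H_def exp_add mult.assoc)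
    qed
    have "norm (bargmann f (s *s v)) \<le> (\<integral>u. norm (f u * gauss_weight u * exp (2 * pi * cdot (s *s v) (cvec u))) \<partial>lborel)"
      unfolding bargmann_def by (rule integral_norm_bound)
    also have "\<dots> \<le> (\<integral>u. H u * exp ((2 * pi * k\<^sup>2) * (norm s)\<^sup>2) \<partial>lborel)"
    proof (rule integral_mono[OF _ _ pt])
      show "integrable lborel (\<lambda>u. norm (f u * gauss_weight u * exp (2 * pi * cdot (s *s v) (cvec u))))"
        using bargmann_dominated[OF f order_refl, of "s *s v" 0] by (simp del: norm_exp_eq_Re)
    qed (use H in simp)
    finally show ?thesis by simp
  qed
  then show ?thesis by (rule that)
qed

text \<open>
  Expanding the square in the coherent state shows that its pairings with \<open>f\<close> are the values of an entire
  function of \<open>x - i \<xi>\<close>, up to a positive factor.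
\<close>
lemma phase_gauss_transform_eq_bargmann:
  "(\<integral>u. f u * phase_gauss x \<xi> u \<partial>lborel) = of_real (exp (- pi * (norm x)\<^sup>2)) * bargmann f (cvec x - \<i> *s cvec \<xi>)"
proof -
  have "phase_gauss x \<xi> u = of_real (exp (- pi * (norm x)\<^sup>2)) * (gauss_weight u * exp (2 * pi * cdot (cvec x - \<i> *s cvec \<xi>) (cvec u)))" for u
  proof -
    have "- pi * (norm (u - x))\<^sup>2 = - pi * (norm x)\<^sup>2 + (- pi * (norm u)\<^sup>2 + 2 * pi * (x \<bullet> u))"
      by (simp add: power2_norm_eq_inner inner_simps inner_commute algebra_simps)
    then have "exp (- pi * (norm (u - x))\<^sup>2) = exp (- pi * (norm x)\<^sup>2) * (exp (- pi * (norm u)\<^sup>2) * exp (2 * pi * (x \<bullet> u)))"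
      by (simp only: exp_add)
    moreover have "exp (2 * pi * cdot (cvec x - \<i> *s cvec \<xi>) (cvec u)) = of_real (exp (2 * pi * (x \<bullet> u))) * cis (- (2 * pi * (\<xi> \<bullet> u)))"
      by (simp add: cdot_linear cdot_cvec cis_conv_exp exp_of_real[symmetric] exp_add[symmetric] algebra_simps)
    ultimately show ?thesis
      by (simp only: phase_gauss_def gauss_weight_def of_real_mult mult_ac)
  qed
  then have "(\<integral>u. f u * phase_gauss x \<xi> u \<partial>lborel)
      = (\<integral>u. of_real (exp (- pi * (norm x)\<^sup>2)) * (f u * gauss_weight u * exp (2 * pi * cdot (cvec x - \<i> *s cvec \<xi>) (cvec u))) \<partial>lborel)"
    by (simp only: mult_ac)
  then show ?thesis
    unfolding bargmann_def by (simp only: integral_mult_right_zero)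
qed

lemma Re_wig_pos_imp_bargmann:
  fixes f g :: "real ^ 'n \<Rightarrow> complex"
  assumes f: "borel_L2 f" and g: "borel_L2 g" and pos: "\<And>z. Re (wig f g z) > 0"
  shows "Re (bargmann f z * cnj (bargmann g z)) > 0"
proof -
  define x \<xi> where "x = (\<chi> i. Re (z $ i))" and "\<xi> = (\<chi> i. - Im (z $ i))"
  have z: "z = cvec x - \<i> *s cvec \<xi>"
    by (simp add: vec_eq_iff cvec_def x_def \<xi>_def complex_eq_iff)
  define r where "r = exp (- pi * (norm x)\<^sup>2)"
  have "Re ((of_real r * bargmann f z) * cnj (of_real r * bargmann g z)) > 0"
    using Re_wig_pos_imp[OF f g pos, of x \<xi>] unfolding phase_gauss_transform_eq_bargmann z r_def .
  moreover have "(of_real r * bargmann f z) * cnj (of_real r * bargmann g z) = of_real (r\<^sup>2) * (bargmann f z * cnj (bargmann g z))"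
    by (simp add: power2_eq_square mult_ac)
  ultimately have "Re (of_real (r\<^sup>2) * (bargmann f z * cnj (bargmann g z))) > 0"
    by (simp only:)
  moreover have "Re (of_real t * w) = t * Re w" for t w
    by simp
  ultimately have "r\<^sup>2 * Re (bargmann f z * cnj (bargmann g z)) > 0"
    by (simp only:)
  then show ?thesis
    by (rule zero_less_mult_pos) (simp add: r_def)
qed

lemma bargmann_line_holomorphic:
  assumes "borel_L2 f"
  shows "(\<lambda>s. bargmann f (s *s v)) holomorphic_on UNIV"
  using bargmann_line_derivatives(1)[OF assms, of 0 v]
  by (auto simp: holomorphic_on_def field_differentiable_def)

text \<open>
  Since \<open>F / G\<close> and \<open>F \<sqdot> cnj G\<close> differ by the positive factor \<open>|G|\<^sup>2\<close>, the quotient has positive real part and is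
  constant on the complex line through \<open>0\<close> and \<open>z\<close>.
\<close>
lemma bargmann_proportional:
  fixes f g :: "real ^ 'n \<Rightarrow> complex"
  assumes f: "borel_L2 f" and g: "borel_L2 g"
    and pos: "\<And>z. Re (bargmann f z * cnj (bargmann g z)) > 0"
  shows "bargmann f z = bargmann f 0 / bargmann g 0 * bargmann g z"
proof -
  have nz: "bargmann g w \<noteq> 0" for w
    using pos[of w] by auto
  define h where "h = (\<lambda>s. bargmann f (s *s z) / bargmann g (s *s z))"
  have "h holomorphic_on UNIV"
    unfolding h_def by (intro holomorphic_intros bargmann_line_holomorphic f g) (use nz in auto)
  moreover have "Re (h s) > 0" for s
  proof -
    have "h s = bargmann f (s *s z) * cnj (bargmann g (s *s z)) / of_real ((norm (bargmann g (s *s z)))\<^sup>2)"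
      unfolding h_def by (rule complex_div_cnj)
    then have "Re (h s) = Re (bargmann f (s *s z) * cnj (bargmann g (s *s z))) / (norm (bargmann g (s *s z)))\<^sup>2"
      by (simp only: Re_divide_of_real)
    also have "\<dots> > 0"
      using pos nz by (intro divide_pos_pos) auto
    finally show ?thesis .
  qed
  ultimately have "h 1 = h 0" by (rule entire_Re_pos_constant)
  then show ?thesis using nz[of z] by (simp add: h_def field_simps)
qed

section \<open>Decay of the Fourier transform\<close>

text \<open>
  Translating by a vector \<open>a n\<close> with \<open>(n + 1) y \<sqdot> a n = \<pi>\<close> changes the sign of the character. So twice the integral
  is an integral of \<open>k u - k (a n + u)\<close>, and \<open>a n\<close> tends to zero.
\<close>
lemma cts_bdd_supp_fourier_decay:
  fixes k :: "'a::euclidean_space \<Rightarrow> complex"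
  assumes k: "cts_bdd_supp k" and y: "y \<noteq> 0"
  shows "(\<lambda>n. \<integral>u. k u * cis (real (Suc n) * (y \<bullet> u)) \<partial>lborel) \<longlonglongrightarrow> 0"
proof -
  obtain B R where B: "\<And>x. norm (k x) \<le> B" "B > 0" "R > 0" "\<And>x. norm x > R \<Longrightarrow> k x = 0"
    using cts_bdd_supp_bound[OF k] by blast
  have ck: "continuous_on UNIV k" using k by (simp add: cts_bdd_supp_def)
  note [measurable] = borel_measurable_continuous_onI[OF ck]
  \<comment> \<open>The frequency is \<open>n + 1\<close> rather than \<open>n\<close>, so that this vector is defined for all \<open>n\<close>.\<close>
  define a where "a = (\<lambda>n. (pi / (norm y)\<^sup>2 * inverse (real (Suc n))) *\<^sub>R y)"
  have ya: "real (Suc n) * (y \<bullet> a n) = pi" for n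
    using y by (simp add: a_def power2_norm_eq_inner del: of_nat_Suc)
  define I where "I = (\<lambda>n. \<integral>u. k u * cis (real (Suc n) * (y \<bullet> u)) \<partial>lborel)"
  define D where "D = (\<lambda>n. \<integral>u. norm (k u - k (a n + u)) \<partial>lborel)"
  have intk: "integrable lborel (\<lambda>u. k (b + u))" for b
  proof (rule Bochner_Integration.integrable_bound[OF integrable_indicator_cball[of B "- b" R]])
    have "norm (k (b + u)) \<le> norm (B * indicator (cball (- b) R) u)" for u
    proof (cases "norm (b + u) > R")
      case False
      then have "u \<in> cball (- b) R"
        using norm_minus_cancel[of "b + u"] by (simp add: dist_norm)
      then show ?thesis using B(1)[of "b + u"] by simp
    qed (simp add: B)
    then show "AE u in lborel. norm (k (b + u)) \<le> norm (B * indicator (cball (- b) R) u)"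
      by (intro always_eventually allI)
  qed measurable
  have intc: "integrable lborel (\<lambda>u. k (b + u) * cis (t * (y \<bullet> u)))" for b t
    by (rule Bochner_Integration.integrable_bound[OF intk[of b]]) (auto simp: norm_mult)
  have ID: "norm (I n) \<le> D n" for n
  proof -
    have "I n = (\<integral>u. k (a n + u) * cis (real (Suc n) * (y \<bullet> (a n + u))) \<partial>lborel)"
      unfolding I_def using lborel_integral_affine[of "\<lambda>u. k u * cis (real (Suc n) * (y \<bullet> u))" 1 "a n"] by simp
    also have "\<dots> = (\<integral>u. - (k (a n + u) * cis (real (Suc n) * (y \<bullet> u))) \<partial>lborel)"
      unfolding inner_add_right distrib_left ya cis_mult[symmetric] cis_pi by simp
    finally have "I n = - (\<integral>u. k (a n + u) * cis (real (Suc n) * (y \<bullet> u)) \<partial>lborel)"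
      by simp
    then have "I n + I n = (\<integral>u. k u * cis (real (Suc n) * (y \<bullet> u)) \<partial>lborel) - (\<integral>u. k (a n + u) * cis (real (Suc n) * (y \<bullet> u)) \<partial>lborel)"
      unfolding I_def by simp
    also have "\<dots> = (\<integral>u. k u * cis (real (Suc n) * (y \<bullet> u)) - k (a n + u) * cis (real (Suc n) * (y \<bullet> u)) \<partial>lborel)"
      by (rule Bochner_Integration.integral_diff[symmetric])
        (use intc[of 0 "real (Suc n)"] intc[of "a n" "real (Suc n)"] in \<open>simp_all del: of_nat_Suc\<close>)
    also have "norm \<dots> \<le> (\<integral>u. norm (k u * cis (real (Suc n) * (y \<bullet> u)) - k (a n + u) * cis (real (Suc n) * (y \<bullet> u))) \<partial>lborel)"
      by (rule integral_norm_bound)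
    also have "\<dots> = D n"
      unfolding D_def left_diff_distrib[symmetric] by (simp add: norm_mult)
    finally have "norm (2 * I n) \<le> D n"
      by (simp only: mult_2)
    then have "2 * norm (I n) \<le> D n"
      by (simp only: norm_mult norm_numeral)
    then show ?thesis using norm_ge_zero[of "I n"] by linarith
  qed
  have D0: "D \<longlonglongrightarrow> 0"
  proof -
    have "(\<lambda>n. pi / (norm y)\<^sup>2 * inverse (real (Suc n))) \<longlonglongrightarrow> pi / (norm y)\<^sup>2 * 0"
      by (intro tendsto_intros LIMSEQ_inverse_real_of_nat)
    then have a: "a \<longlonglongrightarrow> 0"
      unfolding a_def using tendsto_scaleR[OF _ tendsto_const, of _ "pi / (norm y)\<^sup>2 * 0" sequentially y] by simp
    then have "Bseq a" by (intro convergent_imp_Bseq) (auto simp: convergent_def)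
    then obtain K where K: "K > 0" "\<And>n. norm (a n) \<le> K" by (auto simp: Bseq_def)
    have "D \<longlonglongrightarrow> (\<integral>u. 0 \<partial>(lborel :: 'a measure))"
      unfolding D_def
    proof (rule integral_dominated_convergence)
      show "integrable lborel (\<lambda>u. (2 * B) * indicator (cball 0 (R + K)) u :: real)"
        by (rule integrable_indicator_cball)
      show "AE u in lborel. (\<lambda>n. norm (k u - k (a n + u))) \<longlonglongrightarrow> 0"
      proof (intro always_eventually allI)
        fix u
        have "(\<lambda>n. a n + u) \<longlonglongrightarrow> 0 + u" by (intro tendsto_intros a)
        then have "(\<lambda>n. k (a n + u)) \<longlonglongrightarrow> k u"
          by (intro continuous_on_tendsto_compose[OF ck]) auto
        then have "(\<lambda>n. norm (k u - k (a n + u))) \<longlonglongrightarrow> norm (k u - k u)"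
          by (intro tendsto_intros)
        then show "(\<lambda>n. norm (k u - k (a n + u))) \<longlonglongrightarrow> 0" by simp
      qed
      show "AE u in lborel. norm (norm (k u - k (a n + u))) \<le> (2 * B) * indicator (cball 0 (R + K)) u" for n
      proof (intro always_eventually allI)
        fix u
        show "norm (norm (k u - k (a n + u))) \<le> (2 * B) * indicator (cball 0 (R + K)) u"
        proof (cases "norm u \<le> R + K")
          case True
          then show ?thesis
            using norm_triangle_ineq4[of "k u" "k (a n + u)"] B(1)[of u] B(1)[of "a n + u"] by simp
        next
          case False
          have "norm u \<le> norm (a n + u) + norm (a n)"
            using norm_triangle_ineq4[of "a n + u" "a n"] by simp
          then have "norm (a n + u) > R" "norm u > R" using False K(2)[of n] K(1) by linarith+
          then show ?thesis using B(4) False by simp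
        qed
      qed
    qed measurable
    then show ?thesis by simp
  qed
  have "I \<longlonglongrightarrow> 0"
    by (rule Lim_null_comparison[OF always_eventually D0]) (intro allI ID)
  then show ?thesis by (simp add: I_def)
qed

text \<open>
  The Riemann-Lebesgue lemma along a ray, by approximation in \<open>L\<^sup>2\<close>; the weight is itself square integrable, so the
  error is controlled by the Cauchy-Schwarz inequality.
\<close>
lemma fourier_decay:
  fixes f :: "'a::euclidean_space \<Rightarrow> complex"
  assumes f: "borel_L2 f" and y: "y \<noteq> 0"
  shows "(\<lambda>n. \<integral>u. f u * gauss_weight u * cis (real (Suc n) * (y \<bullet> u)) \<partial>lborel) \<longlonglongrightarrow> 0"
proof (rule LIMSEQ_I)
  fix e :: real assume e: "e > 0"
  note [measurable] = borel_L2_measurable[OF f]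
  have gw: "borel_L2 (gauss_weight :: 'a \<Rightarrow> complex)"
  proof -
    have "phase_gauss 0 0 = (gauss_weight :: 'a \<Rightarrow> complex)"
      by (simp add: fun_eq_iff phase_gauss_def gauss_weight_def)
    then show ?thesis using phase_gauss_L2[of 0 "0 :: 'a"] by simp
  qed
  let ?N = "\<lambda>h :: 'a \<Rightarrow> complex. \<integral>u. (cmod (h u))\<^sup>2 \<partial>lborel"
  \<comment> \<open>The summand \<open>1\<close> makes \<open>G\<close> positive without computing the integral.\<close>
  define G where "G = ?N gauss_weight + 1"
  have G: "G > 0" unfolding G_def by (simp add: add_nonneg_pos)
  have "(e / 2)\<^sup>2 / G > 0" using e G by simp
  then obtain \<phi> where \<phi>: "cts_bdd_supp \<phi>" "?N (\<lambda>u. f u - \<phi> u) < (e / 2)\<^sup>2 / G"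
    by (rule cts_bdd_supp_dense[OF f])
  have \<phi>2: "borel_L2 \<phi>" by (rule cts_bdd_supp_L2[OF \<phi>(1)])
  note [measurable] = borel_L2_measurable[OF \<phi>2]
  have "continuous_on UNIV (gauss_weight :: 'a \<Rightarrow> complex)"
    unfolding gauss_weight_def[abs_def] by (intro continuous_intros)
  then have k: "cts_bdd_supp (\<lambda>u. \<phi> u * gauss_weight u)"
    using \<phi>(1) by (auto simp: cts_bdd_supp_def intro!: continuous_intros)
  have "\<forall>\<^sub>F n in sequentially. dist (\<integral>u. \<phi> u * gauss_weight u * cis (real (Suc n) * (y \<bullet> u)) \<partial>lborel) 0 < e / 2"
    using e by (intro tendstoD[OF cts_bdd_supp_fourier_decay[OF k y]]) simp
  then obtain M where M: "\<And>n. n \<ge> M \<Longrightarrow> norm (\<integral>u. \<phi> u * gauss_weight u * cis (real (Suc n) * (y \<bullet> u)) \<partial>lborel) < e / 2"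
    by (auto simp: eventually_sequentially)
  have "norm (\<integral>u. f u * gauss_weight u * cis (real (Suc n) * (y \<bullet> u)) \<partial>lborel) < e" if "n \<ge> M" for n
  proof -
    have c: "integrable lborel (\<lambda>u. h u * gauss_weight u * cis (real (Suc n) * (y \<bullet> u)))" if "borel_L2 h" for h
    proof -
      note [measurable] = borel_L2_measurable[OF that]
      show ?thesis
        by (rule Bochner_Integration.integrable_bound[OF borel_L2_mult_integrable[OF that gw]]) (auto simp: norm_mult)
    qed
    let ?d = "\<lambda>u. f u - \<phi> u"
    have d: "borel_L2 ?d" by (rule borel_L2_diff[OF f \<phi>2])
    have split: "(\<integral>u. f u * gauss_weight u * cis (real (Suc n) * (y \<bullet> u)) \<partial>lborel)
        = (\<integral>u. ?d u * gauss_weight u * cis (real (Suc n) * (y \<bullet> u)) \<partial>lborel) + (\<integral>u. \<phi> u * gauss_weight u * cis (real (Suc n) * (y \<bullet> u)) \<partial>lborel)"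
      using c[OF f] c[OF \<phi>2] unfolding left_diff_distrib by simp
    have "norm (\<integral>u. ?d u * gauss_weight u * cis (real (Suc n) * (y \<bullet> u)) \<partial>lborel) \<le> (\<integral>u. norm (?d u * gauss_weight u * cis (real (Suc n) * (y \<bullet> u))) \<partial>lborel)"
      by (rule integral_norm_bound)
    also have "\<dots> = (\<integral>u. norm (?d u * gauss_weight u) \<partial>lborel)"
      by (simp add: norm_mult)
    also have "\<dots> \<le> e / 2"
    proof (rule power2_le_imp_le)
      have "(\<integral>u. norm (?d u * gauss_weight u) \<partial>lborel)\<^sup>2 \<le> ?N ?d * ?N gauss_weight"
        by (rule borel_L2_Cauchy_Schwarz[OF d gw])
      also have "\<dots> \<le> ((e / 2)\<^sup>2 / G) * G"
        by (intro mult_mono) (use \<phi>(2) in \<open>auto simp: G_def intro!: divide_nonneg_nonneg add_nonneg_nonneg\<close>)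
      finally show "(\<integral>u. norm (?d u * gauss_weight u) \<partial>lborel)\<^sup>2 \<le> (e / 2)\<^sup>2"
        using G by simp
    qed (use e in simp)
    finally show ?thesis
      unfolding split using M[OF that] norm_triangle_lt[of _ _ e] by force
  qed
  then show "\<exists>no. \<forall>n\<ge>no. norm ((\<integral>u. f u * gauss_weight u * cis (real (Suc n) * (y \<bullet> u)) \<partial>lborel) - 0) < e"
    by auto
qed

section \<open>Functions whose Bargmann transform has no zeros\<close>

lemma integrable_coordinates:
  fixes f :: "real ^ 'n \<Rightarrow> complex"
  assumes f: "borel_L2 f"
  shows "integrable lborel (\<lambda>u. f u * gauss_weight u * of_real (u $ i))"
    and "integrable lborel (\<lambda>u. f u * gauss_weight u * (of_real (u $ i) * of_real (u $ j)))"
proof -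
  have le: "\<bar>u $ i\<bar> \<le> exp (norm u)" for u :: "real^'n" and i
    using component_le_norm_cart[of u i] exp_ge_add_one_self[of "norm u"] by linarith
  show "integrable lborel (\<lambda>u. f u * gauss_weight u * of_real (u $ i))"
    by (rule integrable_gauss_weight[OF f, where K=1]) (use le in auto)
  have "\<bar>u $ i\<bar> * \<bar>u $ j\<bar> \<le> exp (norm u) * exp (norm u)" for u :: "real^'n"
    by (intro mult_mono le) auto
  then show "integrable lborel (\<lambda>u. f u * gauss_weight u * (of_real (u $ i) * of_real (u $ j)))"
    by (intro integrable_gauss_weight[OF f, where K=2]) (auto simp: norm_mult exp_add[symmetric])
qed

text \<open>
  On the line through \<open>z\<close> the exponent is determined by the first two derivatives at the origin. These are
  the moments of \<open>f u \<sqdot> exp (- \<pi> |u|\<^sup>2)\<close> against \<open>2 \<pi> z \<sqdot> u\<close> and its square, hence given by a vector \<open>b\<close> and a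
  symmetric matrix \<open>B\<close> that do not depend on \<open>z\<close>.
\<close>
lemma bargmann_zero_free_quadratic:
  fixes f :: "real ^ 'n \<Rightarrow> complex"
  assumes f: "borel_L2 f" and nz: "\<And>z. bargmann f z \<noteq> 0"
  obtains b :: "complex ^ 'n" and B :: "complex ^ 'n ^ 'n"
  where "transpose B = B" "\<And>z. bargmann f z = bargmann f 0 * exp (cdot b z + quad B z / 2)"
proof -
  let ?F0 = "bargmann f 0"
  define h where "h = (\<lambda>u. f u * gauss_weight u)"
  define m where "m = (\<lambda>i. \<integral>u. h u * of_real (u $ i) \<partial>lborel)"
  define mm where "mm = (\<lambda>i j. \<integral>u. h u * (of_real (u $ i) * of_real (u $ j)) \<partial>lborel)"
  define b :: "complex ^ 'n" where "b = (\<chi> i. 2 * pi * m i / ?F0)"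
  define B :: "complex ^ 'n ^ 'n" where "B = (\<chi> i j. (2 * pi)\<^sup>2 * mm i j / ?F0 - b $ i * b $ j)"
  have im: "integrable lborel (\<lambda>u. h u * of_real (u $ i))" for i
    unfolding h_def by (rule integrable_coordinates(1)[OF f])
  have imm: "integrable lborel (\<lambda>u. h u * (of_real (u $ i) * of_real (u $ j)))" for i j
    unfolding h_def by (rule integrable_coordinates(2)[OF f])
  have "transpose B = B"
    by (simp add: B_def transpose_def vec_eq_iff mm_def mult.commute)
  moreover have "bargmann f z = ?F0 * exp (cdot b z + quad B z / 2)" for z
  proof -
    define p where "p = (\<lambda>u. 2 * pi * cdot z (cvec u))"
    define \<phi> \<phi>' \<phi>'' where "\<phi> = (\<lambda>s. bargmann f (s *s z))"
      and "\<phi>' = (\<lambda>s. \<integral>u. h u * p u * exp (s * p u) \<partial>lborel)"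
      and "\<phi>'' = (\<lambda>s. \<integral>u. h u * p u * p u * exp (s * p u) \<partial>lborel)"
    have d1: "(\<phi> has_field_derivative \<phi>' s) (at s)" for s
      using bargmann_line_derivatives(1)[OF f, of 0 z s] by (simp add: \<phi>_def \<phi>'_def h_def p_def)
    have d2: "(\<phi>' has_field_derivative \<phi>'' s) (at s)" for s
      using bargmann_line_derivatives(2)[OF f, of 0 z s] by (simp add: \<phi>'_def \<phi>''_def h_def p_def)
    obtain C K where CK: "\<And>s. norm (\<phi> s) \<le> C * exp (K * (norm s)\<^sup>2)"
      unfolding \<phi>_def using bargmann_growth[OF f] by blast
    have \<phi>0: "\<phi> 0 = ?F0" by (simp add: \<phi>_def)
    have psum: "p u = (\<Sum>i\<in>UNIV. (2 * pi * z $ i) * of_real (u $ i))" for u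
      by (simp add: p_def cdot_def cvec_def sum_distrib_left mult.assoc)
    have "\<phi>' 0 = (\<integral>u. (\<Sum>i\<in>UNIV. (2 * pi * z $ i) * (h u * of_real (u $ i))) \<partial>lborel)"
      unfolding \<phi>'_def psum sum_distrib_left by (simp add: mult_ac)
    also have "\<dots> = (\<Sum>i\<in>UNIV. (2 * pi * z $ i) * m i)"
      using im by (simp add: m_def)
    finally have e1: "\<phi>' 0 / \<phi> 0 = cdot b z"
      by (simp add: \<phi>0 b_def cdot_def sum_divide_distrib mult_ac)
    have e2: "\<phi>'' 0 / \<phi> 0 - (cdot b z)\<^sup>2 = quad B z"
    proof -
      have "h u * p u * p u = (\<Sum>i\<in>UNIV. \<Sum>j\<in>UNIV. ((2 * pi)\<^sup>2 * (z $ i * z $ j)) * (h u * (of_real (u $ i) * of_real (u $ j))))" for u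
      proof -
        have "p u * p u = (\<Sum>i\<in>UNIV. \<Sum>j\<in>UNIV. ((2 * pi)\<^sup>2 * (z $ i * z $ j)) * (of_real (u $ i) * of_real (u $ j)))"
          unfolding psum sum_product by (simp add: power2_eq_square mult_ac)
        then show ?thesis
          unfolding mult.assoc[of "h u"] by (simp add: sum_distrib_left mult_ac)
      qed
      then have "\<phi>'' 0 = (\<integral>u. (\<Sum>i\<in>UNIV. \<Sum>j\<in>UNIV. ((2 * pi)\<^sup>2 * (z $ i * z $ j)) * (h u * (of_real (u $ i) * of_real (u $ j)))) \<partial>lborel)"
        unfolding \<phi>''_def by simp
      also have "\<dots> = (\<Sum>i\<in>UNIV. \<Sum>j\<in>UNIV. ((2 * pi)\<^sup>2 * (z $ i * z $ j)) * mm i j)"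
        using imm by (simp add: mm_def)
      finally have "\<phi>'' 0 / ?F0 = (\<Sum>i\<in>UNIV. \<Sum>j\<in>UNIV. z $ i * (((2 * pi)\<^sup>2 * mm i j / ?F0) * z $ j))"
        by (simp add: sum_divide_distrib mult_ac)
      moreover have "(cdot b z)\<^sup>2 = (\<Sum>i\<in>UNIV. \<Sum>j\<in>UNIV. z $ i * ((b $ i * b $ j) * z $ j))"
        unfolding power2_eq_square cdot_def sum_product by (simp add: mult_ac)
      moreover have "quad B z = (\<Sum>i\<in>UNIV. \<Sum>j\<in>UNIV. z $ i * (((2 * pi)\<^sup>2 * mm i j / ?F0 - b $ i * b $ j) * z $ j))"
        by (simp add: quad_def cdot_def matrix_vector_mult_def B_def sum_distrib_left)
      ultimately show ?thesis
        by (simp only: \<phi>0 left_diff_distrib right_diff_distrib sum_subtractf)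
    qed
    have "\<phi> s \<noteq> 0" for s by (simp add: \<phi>_def nz)
    from zero_free_order_two_jet[OF d1 d2 this CK, of 1]
    have "\<phi> 1 = ?F0 * exp (cdot b z * 1 + quad B z / 2 * 1\<^sup>2)"
      unfolding e1 e2 unfolding \<phi>0 .
    then show ?thesis by (simp add: \<phi>_def)
  qed
  ultimately show ?thesis by (rule that)
qed

lemma bargmann_imaginary_decay:
  fixes f :: "real ^ 'n \<Rightarrow> complex"
  assumes f: "borel_L2 f" and y: "y \<noteq> 0"
  shows "(\<lambda>n. bargmann f ((\<i> * of_real (real (Suc n))) *s cvec y)) \<longlonglongrightarrow> 0"
proof -
  have "bargmann f ((\<i> * of_real (real (Suc n))) *s cvec y) = (\<integral>u. f u * gauss_weight u * cis (real (Suc n) * (((2 * pi) *\<^sub>R y) \<bullet> u)) \<partial>lborel)" for n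
    unfolding bargmann_def by (simp add: cdot_linear cdot_cvec cis_conv_exp mult_ac del: of_nat_Suc)
  then show ?thesis
    using fourier_decay[OF f, of "(2 * pi) *\<^sub>R y"] y by (simp del: of_nat_Suc)
qed

text \<open>
  If the real part of the form were not positive at \<open>y\<close>, then along \<open>i t y\<close> the quadratic term of the exponent would not
  decrease the modulus. Choosing the sign of \<open>y\<close> so that the linear term does not decrease it either
  contradicts the decay along that ray.
\<close>
lemma bargmann_quadratic_pos_real_part:
  fixes f :: "real ^ 'n \<Rightarrow> complex"
  assumes f: "borel_L2 f" and nz: "bargmann f 0 \<noteq> 0"
    and eq: "\<And>z. bargmann f z = bargmann f 0 * exp (cdot b z + quad B z / 2)"
  shows "pos_real_part B"
  unfolding pos_real_part_def
proof (intro allI impI, rule ccontr)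
  fix y :: "real^'n" assume y: "y \<noteq> 0" and neg: "\<not> Re (quad B (cvec y)) > 0"
  define v where "v = (if Im (cdot b (cvec y)) \<le> 0 then y else - y)"
  have "cvec (- y) = - cvec y" "cdot b (- cvec y) = - cdot b (cvec y)" "quad B (- cvec y) = quad B (cvec y)"
    using quad_scale[of B "- 1" "cvec y"] by (simp_all add: cvec_def vec_eq_iff cdot_def sum_negf)
  then have v: "v \<noteq> 0" "Im (cdot b (cvec v)) \<le> 0" "quad B (cvec v) = quad B (cvec y)"
    using y by (auto simp: v_def)
  have "norm (bargmann f 0) \<le> norm (bargmann f ((\<i> * of_real (real (Suc n))) *s cvec v))" for n
  proof -
    define t where "t = real (Suc n)"
    have t: "t > 0" by (simp add: t_def)
    have "Re (cdot b ((\<i> * of_real t) *s cvec v) + quad B ((\<i> * of_real t) *s cvec v) / 2)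
        = t * (- Im (cdot b (cvec v))) + t\<^sup>2 / 2 * (- Re (quad B (cvec y)))"
      by (simp add: cdot_linear quad_scale v power_mult_distrib flip: of_real_power)
    also have "\<dots> \<ge> 0"
      using t v neg by (intro add_nonneg_nonneg mult_nonneg_nonneg) auto
    finally have "1 \<le> norm (exp (cdot b ((\<i> * of_real t) *s cvec v) + quad B ((\<i> * of_real t) *s cvec v) / 2))"
      by (simp only: norm_exp_eq_Re one_le_exp_iff)
    then have "norm (bargmann f 0) * 1 \<le> norm (bargmann f ((\<i> * of_real t) *s cvec v))"
      unfolding eq[of "(\<i> * of_real t) *s cvec v"] norm_mult by (rule mult_left_mono) simp
    then show ?thesis by (simp add: t_def)
  qed
  moreover have "(\<lambda>n. norm (bargmann f ((\<i> * of_real (real (Suc n))) *s cvec v))) \<longlonglongrightarrow> 0"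
    by (rule tendsto_norm_zero[OF bargmann_imaginary_decay[OF f v(1)]])
  ultimately have "norm (bargmann f 0) \<le> 0"
    by (intro LIMSEQ_le_const) auto
  with nz show False by simp
qed

text \<open>
  The Hermitian form of a complex symmetric matrix at \<open>p + i q\<close>: the mixed terms cancel by symmetry. This
  transfers positivity from real to complex vectors.
\<close>
lemma cdot_conjugate_matrix:
  fixes B :: "complex ^ 'n ^ 'n"
  assumes sym: "transpose B = B"
  shows "cdot (cvec p - \<i> *s cvec q) (B *v (cvec p + \<i> *s cvec q)) = quad B (cvec p) + quad B (cvec q)"
proof -
  have "cdot (cvec p) (B *v cvec q) = cdot (cvec q) (B *v cvec p)"
    using cdot_matrix[OF sym, of "cvec p" "cvec q"] cdot_commute by metis
  then show ?thesis
    by (simp add: quad_def matrix_vector_right_distrib vector_scalar_commute cdot_linear algebra_simps)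
qed

lemma complex_vector_cases:
  obtains p q where "x = cvec p + \<i> *s cvec q"
proof -
  have "x = cvec (\<chi> i. Re (x $ i)) + \<i> *s cvec (\<chi> i. Im (x $ i))"
    by (simp add: vec_eq_iff cvec_def complex_eq)
  then show ?thesis by (rule that)
qed

lemma Re_quad_sum_pos:
  assumes "pos_real_part B" and "cvec p + \<i> *s cvec q \<noteq> 0"
  shows "Re (quad B (cvec p) + quad B (cvec q)) > 0"
proof -
  have nonneg: "Re (quad B (cvec r)) \<ge> 0" for r
  proof (cases "r = 0")
    case True
    then show ?thesis by (simp add: quad_def cvec_def cdot_def)
  qed (use assms in \<open>auto simp: pos_real_part_def less_imp_le\<close>)
  have "p \<noteq> 0 \<or> q \<noteq> 0"
    using assms(2) by (auto simp: cvec_def vec_eq_iff)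
  then show ?thesis
    using assms(1) nonneg[of p] nonneg[of q] by (auto simp: pos_real_part_def add_pos_nonneg add_nonneg_pos)
qed

text \<open>
  Positivity on complex vectors gives a trivial kernel. For the inverse, put \<open>x = N y\<close> with \<open>y\<close> real: then
  \<open>y \<sqdot> N y = y \<sqdot> x\<close> has the same real part as \<open>cnj x \<sqdot> y = cnj x \<sqdot> B x\<close>, which is positive.
\<close>
lemma pos_real_part_inverse:
  fixes B :: "complex ^ 'n ^ 'n"
  assumes sym: "transpose B = B" and pos: "pos_real_part B"
  obtains N where "B ** N = mat 1" "N ** B = mat 1" "transpose N = N" "pos_real_part N"
proof -
  have ker: "x = 0" if "B *v x = 0" for x
  proof (rule ccontr)
    assume "x \<noteq> 0"
    obtain p q where x: "x = cvec p + \<i> *s cvec q" by (rule complex_vector_cases)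
    have "Re (quad B (cvec p) + quad B (cvec q)) > 0"
      using Re_quad_sum_pos[OF pos] \<open>x \<noteq> 0\<close> x by blast
    moreover have "quad B (cvec p) + quad B (cvec q) = 0"
      using cdot_conjugate_matrix[OF sym, of p q] that x by simp
    ultimately show False by simp
  qed
  then obtain N where NB: "N ** B = mat 1"
    using matrix_left_invertible_ker[of B] by blast
  then have BN: "B ** N = mat 1"
    using matrix_left_right_inverse by blast
  have Nsym: "transpose N = N"
  proof -
    have "transpose N ** B = mat 1"
      using arg_cong[OF BN, of transpose] by (simp add: matrix_transpose_mul sym)
    then have "transpose N ** B ** N = N"
      by simp
    then show ?thesis
      by (simp add: matrix_mul_assoc[symmetric] BN)
  qed
  have "pos_real_part N"
    unfolding pos_real_part_def
  proof (intro allI impI)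
    fix y :: "real^'n" assume y: "y \<noteq> 0"
    define x where "x = N *v cvec y"
    have Bx: "B *v x = cvec y"
      by (simp add: x_def matrix_vector_mul_assoc BN)
    obtain p q where x: "x = cvec p + \<i> *s cvec q" by (rule complex_vector_cases)
    have "x \<noteq> 0"
    proof
      assume "x = 0"
      then have "cvec y = 0" using Bx by simp
      with y show False by (simp add: cvec_def vec_eq_iff)
    qed
    then have "Re (quad B (cvec p) + quad B (cvec q)) > 0"
      using Re_quad_sum_pos[OF pos] x by blast
    also have "quad B (cvec p) + quad B (cvec q) = cdot (cvec p - \<i> *s cvec q) (cvec y)"
      using cdot_conjugate_matrix[OF sym, of p q] Bx x by simp
    also have "Re \<dots> = Re (cdot (cvec y) x)"
      by (simp add: x cdot_linear cdot_cvec inner_commute)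
    finally show "Re (quad N (cvec y)) > 0"
      by (simp add: quad_def x_def)
  qed
  with BN NB Nsym show ?thesis by (rule that)
qed

text \<open>
  Otherwise every value of the transform would vanish, in particular the Fourier transform of a nowhere
  vanishing Gaussian.
\<close>
lemma gauss_laplace_nonzero:
  fixes M :: "complex ^ 'n ^ 'n"
  assumes sym: "transpose M = M" and pos: "pos_real_part M" and inv: "M ** L = mat 1"
  shows "gauss_laplace M 0 \<noteq> 0"
proof
  assume 0: "gauss_laplace M 0 = 0"
  let ?k = "\<lambda>u. exp (- quad M (cvec u) / 2)"
  have "gauss_laplace M w = 0" for w
    using gauss_laplace_shift[OF sym pos, of "L *v w"] 0 by (simp add: matrix_vector_mul_assoc inv)
  moreover have "(\<integral>u. ?k u * cis (y \<bullet> u) \<partial>lborel) = gauss_laplace M (\<i> *s cvec y)" for y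
    unfolding gauss_laplace_def by (simp add: exp_add[symmetric] cdot_linear cdot_cvec cis_conv_exp)
  ultimately have "AE u in lborel. ?k u = 0"
    using gauss_laplace_integrable[OF pos, of 0] by (intro fourier_injective) auto
  then have "AE u in (lborel :: (real^'n) measure). False"
    by simp
  then show False
    by (simp add: eventually_False ae_filter_eq_bot_iff)
qed

text \<open>
  The matrix \<open>M\<close> is \<open>4 \<pi>\<^sup>2\<close> times the inverse of \<open>B\<close>, so that shifting by
  \<open>s = (b + B w) / (2 \<pi>)\<close> reproduces the exponent \<open>b \<sqdot> w + w \<sqdot> B w / 2\<close> up to a constant. The function \<open>k\<close> is the
  resulting Gaussian, with the weight \<open>exp (- \<pi> |u|\<^sup>2)\<close> still included; undoing the weight adds \<open>\<pi> |u|\<^sup>2\<close> to the exponent.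
\<close>
lemma bargmann_zero_free_imp_gaussian:
  fixes f :: "real ^ 'n \<Rightarrow> complex"
  assumes f: "borel_L2 f" and nz: "\<And>z. bargmann f z \<noteq> 0"
  shows "\<exists>Q. quadratic_polynomial Q \<and> (AE u in lborel. f u = exp (Q u))"
proof -
  let ?F0 = "bargmann f 0"
  obtain b B where symB: "transpose B = B" and eq: "\<And>z. bargmann f z = ?F0 * exp (cdot b z + quad B z / 2)"
    using bargmann_zero_free_quadratic[OF f nz] by blast
  have posB: "pos_real_part B"
    by (rule bargmann_quadratic_pos_real_part[OF f nz eq])
  obtain N where BN: "B ** N = mat 1" and NB: "N ** B = mat 1" and symN: "transpose N = N" and posN: "pos_real_part N"
    using pos_real_part_inverse[OF symB posB] by blast
  define c :: complex where "c = of_real ((2 * pi)\<^sup>2)"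
  define M where "M = (\<chi> i j. c * N $ i $ j)"
  have M: "M *v x = c *s (N *v x)" for x
    by (simp add: M_def vec_eq_iff matrix_vector_mult_def sum_distrib_left mult.assoc)
  have symM: "transpose M = M"
    using symN by (simp add: M_def transpose_def vec_eq_iff)
  have quadM: "quad M x = c * quad N x" for x
    by (simp add: quad_def M cdot_linear)
  have posM: "pos_real_part M"
    using posN unfolding pos_real_part_def quadM c_def by simp
  define L where "L = (\<chi> i j. inverse c * B $ i $ j)"
  have c0: "c \<noteq> 0" by (simp add: c_def)
  have inv: "M ** L = mat 1"
  proof -
    have "(c * x) * (inverse c * y) = x * y" for x y
      using c0 by simp
    then have "M ** L = N ** B"
      by (simp only: vec_eq_iff matrix_matrix_mult_def M_def L_def vec_lambda_beta simp_thms)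
    then show ?thesis using NB by simp
  qed
  define J where "J = gauss_laplace M 0"
  have J: "J \<noteq> 0" unfolding J_def by (rule gauss_laplace_nonzero[OF symM posM inv])
  define a where "a = (2 * of_real pi) *s (N *v b)"
  define k where "k = (\<lambda>u. exp (- quad M (cvec u) / 2 + cdot a (cvec u)))"
  have k: "integrable lborel k"
    unfolding k_def by (rule gauss_laplace_integrable[OF posM])
  define \<kappa> where "\<kappa> = ?F0 / (J * exp (quad N b / 2))"
  have \<kappa>: "\<kappa> \<noteq> 0" using nz[of 0] J by (simp add: \<kappa>_def)
  define H where "H = (\<lambda>u. f u * gauss_weight u)"
  have H: "integrable lborel H"
    unfolding H_def using integrable_gauss_weight[OF f, of "\<lambda>_. 1" 0] by simp
  have Hc: "integrable lborel (\<lambda>u. h u * cis (y \<bullet> u))" if "integrable lborel h" for h :: "real^'n \<Rightarrow> complex" and y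
  proof -
    note [measurable] = borel_measurable_integrable[OF that]
    show ?thesis by (rule Bochner_Integration.integrable_bound[OF that]) (auto simp: norm_mult)
  qed
  have ft: "(\<integral>u. H u * cis (y \<bullet> u) \<partial>lborel) = \<kappa> * (\<integral>u. k u * cis (y \<bullet> u) \<partial>lborel)" for y
  proof -
    \<comment> \<open>At \<open>w\<close> the kernel of the Bargmann transform is the character with frequency \<open>y\<close>.\<close>
    define w where "w = (\<i> / (2 * of_real pi)) *s cvec y"
    have w: "(2 * of_real pi) *s w = \<i> *s cvec y" by (simp add: w_def)
    have "(\<integral>u. H u * cis (y \<bullet> u) \<partial>lborel) = bargmann f w"
      unfolding bargmann_def H_def by (simp add: w_def cdot_linear cdot_cvec cis_conv_exp)
    also have "\<dots> = ?F0 * exp (cdot b w + quad B w / 2)" by (rule eq)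
    finally have 1: "(\<integral>u. H u * cis (y \<bullet> u) \<partial>lborel) = ?F0 * exp (cdot b w + quad B w / 2)" .
    define s where "s = inverse (2 * of_real pi) *s (b + B *v w)"
    have cc: "c * inverse (2 * of_real pi) = 2 * of_real pi" by (simp add: c_def power2_eq_square)
    have NBw: "N *v (B *v w) = w" by (simp add: matrix_vector_mul_assoc NB)
    have "M *v s = c *s (N *v s)" by (rule M)
    also have "N *v s = inverse (2 * of_real pi) *s (N *v b + w)"
      by (simp only: s_def vector_scalar_commute matrix_vector_right_distrib NBw)
    also have "c *s \<dots> = (2 * of_real pi) *s (N *v b + w)"
      by (simp only: vector_smult_assoc cc)
    finally have Ms: "M *v s = a + \<i> *s cvec y"
      by (simp add: a_def vector_add_ldistrib w)
    have "quad M s = quad N (b + B *v w)"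
      unfolding quadM s_def quad_scale c_def by (simp add: power2_eq_square field_simps)
    also have "\<dots> = quad N b + 2 * cdot b w + quad B w"
    proof -
      have "quad N (B *v w) = quad B w" "cdot (N *v b) (B *v w) = cdot b w"
        using cdot_matrix[OF symN, of b "B *v w"] NBw by (simp_all add: quad_def cdot_commute)
      then show ?thesis by (simp add: quad_add[OF symN])
    qed
    finally have qs: "quad M s / 2 = quad N b / 2 + (cdot b w + quad B w / 2)" by simp
    have "(\<integral>u. k u * cis (y \<bullet> u) \<partial>lborel) = gauss_laplace M (a + \<i> *s cvec y)"
      unfolding gauss_laplace_def k_def by (simp add: cdot_linear cdot_cvec cis_conv_exp exp_add[symmetric] algebra_simps)
    also have "\<dots> = exp (quad N b / 2) * exp (cdot b w + quad B w / 2) * J"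
      using gauss_laplace_shift[OF symM posM, of s] unfolding Ms qs J_def exp_add .
    finally have "(\<integral>u. k u * cis (y \<bullet> u) \<partial>lborel) = exp (quad N b / 2) * exp (cdot b w + quad B w / 2) * J" .
    then show ?thesis unfolding 1 using J by (simp add: \<kappa>_def)
  qed
  have "AE u in lborel. H u - \<kappa> * k u = 0"
  proof (rule fourier_injective)
    show "integrable lborel (\<lambda>u. H u - \<kappa> * k u)" using H k by simp
    show "(\<integral>u. (H u - \<kappa> * k u) * cis (y \<bullet> u) \<partial>lborel) = 0" for y
      using ft[of y] Hc[OF H, of y] Hc[OF k, of y] by (simp add: left_diff_distrib mult.assoc)
  qed
  moreover define Q where "Q = (\<lambda>u. (- quad M (cvec u) / 2 + of_real pi * of_real (u \<bullet> u)) + cdot a (cvec u) + Ln \<kappa>)"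
  have "f u = exp (Q u)" if "H u - \<kappa> * k u = 0" for u
  proof -
    have "exp (of_real pi * of_real (u \<bullet> u)) * gauss_weight u = 1"
      by (simp add: gauss_weight_def exp_of_real[symmetric] exp_add[symmetric] power2_norm_eq_inner)
    then have "f u = exp (of_real pi * of_real (u \<bullet> u)) * H u"
      by (simp add: H_def mult_ac)
    also have "\<dots> = exp (of_real pi * of_real (u \<bullet> u)) * (exp (Ln \<kappa>) * k u)"
      using that \<kappa> by simp
    also have "\<dots> = exp (Q u)"
      unfolding Q_def k_def exp_add[symmetric] by (simp add: algebra_simps)
    finally show ?thesis .
  qed
  ultimately have "AE u in lborel. f u = exp (Q u)"
    by auto
  moreover have "quadratic_polynomial Q"
    unfolding quadratic_polynomial_def
  proof (intro exI allI)
    let ?A = "\<chi> i j. - M $ i $ j / 2 + of_real pi * (if i = j then 1 else 0)"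
    fix x :: "real^'n"
    have "quad M (cvec x) = (\<Sum>i\<in>UNIV. \<Sum>j\<in>UNIV. M $ i $ j * of_real (x $ i) * of_real (x $ j))"
      by (simp add: quad_def cdot_def cvec_def matrix_vector_mult_def sum_distrib_left mult_ac)
    moreover have "of_real (x \<bullet> x) = (\<Sum>i\<in>UNIV. \<Sum>j\<in>UNIV. (if i = j then 1 else 0) * of_real (x $ i) * complex_of_real (x $ j))"
      by (simp add: inner_vec_def if_distrib[of "\<lambda>a. a * _"] cong: if_cong)
    ultimately have "- quad M (cvec x) / 2 + of_real pi * of_real (x \<bullet> x)
        = (\<Sum>i\<in>UNIV. \<Sum>j\<in>UNIV. ?A $ i $ j * of_real (x $ i) * of_real (x $ j))"
      by (simp add: sum_distrib_left sum_divide_distrib sum_subtractf[symmetric] sum_negf[symmetric] sum.distrib[symmetric] algebra_simps del: sum_subtractf sum.distrib)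
    then show "Q x = (\<Sum>i\<in>UNIV. \<Sum>j\<in>UNIV. ?A $ i $ j * of_real (x $ i) * of_real (x $ j)) + (\<Sum>i\<in>UNIV. a $ i * of_real (x $ i)) + Ln \<kappa>"
      by (simp add: Q_def cdot_def cvec_def)
  qed
  ultimately show ?thesis by blast
qed

section \<open>From the Wigner distribution to Gaussians\<close>

lemma bargmann_imp_AE_zero:
  fixes h :: "real ^ 'n \<Rightarrow> complex"
  assumes h: "borel_L2 h" and zero: "\<And>z. bargmann h z = 0"
  shows "AE u in lborel. h u = 0"
proof -
  have "AE u in lborel. h u * gauss_weight u = 0"
  proof (rule fourier_injective)
    show "integrable lborel (\<lambda>u. h u * gauss_weight u)"
      using integrable_gauss_weight[OF h, of "\<lambda>_. 1" 0] by simp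
    show "(\<integral>u. h u * gauss_weight u * cis (y \<bullet> u) \<partial>lborel) = 0" for y
      using zero[of "(\<i> / (2 * of_real pi)) *s cvec y"]
      by (simp add: bargmann_def cdot_linear cdot_cvec cis_conv_exp)
  qed
  then show ?thesis by simp
qed

lemma bargmann_diff_cmult:
  fixes f g :: "real ^ 'n \<Rightarrow> complex"
  assumes f: "borel_L2 f" and g: "borel_L2 g"
  shows "bargmann (\<lambda>u. f u - c * g u) z = bargmann f z - c * bargmann g z"
proof -
  have int: "integrable lborel (\<lambda>u. h u * gauss_weight u * exp (2 * pi * cdot z (cvec u)))" if "borel_L2 h" for h :: "real^'n \<Rightarrow> complex"
  proof -
    note [measurable] = borel_L2_measurable[OF that]
    have m: "(\<lambda>u. h u * gauss_weight u * exp (2 * pi * cdot z (cvec u))) \<in> borel_measurable lborel"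
      by measurable
    have "integrable lborel (\<lambda>u. norm (h u * gauss_weight u * exp (2 * pi * cdot z (cvec u))))"
      using bargmann_dominated[OF that order_refl, of z 0] by (simp del: norm_exp_eq_Re)
    then show ?thesis
      by (rule integrable_norm_cancel[OF _ m])
  qed
  show ?thesis
    unfolding bargmann_def left_diff_distrib using int[OF f] int[OF g] by (simp add: mult.assoc)
qed

lemma Re_wig_pos_imp_gaussian:
  fixes f g :: "real ^ 'n \<Rightarrow> complex"
  assumes f: "borel_L2 f" and g: "borel_L2 g" and pos: "\<And>z. Re (wig f g z) > 0"
  obtains Q c where "quadratic_polynomial Q" "AE u in lborel. g u = exp (Q u)" "AE u in lborel. f u = c * exp (Q u)" "c \<noteq> 0"
proof -
  note bpos = Re_wig_pos_imp_bargmann[OF f g pos]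
  have nz: "bargmann f z \<noteq> 0" "bargmann g z \<noteq> 0" for z
    using bpos[of z] by auto
  obtain Q where Q: "quadratic_polynomial Q" "AE u in lborel. g u = exp (Q u)"
    using bargmann_zero_free_imp_gaussian[OF g nz(2)] by blast
  define c where "c = bargmann f 0 / bargmann g 0"
  have "bargmann (\<lambda>u. f u - c * g u) z = 0" for z
    using bargmann_proportional[OF f g bpos, of z] unfolding bargmann_diff_cmult[OF f g] c_def by (simp only: right_minus_eq)
  then have "AE u in lborel. f u - c * g u = 0"
    by (intro bargmann_imp_AE_zero borel_L2_diff f borel_L2_cmult g)
  with Q(2) have "AE u in lborel. f u = c * exp (Q u)"
    by eventually_elim simp
  then show ?thesis
    using that[of Q c] Q nz by (simp add: c_def)
qed

lemma square_integrable_borel_representative: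
  fixes f :: "real ^ 'n \<Rightarrow> complex"
  assumes "square_integrable f"
  obtains f' where "borel_L2 f'" "AE x in lborel. f x = f' x"
proof -
  have fm: "f \<in> borel_measurable lebesgue" and int: "integrable lebesgue (\<lambda>x. (cmod (f x))\<^sup>2)"
    using assms by (auto simp: square_integrable_def)
  obtain r where r [measurable]: "r \<in> borel_measurable lborel" "AE x in lborel. Re (f x) = r x"
    using completion_ex_borel_measurable_real[of "\<lambda>x. Re (f x)" lborel] fm by auto
  obtain s where s [measurable]: "s \<in> borel_measurable lborel" "AE x in lborel. Im (f x) = s x"
    using completion_ex_borel_measurable_real[of "\<lambda>x. Im (f x)" lborel] fm by auto
  define f' where "f' = (\<lambda>x. of_real (r x) + \<i> * of_real (s x))"
  have m [measurable]: "f' \<in> borel_measurable borel"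
    using r(1) s(1) unfolding f'_def by measurable
  have ae: "AE x in lborel. f x = f' x"
    using r(2) s(2) by eventually_elim (simp add: f'_def complex_eq_iff)
  have "integrable lebesgue (\<lambda>x. (cmod (f' x))\<^sup>2)"
  proof (rule integrable_cong_AE_imp[OF int])
    show "AE x in lebesgue. (cmod (f x))\<^sup>2 = (cmod (f' x))\<^sup>2"
      by (rule AE_completion) (use ae in eventually_elim, simp)
  qed (intro measurable_completion, measurable)
  then have "integrable lborel (\<lambda>x. (cmod (f' x))\<^sup>2)"
    by (subst (asm) integrable_completion) auto
  with m have "borel_L2 f'" by (simp add: borel_L2_def)
  with ae show ?thesis by (rule that[rotated])
qed

lemma AE_lborel_affine:
  fixes P :: "'a::euclidean_space \<Rightarrow> bool"
  assumes P: "AE x in lborel. P x" and c: "c \<noteq> 0"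
  shows "AE x in lborel. P (t + c *\<^sub>R x)"
proof -
  obtain N where N: "N \<in> null_sets lborel" "{x. \<not> P x} \<subseteq> N"
    using P by (auto elim!: AE_E simp: null_sets_def)
  have [measurable]: "N \<in> sets borel" using N by auto
  have "AE x in lborel. x \<notin> N" using N by (intro AE_not_in)
  then have "AE x in density (distr lborel borel (\<lambda>x. t + c *\<^sub>R x)) (\<lambda>_. ennreal (\<bar>c\<bar>^DIM('a))). x \<notin> N"
    unfolding lborel_affine[OF c, of t, symmetric] .
  then have "AE x in distr lborel borel (\<lambda>x. t + c *\<^sub>R x). x \<notin> N"
    using c by (subst (asm) AE_density) auto
  then have "AE x in lborel. t + c *\<^sub>R x \<notin> N"
    by (subst (asm) AE_distr_iff) auto
  then show ?thesis
    by eventually_elim (use N in auto)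
qed

text \<open>
  Null sets are preserved by the affine maps \<open>t \<mapsto> x + t / 2\<close> and \<open>t \<mapsto> x - t / 2\<close>, so for every point \<open>z\<close> the integrands of both
  sides agree almost everywhere; the power of two is the Jacobian of \<open>t = 2 s\<close>.
\<close>
lemma wigner_eq_wig:
  fixes f g f' g' :: "real ^ 'n \<Rightarrow> complex"
  assumes f': "borel_L2 f'" "AE x in lborel. f x = f' x" and g': "borel_L2 g'" "AE x in lborel. g x = g' x"
  shows "wigner f g z = of_real (2 ^ CARD('n)) * wig f' g' z"
proof -
  obtain x \<xi> where z: "z = (x, \<xi>)" by (cases z)
  note [measurable] = f'(1)[THEN borel_L2_measurable] g'(1)[THEN borel_L2_measurable]
  let ?h = "\<lambda>t. f (x + t /\<^sub>R 2) * cnj (g (x - t /\<^sub>R 2)) * exp (- 2 * of_real pi * \<i> * of_real (\<xi> \<bullet> t))"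
  let ?k = "\<lambda>t. f' (x + (1/2) *\<^sub>R t) * cnj (g' (x + (- 1/2) *\<^sub>R t)) * cis (- (2 * pi * (\<xi> \<bullet> t)))"
  have k [measurable]: "?k \<in> borel_measurable borel" by measurable
  have "AE t in lborel. f (x + (1/2) *\<^sub>R t) = f' (x + (1/2) *\<^sub>R t)"
    by (rule AE_lborel_affine[OF f'(2)]) simp
  moreover have "AE t in lborel. g (x + (- 1/2) *\<^sub>R t) = g' (x + (- 1/2) *\<^sub>R t)"
    by (rule AE_lborel_affine[OF g'(2)]) simp
  ultimately have "AE t in lborel. ?k t = ?h t"
  proof eventually_elim
    case (elim t)
    have "cis (- (2 * pi * (\<xi> \<bullet> t))) = exp (- 2 * of_real pi * \<i> * of_real (\<xi> \<bullet> t))"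
      by (simp add: cis_conv_exp mult_ac)
    moreover have "t /\<^sub>R 2 = (1/2) *\<^sub>R t" "x - (1/2) *\<^sub>R t = x + (- 1/2) *\<^sub>R t"
      by (simp_all add: inverse_eq_divide)
    ultimately show ?case using elim by (simp only:)
  qed
  then have ae: "AE t in lebesgue. ?k t = ?h t"
    by (rule AE_completion)
  have kl: "?k \<in> borel_measurable lebesgue"
    by (intro measurable_completion) (use k in simp)
  have hl: "?h \<in> borel_measurable lebesgue"
    by (rule borel_measurable_AE[OF kl ae])
  have "wigner f g z = integral\<^sup>L lebesgue ?h"
    by (simp add: wigner_def z)
  also have "\<dots> = integral\<^sup>L lebesgue ?k"
    by (rule integral_cong_AE[OF hl kl]) (use ae in eventually_elim, simp)
  also have "\<dots> = integral\<^sup>L lborel ?k"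
    by (rule integral_completion) (use k in simp)
  also have "\<dots> = \<bar>2\<bar> ^ DIM(real^'n) *\<^sub>R (\<integral>s. ?k (0 + 2 *\<^sub>R s) \<partial>lborel)"
    by (rule lborel_integral_affine[OF k]) simp
  also have "(\<integral>s. ?k (0 + 2 *\<^sub>R s) \<partial>lborel) = wig f' g' z"
    by (simp add: wig_def z mult.assoc[symmetric])
  finally show ?thesis by (simp add: scaleR_conv_of_real)
qed

text \<open>
  Square integrability of the exponential is inherited from \<open>f\<close>, of which it is almost everywhere a
  multiple.
\<close>
lemma generalized_gaussian_exp:
  assumes "square_integrable f" "quadratic_polynomial Q" "AE x in lebesgue. f x = c * exp (Q x)" "c \<noteq> 0"
  shows "generalized_gaussian (\<lambda>x. exp (Q x))"
proof -
  have "continuous_on UNIV Q"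
  proof -
    obtain A b d where "\<And>x. Q x = (\<Sum>i\<in>UNIV. \<Sum>j\<in>UNIV. A $ i $ j * of_real (x $ i) * of_real (x $ j))
              + (\<Sum>i\<in>UNIV. b $ i * of_real (x $ i)) + d"
      using assms(2) unfolding quadratic_polynomial_def by blast
    then have "Q = (\<lambda>x. (\<Sum>i\<in>UNIV. \<Sum>j\<in>UNIV. A $ i $ j * of_real (x $ i) * of_real (x $ j))
              + (\<Sum>i\<in>UNIV. b $ i * of_real (x $ i)) + d)" by (rule ext)
    then show ?thesis by simp (intro continuous_intros)
  qed
  then have m: "(\<lambda>x. exp (Q x)) \<in> borel_measurable lebesgue"
    by (intro measurable_completion) (auto intro!: borel_measurable_continuous_onI continuous_intros)
  have int: "integrable lebesgue (\<lambda>x. (cmod (f x))\<^sup>2 / (cmod c)\<^sup>2)"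
    using assms(1) by (simp add: square_integrable_def)
  have "integrable lebesgue (\<lambda>x. (cmod (exp (Q x)))\<^sup>2)"
  proof (rule integrable_cong_AE_imp[OF int])
    show "AE x in lebesgue. (cmod (f x))\<^sup>2 / (cmod c)\<^sup>2 = (cmod (exp (Q x)))\<^sup>2"
      using assms(3) by eventually_elim (use assms(4) in \<open>simp add: norm_mult power_mult_distrib del: norm_exp_eq_Re\<close>)
    show "(\<lambda>x. (cmod (exp (Q x)))\<^sup>2) \<in> borel_measurable lebesgue"
      by (rule measurable_compose[OF m, of "\<lambda>w. (cmod w)\<^sup>2" borel]) measurable
  qed
  with m assms(2) show ?thesis
    unfolding generalized_gaussian_def square_integrable_def by blast
qed

lemma quadratic_polynomial_add_const:
  assumes "quadratic_polynomial Q"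
  shows "quadratic_polynomial (\<lambda>x. Q x + d)"
proof -
  obtain A b c where "\<And>x. Q x = (\<Sum>i\<in>UNIV. \<Sum>j\<in>UNIV. A $ i $ j * of_real (x $ i) * of_real (x $ j))
              + (\<Sum>i\<in>UNIV. b $ i * of_real (x $ i)) + c"
    using assms unfolding quadratic_polynomial_def by blast
  then show ?thesis
    unfolding quadratic_polynomial_def
    by (intro exI[of _ A] exI[of _ b] exI[of _ "c + d"]) (simp add: add.assoc)
qed

text \<open>
  The factor \<open>\<omega>\<close> covers both cases of the theorem: it is \<open>1\<close> for the real part and \<open>i\<close> for the imaginary part, and
  it is absorbed into \<open>f\<close> together with the constant sign of the real part.
\<close>
lemma wigner_phase_nonvanishing_imp_gaussian:
  fixes f g :: "real ^ 'n \<Rightarrow> complex"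
  assumes f: "square_integrable f" and g: "square_integrable g"
    and \<omega>: "\<omega> \<noteq> 0" and nz: "\<And>z. Re (\<omega> * wigner f g z) \<noteq> 0"
  obtains Q c where "quadratic_polynomial Q" "generalized_gaussian (\<lambda>x. exp (Q x))" "c \<noteq> 0"
    "AE x in lebesgue. f x = c * exp (Q x)" "AE x in lebesgue. g x = exp (Q x)"
proof -
  obtain f' where f': "borel_L2 f'" "AE x in lborel. f x = f' x"
    using square_integrable_borel_representative[OF f] by blast
  obtain g' where g': "borel_L2 g'" "AE x in lborel. g x = g' x"
    using square_integrable_borel_representative[OF g] by blast
  have "continuous_on UNIV (\<lambda>z. Re (\<omega> * wig f' g' z))"
    by (intro continuous_intros continuous_on_wig f' g')
  moreover have "Re (\<omega> * wig f' g' z) \<noteq> 0" for z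
  proof -
    have "\<omega> * wigner f g z = of_real (2 ^ CARD('n)) * (\<omega> * wig f' g' z)"
      unfolding wigner_eq_wig[OF f' g'] by (simp only: mult_ac)
    moreover have "Re (of_real t * w) = t * Re w" for t w
      by simp
    ultimately show ?thesis
      using nz[of z] by (metis mult_zero_right)
  qed
  ultimately consider "\<forall>z. Re (\<omega> * wig f' g' z) > 0" | "\<forall>z. Re (\<omega> * wig f' g' z) < 0"
    using nonvanishing_constant_sign by blast
  then obtain \<omega>' where \<omega>': "\<omega>' \<noteq> 0" "\<And>z. Re (\<omega>' * wig f' g' z) > 0"
  proof cases
    case 1
    then show ?thesis using \<omega> that[of \<omega>] by blast
  next
    case 2
    have "Re (- \<omega> * wig f' g' z) > 0" for z
      using 2[rule_format, of z] by simp
    then show ?thesis using \<omega> that[of "- \<omega>"] by (metis neg_equal_0_iff_equal)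
  qed
  have "Re (wig (\<lambda>u. \<omega>' * f' u) g' z) > 0" for z
    unfolding wig_cmult_left by (rule \<omega>'(2))
  then obtain Q c where Q: "quadratic_polynomial Q" "c \<noteq> 0" and ae: "AE u in lborel. g' u = exp (Q u)" "AE u in lborel. \<omega>' * f' u = c * exp (Q u)"
    by (rule Re_wig_pos_imp_gaussian[OF borel_L2_cmult[OF f'(1)] g'(1)]) blast
  have "AE u in lborel. f u = (c / \<omega>') * exp (Q u)"
    using ae(2) f'(2) by eventually_elim (use \<omega>'(1) in \<open>simp add: field_simps\<close>)
  then have fl: "AE u in lebesgue. f u = (c / \<omega>') * exp (Q u)"
    by (rule AE_completion)
  have "AE u in lborel. g u = exp (Q u)"
    using ae(1) g'(2) by eventually_elim simp
  then have gl: "AE u in lebesgue. g u = exp (Q u)"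
    by (rule AE_completion)
  have "generalized_gaussian (\<lambda>x. exp (Q x))"
    using generalized_gaussian_exp[OF g Q(1), of 1] gl by simp
  then show ?thesis
    using that[of Q "c / \<omega>'"] Q \<omega>'(1) fl gl by simp
qed

theorem theorem5p4:
  fixes f g :: "real ^ 'n \<Rightarrow> complex"
  assumes "square_integrable f" and "square_integrable g"
  shows "((\<forall>z. Re (wigner f g z) \<noteq> 0) \<longrightarrow>
            (\<exists>\<gamma> a b. generalized_gaussian \<gamma> \<and>
               (AE x in lebesgue. f x = a * \<gamma> x) \<and> (AE x in lebesgue. g x = b * \<gamma> x)))
       \<and> ((\<forall>z. Im (wigner f g z) \<noteq> 0) \<longrightarrow>
            (\<exists>\<gamma>. generalized_gaussian \<gamma> \<and> (AE x in lebesgue. f x = \<gamma> x)) \<and>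
            (\<exists>\<gamma>. generalized_gaussian \<gamma> \<and> (AE x in lebesgue. g x = \<gamma> x)))"
proof (intro conjI impI)
  assume "\<forall>z. Re (wigner f g z) \<noteq> 0"
  then have "Re (1 * wigner f g z) \<noteq> 0" for z unfolding mult_1 by blast
  then obtain Q c where "generalized_gaussian (\<lambda>x. exp (Q x))"
    "AE x in lebesgue. f x = c * exp (Q x)" "AE x in lebesgue. g x = exp (Q x)"
    by (rule wigner_phase_nonvanishing_imp_gaussian[OF assms one_neq_zero])
  then show "\<exists>\<gamma> a b. generalized_gaussian \<gamma> \<and>
               (AE x in lebesgue. f x = a * \<gamma> x) \<and> (AE x in lebesgue. g x = b * \<gamma> x)"
    by (intro exI[of _ "\<lambda>x. exp (Q x)"] exI[of _ c] exI[of _ 1]) simp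
next
  assume "\<forall>z. Im (wigner f g z) \<noteq> 0"
  then have "Re (\<i> * wigner f g z) \<noteq> 0" for z by (metis Re_i_times neg_equal_0_iff_equal)
  then obtain Q c where Q: "quadratic_polynomial Q" "generalized_gaussian (\<lambda>x. exp (Q x))" "c \<noteq> 0"
    and f: "AE x in lebesgue. f x = c * exp (Q x)" and g: "AE x in lebesgue. g x = exp (Q x)"
    by (rule wigner_phase_nonvanishing_imp_gaussian[OF assms complex_i_not_zero])
  show "\<exists>\<gamma>. generalized_gaussian \<gamma> \<and> (AE x in lebesgue. g x = \<gamma> x)"
    using Q g by blast
  have c: "c * exp (Q x) = exp (Q x + Ln c)" for x
    using Q(3) by (simp add: exp_add)
  have "generalized_gaussian (\<lambda>x. exp (Q x + Ln c))"
    using generalized_gaussian_exp[OF assms(1) quadratic_polynomial_add_const[OF Q(1)], of 1] f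
    by (simp add: c)
  then show "\<exists>\<gamma>. generalized_gaussian \<gamma> \<and> (AE x in lebesgue. f x = \<gamma> x)"
    using f unfolding c by blast
qed

end
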